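(* Let $f:\Sigma_g\to(\vee^gS^1)\times(\vee^gS^1)$ be a locally injective Stallings map describing a Heegaard splitting. Let $p_1,p_2$ be the coordinate projections of $T_1\times T_2$. The Guirardel core of the actions of $\pi_1(\Sigma_g)$ on $T_1$ and $T_2$ is the smallest set $X\subseteq T_1\times T_2$ such that $\hat f(S)\subseteq X$ and the fibres $p_1^{-1}(t)\cap X$ are connected for every $t\in T_1$ and $p_2^{-1}(t)\cap X$ are connected for every $t\in T_2$.
   Context: A Heegaard splitting of genus $g$ of a closed orientable 3-manifold $M$ is a decomposition $M=\mathcal{H}_1\cup\mathcal{H}_2$ into two genus-$g$ handlebodies intersecting exactly in their common boundary $\Sigma_g$; $\iota_i:\Sigma_g\to\mathcal{H}_i$ is the inclusion. A Stallings map for it is a map $f=f_1\times f_2:\Sigma_g\to(\vee^gS^1)\times(\vee^gS^1)$ with $f_i\simeq d_i\circ\iota_i$ for some homotopy equivalences $d_i:\mathcal{H}_i\to\vee^gS^1$. Standing assumptions: $S^2\times S^1$ is not a connect summand of $M$; $f$ is taut, and $\Sigma_g$ carries the square complex structure dual to the Heegaard diagram of $f$, for which $f$ is a combinatorial map of square complexes (each open cell is sent homeomorphically onto an open cell of the product square complex $(\vee^gS^1)\times(\vee^gS^1)$). Here the Heegaard diagram of $f$ consists of the two families of $g$ disjoint simple closed curves obtained as preimages under $f_1$, resp. $f_2$, of the midpoints of the circles of $\vee^gS^1$. $f$ is taut if every connected component of the complement of the diagram intersects each side of each diagram curve in at most one connected component (the sides of a curve $\gamma$ are the two components of arbitrarily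 small annular neighbourhoods of $\gamma$ minus $\gamma$; the number of components is counted in the limit of small neighbourhoods). $T_1,T_2$ are copies of the universal cover of $\vee^gS^1$ (trees with edges of length 1). $S$ is the cover of $\Sigma_g$ corresponding to $\ker(f_*:\pi_1(\Sigma_g)\to\pi_1((\vee^gS^1)\times(\vee^gS^1)))$ and $\hat f:S\to T_1\times T_2$ is the lift of $f$. An element $\alpha\in\pi_1(\Sigma_g)$ acts on $T_i$ by the deck transformation $f_{i*}(\alpha)\in F_g$, and diagonally on $T_1\times T_2$. Guirardel core: a direction in a tree $T$ is a connected component of $T\setminus\{x\}$ for a point $x\in T$. A quadrant in $T_1\times T_2$ is a product $\delta_1\times\delta_2$ of directions $\delta_i\subset T_i$. Given a base point $(t_1,t_2)$, a quadrant $Q=\delta_1\times\delta_2$ is heavy if there is a sequence $\gamma_n$ in the group with $\gamma_n\cdot(t_1,t_2)\in Q$ for all $n$ and with the distance between $t_i$ and $\gamma_n\cdot t_i$ in $T_i$ tending to $\infty$ for $i=1,2$; it is light otherwise. The core is the complement in $T_1\times T_2$ of the union of all light quadrants. *)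

theory Defs
  imports "HOL-Analysis.Analysis" "HOL-Homology.Homology"
begin

section \<open>Fundamental groups, covers and deck transformations\<close>

definition path_class :: "'a::topological_space set \<Rightarrow> (real \<Rightarrow> 'a) \<Rightarrow> (real \<Rightarrow> 'a) set" where
  "path_class X p = {q. homotopic_paths X p q}"

definition loops_at :: "'a::topological_space set \<Rightarrow> 'a \<Rightarrow> (real \<Rightarrow> 'a) set" where
  "loops_at X x = {p. path p \<and> path_image p \<subseteq> X \<and> pathstart p = x \<and> pathfinish p = x}"

definition pi1 :: "'a::topological_space set \<Rightarrow> 'a \<Rightarrow> (real \<Rightarrow> 'a) set monoid" where
  "pi1 X x = \<lparr>carrier = path_class X ` loops_at X x,
              mult = (\<lambda>c d. \<Union>p\<in>c. \<Union>q\<in>d. path_class X (p +++ q)),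
              one = path_class X (\<lambda>_. x)\<rparr>"

definition pi1_map ::
    "'b::topological_space set \<Rightarrow> ('a::topological_space \<Rightarrow> 'b) \<Rightarrow> (real \<Rightarrow> 'a) set \<Rightarrow> (real \<Rightarrow> 'b) set" where
  "pi1_map Y f c = (\<Union>p\<in>c. path_class Y (f \<circ> p))"

text \<open>
  The action of a class \<open>c\<close> of loops at \<open>q t\<close> on the universal cover \<open>q : T \<rightarrow> q ` T\<close> based at \<open>t\<close>:
  the deck transformation that carries \<open>t\<close> to the end point of the lift at \<open>t\<close> of a loop in \<open>c\<close>.
  The extensionality requirement only fixes the irrelevant values outside \<open>T\<close>.
\<close>
definition deck_action ::
    "'a::topological_space set \<Rightarrow> ('a \<Rightarrow> 'b::topological_space) \<Rightarrow> 'a \<Rightarrow> (real \<Rightarrow> 'b) set \<Rightarrow> 'a \<Rightarrow> 'a" where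
  "deck_action T q t c =
     (THE h. h \<in> extensional T \<and> (\<exists>h'. homeomorphism T T h h') \<and> (\<forall>y\<in>T. q (h y) = q y) \<and>
             (\<exists>l. path l \<and> path_image l \<subseteq> T \<and> pathstart l = t \<and> pathfinish l = h t \<and> q \<circ> l \<in> c))"

section \<open>The wedge of circles and its universal cover\<close>

text \<open>
  The wedge of \<open>g\<close> circles is realised by the circles of radius \<open>k\<close> around \<open>k\<close> in the complex plane,
  for \<open>k = 1, \<dots>, g\<close>. Any two of them meet exactly in the wedge point \<open>0\<close>, and the
  midpoint of the \<open>k\<close>-th circle (the point opposite to \<open>0\<close>) is \<open>2 k\<close>.
\<close>
definition rose :: "nat \<Rightarrow> complex set" where
  "rose g = insert 0 (\<Union>k\<in>{1..g}. sphere (of_nat k) (real k))"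

definition rose_edge :: "nat \<Rightarrow> complex set" where
  "rose_edge k = sphere (of_nat k) (real k) - {0}"

definition rose_midpoint :: "nat \<Rightarrow> complex" where
  "rose_midpoint k = of_nat (2 * k)"

definition rose_cells :: "nat \<Rightarrow> complex set set" where
  "rose_cells g = insert {0} (rose_edge ` {1..g})"

definition isometric_segment :: "'a::metric_space set \<Rightarrow> real \<Rightarrow> (real \<Rightarrow> 'a) \<Rightarrow> bool" where
  "isometric_segment T l u \<longleftrightarrow>
     u ` {0..l} \<subseteq> T \<and> (\<forall>r\<in>{0..l}. \<forall>s\<in>{0..l}. dist (u r) (u s) = \<bar>r - s\<bar>)"

text \<open>
  The last two conditions say that the distance on \<open>T\<close> is the path metric for which
  every edge (a component of the preimage of an open circle) has length 1.
\<close>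
definition rose_universal_cover :: "nat \<Rightarrow> 'a::metric_space set \<Rightarrow> ('a \<Rightarrow> complex) \<Rightarrow> bool" where
  "rose_universal_cover g T q \<longleftrightarrow>
     covering_space T q (rose g) \<and> simply_connected T \<and>
     (\<forall>k\<in>{1..g}. \<forall>e\<in>components {y\<in>T. q y \<in> rose_edge k}.
        \<exists>u. isometric_segment T 1 u \<and> u ` {0<..<1} = e) \<and>
     (\<forall>x\<in>T. \<forall>y\<in>T. \<exists>u. isometric_segment T (dist x y) u \<and> u 0 = x \<and> u (dist x y) = y)"

section \<open>3-manifolds and Heegaard splittings\<close>

definition closed_3manifold :: "'a::t2_space set \<Rightarrow> bool" where
  "closed_3manifold M \<longleftrightarrow>
     compact M \<and>
     (\<forall>x\<in>M. \<exists>U. openin (top_of_set M) U \<and> x \<in> U \<and> U homeomorphic (UNIV :: (real^3) set))"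

text \<open>
  An orientation is a locally consistent choice of generators of the local homology groups
  \<open>H\<^sub>3(M, M - x)\<close>.
\<close>
definition orientable_3manifold :: "'a::t2_space set \<Rightarrow> bool" where
  "orientable_3manifold M \<longleftrightarrow>
     (\<exists>\<mu>. (\<forall>x\<in>M. \<mu> x \<in> carrier (relative_homology_group 3 (top_of_set M) (M - {x})) \<and>
              generate (relative_homology_group 3 (top_of_set M) (M - {x})) {\<mu> x} =
                carrier (relative_homology_group 3 (top_of_set M) (M - {x}))) \<and>
          (\<forall>x\<in>M. \<exists>U. openin (top_of_set M) U \<and> x \<in> U \<and>
             (\<exists>c \<in> carrier (relative_homology_group 3 (top_of_set M) (M - U)).
                \<forall>y\<in>U. hom_induced 3 (top_of_set M) (M - U) (top_of_set M) (M - {y}) id c = \<mu> y)))"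

text \<open>
  The embedded balls removed in a connected sum are required to extend to a larger open ball, so
  that their boundary spheres are flat.
\<close>
definition flat_ball_embedding :: "'a::t2_space set \<Rightarrow> (real^3 \<Rightarrow> 'a) \<Rightarrow> bool" where
  "flat_ball_embedding A e \<longleftrightarrow>
     openin (top_of_set A) (e ` ball 0 2) \<and> (\<exists>e'. homeomorphism (ball 0 2) (e ` ball 0 2) e e')"

definition connected_sum :: "'m::t2_space set \<Rightarrow> 'a::t2_space set \<Rightarrow> 'b::t2_space set \<Rightarrow> bool" where
  "connected_sum M A B \<longleftrightarrow>
     (\<exists>P Q d e \<phi> \<phi>' \<psi> \<psi>'.
        M = P \<union> Q \<and> closedin (top_of_set M) P \<and> closedin (top_of_set M) Q \<and>
        flat_ball_embedding A d \<and> flat_ball_embedding B e \<and>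
        homeomorphism (A - d ` ball 0 1) P \<phi> \<phi>' \<and> homeomorphism (B - e ` ball 0 1) Q \<psi> \<psi>' \<and>
        \<phi> ` d ` sphere 0 1 = P \<inter> Q \<and> \<psi> ` e ` sphere 0 1 = P \<inter> Q)"

text \<open>
  The complementary summand \<open>N\<close> ranges over subspaces of \<open>\<real>\<^sup>\<omega>\<close>; this is no restriction, since
  every closed manifold is compact and metrizable and hence embeds there.
\<close>
definition S2xS1_summand :: "'m::t2_space set \<Rightarrow> bool" where
  "S2xS1_summand M \<longleftrightarrow>
     (\<exists>N :: (nat \<Rightarrow> real) set.
        closed_3manifold N \<and> connected_sum M N (sphere (0::real^3) 1 \<times> sphere (0::complex) 1))"

text \<open>
  A 3-ball with \<open>g\<close> orientable 1-handles attached is a disc with \<open>g\<close> holes times an interval.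
  The model is a closed subset of a 3-dimensional Euclidean space, and its
  frontier there is its boundary as a manifold.
\<close>
definition handlebody_model :: "nat \<Rightarrow> (complex \<times> real) set" where
  "handlebody_model g = (cball 0 (real g + 1) - (\<Union>k\<in>{1..g}. ball (of_nat k) (1/4))) \<times> {0..1}"

definition handlebody :: "nat \<Rightarrow> 'm::t2_space set \<Rightarrow> 'm set \<Rightarrow> bool" where
  "handlebody g H B \<longleftrightarrow>
     (\<exists>\<phi> \<phi>'. homeomorphism (handlebody_model g) H \<phi> \<phi>' \<and> \<phi> ` frontier (handlebody_model g) = B)"

definition heegaard_splitting :: "nat \<Rightarrow> 'm::t2_space set \<Rightarrow> 'm set \<Rightarrow> 'm set \<Rightarrow> 'm set \<Rightarrow> bool" where
  "heegaard_splitting g M H1 H2 \<Sigma> \<longleftrightarrow>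
     M = H1 \<union> H2 \<and> H1 \<inter> H2 = \<Sigma> \<and> handlebody g H1 \<Sigma> \<and> handlebody g H2 \<Sigma>"

definition homotopy_equivalence_map ::
    "'a::topological_space set \<Rightarrow> 'b::topological_space set \<Rightarrow> ('a \<Rightarrow> 'b) \<Rightarrow> bool" where
  "homotopy_equivalence_map A B d \<longleftrightarrow>
     continuous_on A d \<and> d ` A \<subseteq> B \<and>
     (\<exists>e. continuous_on B e \<and> e ` B \<subseteq> A \<and>
          homotopic_with_canon (\<lambda>_. True) A A (e \<circ> d) id \<and>
          homotopic_with_canon (\<lambda>_. True) B B (d \<circ> e) id)"

definition stallings_map ::
    "nat \<Rightarrow> 'm::t2_space set \<Rightarrow> 'm set \<Rightarrow> 'm set \<Rightarrow> ('m \<Rightarrow> complex \<times> complex) \<Rightarrow> bool" where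
  "stallings_map g H1 H2 \<Sigma> f \<longleftrightarrow>
     continuous_on \<Sigma> f \<and> f ` \<Sigma> \<subseteq> rose g \<times> rose g \<and>
     (\<exists>d1. homotopy_equivalence_map H1 (rose g) d1 \<and>
           homotopic_with_canon (\<lambda>_. True) \<Sigma> (rose g) (fst \<circ> f) d1) \<and>
     (\<exists>d2. homotopy_equivalence_map H2 (rose g) d2 \<and>
           homotopic_with_canon (\<lambda>_. True) \<Sigma> (rose g) (snd \<circ> f) d2)"

definition locally_injective :: "'a::topological_space set \<Rightarrow> ('a \<Rightarrow> 'b) \<Rightarrow> bool" where
  "locally_injective X f \<longleftrightarrow> (\<forall>x\<in>X. \<exists>U. openin (top_of_set X) U \<and> x \<in> U \<and> inj_on f U)"

section \<open>Heegaard diagrams and the dual square complex\<close>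

definition simple_closed_curve :: "'a::topological_space set \<Rightarrow> bool" where
  "simple_closed_curve \<gamma> \<longleftrightarrow> (\<exists>c. simple_path c \<and> pathfinish c = pathstart c \<and> path_image c = \<gamma>)"

definition midpoint_preimages :: "nat \<Rightarrow> 'a set \<Rightarrow> ('a \<Rightarrow> complex) \<Rightarrow> 'a set set" where
  "midpoint_preimages g \<Sigma> h = (\<lambda>k. {x\<in>\<Sigma>. h x = rose_midpoint k}) ` {1..g}"

definition diagram_curves :: "nat \<Rightarrow> 'a set \<Rightarrow> ('a \<Rightarrow> complex \<times> complex) \<Rightarrow> 'a set set" where
  "diagram_curves g \<Sigma> f = midpoint_preimages g \<Sigma> (fst \<circ> f) \<union> midpoint_preimages g \<Sigma> (snd \<circ> f)"

text \<open>
  Both families consist of \<open>g\<close> curves: preimages of distinct midpoints under \<open>f\<^sub>1\<close> (or under \<open>f\<^sub>2\<close>) are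
  disjoint, and simple closed curves are nonempty.
\<close>
definition has_heegaard_diagram ::
    "nat \<Rightarrow> 'a::topological_space set \<Rightarrow> ('a \<Rightarrow> complex \<times> complex) \<Rightarrow> bool" where
  "has_heegaard_diagram g \<Sigma> f \<longleftrightarrow> (\<forall>\<gamma>\<in>diagram_curves g \<Sigma> f. simple_closed_curve \<gamma>)"

definition annular_neighbourhood :: "'a::topological_space set \<Rightarrow> 'a set \<Rightarrow> 'a set \<Rightarrow> bool" where
  "annular_neighbourhood \<Sigma> \<gamma> A \<longleftrightarrow>
     openin (top_of_set \<Sigma>) A \<and>
     (\<exists>\<phi> \<phi>'. homeomorphism (sphere (0::complex) 1 \<times> {-1<..<1::real}) A \<phi> \<phi>' \<and>
             \<phi> ` (sphere 0 1 \<times> {0}) = \<gamma>)"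

text \<open>
  Counting the components of \<open>C \<inter> side\<close> ``in the limit'' is expressed by arbitrarily small annular
  neighbourhoods for which the intersection has at most one component. Asking
  this of every small neighbourhood would be too strong, because an annulus with a wiggly
  boundary can meet \<open>C\<close> in components that stay away from \<open>\<gamma>\<close>.
\<close>
definition taut :: "nat \<Rightarrow> 'a::topological_space set \<Rightarrow> ('a \<Rightarrow> complex \<times> complex) \<Rightarrow> bool" where
  "taut g \<Sigma> f \<longleftrightarrow>
     (\<forall>\<gamma>\<in>diagram_curves g \<Sigma> f. \<forall>U. openin (top_of_set \<Sigma>) U \<and> \<gamma> \<subseteq> U \<longrightarrow>
        (\<exists>A\<subseteq>U. annular_neighbourhood \<Sigma> \<gamma> A \<and>
           (\<forall>side\<in>components (A - \<gamma>). \<forall>C\<in>components (\<Sigma> - \<Union>(diagram_curves g \<Sigma> f)).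
              connected (C \<inter> side))))"

definition open_edge :: "(real \<Rightarrow> 'a) \<Rightarrow> 'a set" where
  "open_edge e = e ` {0<..<1}"

definition open_square :: "(real \<times> real \<Rightarrow> 'a) \<Rightarrow> 'a set" where
  "open_square s = s ` ({0<..<1} \<times> {0<..<1})"

definition open_cells :: "'a set \<Rightarrow> (real \<Rightarrow> 'a) set \<Rightarrow> (real \<times> real \<Rightarrow> 'a) set \<Rightarrow> 'a set set" where
  "open_cells V E Q = (\<lambda>v. {v}) ` V \<union> open_edge ` E \<union> open_square ` Q"

text \<open>
  A finite square complex structure on a compact Hausdorff space, given by its vertices \<open>V\<close> and the
  characteristic maps of its edges (\<open>E\<close>) and squares (\<open>Q\<close>). Every side of a square is attached to an
  edge by an isometry. By finiteness \<open>X\<close> carries the weak topology.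
\<close>
definition square_complex ::
    "'a::t2_space set \<Rightarrow> 'a set \<Rightarrow> (real \<Rightarrow> 'a) set \<Rightarrow> (real \<times> real \<Rightarrow> 'a) set \<Rightarrow> bool" where
  "square_complex X V E Q \<longleftrightarrow>
     finite V \<and> finite E \<and> finite Q \<and>
     (\<forall>e\<in>E. continuous_on {0..1} e \<and> inj_on e {0<..<1} \<and> e 0 \<in> V \<and> e 1 \<in> V) \<and>
     (\<forall>s\<in>Q. continuous_on ({0..1} \<times> {0..1}) s \<and> inj_on s ({0<..<1} \<times> {0<..<1}) \<and>
        (\<forall>side\<in>{\<lambda>t. s (t, 0), \<lambda>t. s (t, 1), \<lambda>t. s (0, t), \<lambda>t. s (1, t)}.
           \<exists>e\<in>E. (\<forall>t\<in>{0..1}. side t = e t) \<or> (\<forall>t\<in>{0..1}. side t = e (1 - t)))) \<and>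
     inj_on open_edge E \<and> inj_on open_square Q \<and>
     (\<forall>v\<in>V. \<forall>e\<in>E. v \<notin> open_edge e) \<and>
     (\<forall>v\<in>V. \<forall>s\<in>Q. v \<notin> open_square s) \<and>
     (\<forall>e\<in>E. \<forall>s\<in>Q. open_edge e \<inter> open_square s = {}) \<and>
     disjoint (open_cells V E Q) \<and> \<Union>(open_cells V E Q) = X"

text \<open>
  Duality with the diagram \<open>A \<union> B\<close>: squares correspond to the points of \<open>A \<inter> B\<close> they contain, edges to
  the arcs of the diagram between such points that they cross (once), and vertices to the
  complementary regions containing them.
\<close>
definition dual_to_diagram ::
    "'a::topological_space set \<Rightarrow> 'a set \<Rightarrow> 'a set \<Rightarrow>
     'a set \<Rightarrow> (real \<Rightarrow> 'a) set \<Rightarrow> (real \<times> real \<Rightarrow> 'a) set \<Rightarrow> bool" where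
  "dual_to_diagram \<Sigma> A B V E Q \<longleftrightarrow>
     (\<forall>s\<in>Q. \<exists>x. open_square s \<inter> (A \<inter> B) = {x}) \<and> (\<forall>x\<in>A \<inter> B. \<exists>s\<in>Q. x \<in> open_square s) \<and>
     (\<forall>e\<in>E. \<exists>x. open_edge e \<inter> (A \<union> B) = {x} \<and> x \<notin> A \<inter> B) \<and>
     (\<forall>a\<in>components ((A \<union> B) - (A \<inter> B)). \<exists>!e. e \<in> E \<and> open_edge e \<inter> a \<noteq> {}) \<and>
     V \<inter> (A \<union> B) = {} \<and> (\<forall>C\<in>components (\<Sigma> - (A \<union> B)). \<exists>v. V \<inter> C = {v})"

definition combinatorial_to_rose_product ::
    "nat \<Rightarrow> ('a::topological_space \<Rightarrow> complex \<times> complex) \<Rightarrow>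
     'a set \<Rightarrow> (real \<Rightarrow> 'a) set \<Rightarrow> (real \<times> real \<Rightarrow> 'a) set \<Rightarrow> bool" where
  "combinatorial_to_rose_product g f V E Q \<longleftrightarrow>
     (\<forall>c\<in>open_cells V E Q. \<exists>a\<in>rose_cells g. \<exists>b\<in>rose_cells g. \<exists>h. homeomorphism c (a \<times> b) f h)"

section \<open>The Guirardel core\<close>

definition directions :: "'a::topological_space set \<Rightarrow> 'a set set" where
  "directions T = (\<Union>x\<in>T. components (T - {x}))"

definition quadrants ::
    "'a::topological_space set \<Rightarrow> 'b::topological_space set \<Rightarrow> ('a \<times> 'b) set set" where
  "quadrants T1 T2 = {\<delta>1 \<times> \<delta>2 | \<delta>1 \<delta>2. \<delta>1 \<in> directions T1 \<and> \<delta>2 \<in> directions T2}"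

definition heavy ::
    "('g, 'r) monoid_scheme \<Rightarrow> ('g \<Rightarrow> 'a::metric_space \<Rightarrow> 'a) \<Rightarrow> ('g \<Rightarrow> 'b::metric_space \<Rightarrow> 'b) \<Rightarrow>
     'a \<Rightarrow> 'b \<Rightarrow> ('a \<times> 'b) set \<Rightarrow> bool" where
  "heavy G a1 a2 t1 t2 R \<longleftrightarrow>
     (\<exists>\<gamma> :: nat \<Rightarrow> 'g. (\<forall>n. \<gamma> n \<in> carrier G \<and> (a1 (\<gamma> n) t1, a2 (\<gamma> n) t2) \<in> R) \<and>
        filterlim (\<lambda>n. dist t1 (a1 (\<gamma> n) t1)) at_top sequentially \<and>
        filterlim (\<lambda>n. dist t2 (a2 (\<gamma> n) t2)) at_top sequentially)"

definition guirardel_core ::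
    "('g, 'r) monoid_scheme \<Rightarrow> 'a::metric_space set \<Rightarrow> ('g \<Rightarrow> 'a \<Rightarrow> 'a) \<Rightarrow>
     'b::metric_space set \<Rightarrow> ('g \<Rightarrow> 'b \<Rightarrow> 'b) \<Rightarrow> 'a \<Rightarrow> 'b \<Rightarrow> ('a \<times> 'b) set" where
  "guirardel_core G T1 a1 T2 a2 t1 t2 =
     T1 \<times> T2 - \<Union>{R \<in> quadrants T1 T2. \<not> heavy G a1 a2 t1 t2 R}"

definition fibres_connected ::
    "'a::topological_space set \<Rightarrow> 'b::topological_space set \<Rightarrow> ('a \<times> 'b) set \<Rightarrow> bool" where
  "fibres_connected T1 T2 X \<longleftrightarrow>
     (\<forall>t\<in>T1. connected (fst -` {t} \<inter> X)) \<and> (\<forall>t\<in>T2. connected (snd -` {t} \<inter> X))"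

end

theory Submission
  imports Defs
begin

text \<open>
  Fibres of the core are connected because the complement of a direction in a tree is convex.

  The image of \<open>fhat\<close> lies in the core: since \<open>f\<close> is locally injective, a diagram curve of the
  first family, on which \<open>f\<^sub>1\<close> is constant, lifts to a locally injective and hence properly embedded
  line in the second tree, and vice versa. Up to bounded error every quadrant that meets the image
  contains the centre of a square of the image, and following the two lines through such a centre in
  suitable directions shows that the quadrant is heavy.

  The core is minimal: if \<open>(x\<^sub>1, x\<^sub>2) \<notin> X\<close>, the fibres of \<open>X\<close> over \<open>x\<^sub>1\<close> and \<open>x\<^sub>2\<close> lie in
  single directions \<open>\<delta>\<^sub>2\<close> at \<open>x\<^sub>2\<close> and \<open>\<delta>\<^sub>1\<close> at \<open>x\<^sub>1\<close>. Then the part of \<open>S\<close> mapped to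
  \<open>(T\<^sub>1 - x\<^sub>1 - \<delta>\<^sub>1) \<times> (T\<^sub>2 - x\<^sub>2 - \<delta>\<^sub>2)\<close> is open and closed, and after a change of
  directions it is empty. A quadrant around \<open>(x\<^sub>1, x\<^sub>2)\<close> that exceeds this product only by a bounded amount
  in each factor is light.
\<close>

section \<open>Lifting through covers of arbitrary topological spaces\<close>

text \<open>Both trees enter only as simply connected covers of the rose with a path metric, so that
  a point of an edge separates the tree has to be proved: collapsing everything but one edge gives a
  map to the circle, its lift to the reals measures on which side of the edge a point lies, and
  directions become superlevel sets of this height. All errors are bounded by edge lengths, which is
  where the recurring constant 1 comes from. Centres of squares matter because two diagram curves
  cross there, so that the two coordinates can be driven to infinity independently. They are reached
  cell by cell, and for this the directions are enlarged to be based at vertices: a path inside one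
  cell cannot cross a vertex. For minimality, a part of \<open>S\<close> that is open and closed is
  empty or all of \<open>S\<close>. In the second case the image avoids \<open>x1\<close> in the
  first and \<open>x2\<close> in the second coordinate, and the directions that contain its two
  projections replace the old ones. The complement of a direction need not be a direction, hence the
  detour over slightly larger sets around \<open>x1\<close> and \<open>x2\<close>.\<close>

lemma covering_space_unique_lift:
  fixes g1 g2 :: "'a::topological_space \<Rightarrow> 'c::topological_space"
  assumes cov: "covering_space C p B"
    and "connected U" "a \<in> U" "g1 a = g2 a"
    and g1: "continuous_on U g1" "g1 ` U \<subseteq> C" and g2: "continuous_on U g2" "g2 ` U \<subseteq> C"
    and eq: "\<And>x. x \<in> U \<Longrightarrow> p (g1 x) = p (g2 x)"
    and "x \<in> U"
  shows "g1 x = g2 x"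
proof -
  have op: "openin (top_of_set U) (U \<inter> h -` N)" if "continuous_on U h" "h ` U \<subseteq> C" "openin (top_of_set C) N" for h N
    using continuous_openin_preimage[of U h C N] that by auto
  \<comment> \<open>On \<open>N\<close> both lifts stay in the sheets of \<open>g1 z\<close> and
    \<open>g2 z\<close>. In a common sheet injectivity of \<open>p\<close> makes them agree, in
    different sheets disjointness keeps them apart.\<close>
  have loc: "\<exists>N. openin (top_of_set U) N \<and> z \<in> N \<and> (\<forall>y\<in>N. (g1 y = g2 y) = (g1 z = g2 z))" if "z \<in> U" for z
  proof -
    have "p (g1 z) \<in> B" using cov that g1 by (auto simp: covering_space_def)
    then obtain W v where W: "p (g1 z) \<in> W" and v: "\<Union>v = C \<inter> p -` W" "\<forall>u\<in>v. openin (top_of_set C) u"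
      "pairwise disjnt v" "\<forall>u\<in>v. \<exists>q. homeomorphism u W p q"
      using cov unfolding covering_space_def by metis
    have "g1 z \<in> \<Union>v" "g2 z \<in> \<Union>v" using v(1) W that g1 g2 eq[OF that] by auto
    then obtain v1 v2 where v1: "v1 \<in> v" "g1 z \<in> v1" and v2: "v2 \<in> v" "g2 z \<in> v2" by blast
    let ?N = "(U \<inter> g1 -` v1) \<inter> (U \<inter> g2 -` v2)"
    have "openin (top_of_set U) ?N"
      using openin_Int[OF op[OF g1, of v1] op[OF g2, of v2]] v(2) v1(1) v2(1) by blast
    moreover have "(g1 y = g2 y) = (g1 z = g2 z)" if y: "y \<in> ?N" for y
    proof (cases "v1 = v2")
      case True
      obtain q where q: "homeomorphism v1 W p q" using v(4) v1 by blast
      have "inj_on p v1" by (rule inj_on_inverseI[of _ q]) (rule homeomorphism_apply1[OF q])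
      moreover have "g1 y \<in> v1" "g2 y \<in> v1" "y \<in> U" using y True by auto
      ultimately have "g1 y = g2 y" using eq inj_onD by metis
      moreover have "g1 z = g2 z"
        using \<open>inj_on p v1\<close> v1 v2 True eq[OF \<open>z \<in> U\<close>] inj_onD by metis
      ultimately show ?thesis by simp
    next
      case False
      then have "v1 \<inter> v2 = {}" using v(3) v1 v2 by (auto simp: pairwise_def disjnt_def)
      then show ?thesis using v1 v2 y by auto
    qed
    ultimately show ?thesis using that v1 v2 by blast
  qed
  show ?thesis
  proof (rule connected_induction_simple[OF \<open>connected U\<close>, of a x "\<lambda>y. g1 y = g2 y"])
    fix z assume "z \<in> U"
    then show "\<exists>N. openin (top_of_set U) N \<and> z \<in> N \<and> (\<forall>x\<in>N. \<forall>y\<in>N. g1 x = g2 x \<longrightarrow> g1 y = g2 y)"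
      using loc[of z] by blast
  qed (use assms in auto)
qed

text \<open>Being liftable over \<open>{0..t}\<close> is locally constant in \<open>t\<close>, so
  connectedness of the unit interval carries it from 0 to 1. The spaces are bare topological ones
  because \<open>S\<close> and \<open>\<Sigma>\<close> come without a metric.\<close>

lemma covering_space_path_lift:
  fixes C :: "'a::topological_space set" and B :: "'b::topological_space set"
  assumes cov: "covering_space C p B" and r: "path r" "path_image r \<subseteq> B" and a: "a \<in> C" "p a = pathstart r"
  obtains r' where "path r'" "path_image r' \<subseteq> C" "pathstart r' = a" "\<And>t. t \<in> {0..1} \<Longrightarrow> p (r' t) = r t"
proof -
  have contr: "continuous_on {0..1} r" using r by (simp add: path_def)
  have rB: "r t \<in> B" if "t \<in> {0..1}" for t
    using r that by (auto simp: path_def path_image_def)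
  define P where "P t \<longleftrightarrow> (\<exists>r'. continuous_on {0..t} r' \<and> r' ` {0..t} \<subseteq> C \<and> r' 0 = a \<and> (\<forall>s\<in>{0..t}. p (r' s) = r s))" for t :: real
  have ext: "P t" if "P s" "s \<le> t" "0 \<le> s" "openin (top_of_set B) W" "W \<noteq> {}" "r ` {s..t} \<subseteq> W"
     "\<Union>v = C \<inter> p -` W" "\<forall>u\<in>v. \<exists>q. homeomorphism u W p q" "t \<le> 1" for s t W v
  proof -
    obtain r' where r': "continuous_on {0..s} r'" "r' ` {0..s} \<subseteq> C" "r' 0 = a" "\<forall>x\<in>{0..s}. p (r' x) = r x"
      using \<open>P s\<close> P_def by blast
    have "r' s \<in> \<Union>v" using that r' by auto
    then obtain u q where u: "u \<in> v" "r' s \<in> u" "homeomorphism u W p q" using \<open>\<forall>u\<in>v. \<exists>q. homeomorphism u W p q\<close> by blast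
    \<comment> \<open>The lift is prolonged past \<open>s\<close> by the inverse \<open>q\<close> of
      \<open>p\<close> on the sheet \<open>u\<close> that contains \<open>r' s\<close>; the two
      pieces meet since \<open>q (r s) = r' s\<close>.\<close>
    define r'' where "r'' x = (if x \<le> s then r' x else q (r x))" for x
    have qs: "q (r s) = r' s" using u r' that by (metis atLeastAtMost_iff homeomorphism_apply1 order_refl)
    have cq: "continuous_on {s..t} (q \<circ> r)"
      using u that contr
      by (intro continuous_on_compose continuous_on_subset[OF homeomorphism_cont2[OF u(3)]] continuous_on_subset[OF contr]) auto
    have "continuous_on ({0..s} \<union> {s..t}) r''"
      unfolding r''_def
    proof (rule continuous_on_cases[where P="\<lambda>x. x \<le> s"])
      show "continuous_on {s..t} (\<lambda>x. q (r x))" using cq by (simp add: o_def)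
      show "\<forall>x. x \<in> {0..s} \<and> \<not> x \<le> s \<or> x \<in> {s..t} \<and> x \<le> s \<longrightarrow> r' x = q (r x)" using qs by auto
    qed (use r' in auto)
    moreover have "{0..s} \<union> {s..t} = {0..t}" using that by auto
    moreover have "r'' x \<in> C \<and> p (r'' x) = r x" if "x \<in> {0..t}" for x
    proof (cases "x \<le> s")
      case True
      then show ?thesis using r' that by (auto simp: r''_def)
    next
      case False
      then have "r x \<in> W" using \<open>r ` {s..t} \<subseteq> W\<close> that by auto
      then have "q (r x) \<in> u" "p (q (r x)) = r x" using u(3) by (auto simp: homeomorphism_def)
      then show ?thesis using False u \<open>\<Union>v = C \<inter> p -` W\<close> by (auto simp: r''_def)
    qed
    moreover have "r'' 0 = a" using r'(3) that by (auto simp: r''_def)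
    ultimately show ?thesis unfolding P_def by (metis image_subset_iff)
  qed
  have "P 0" unfolding P_def using a by (intro exI[of _ "\<lambda>_. a"]) (auto simp: pathstart_def)
  have loc: "\<exists>N. openin (top_of_set {0..1}) N \<and> z \<in> N \<and> (\<forall>x\<in>N. \<forall>y\<in>N. P x \<longrightarrow> P y)" if z: "z \<in> {0..1}" for z
  proof -
    obtain W v where W: "r z \<in> W" "openin (top_of_set B) W" and v: "\<Union>v = C \<inter> p -` W"
      "\<forall>u\<in>v. \<exists>q. homeomorphism u W p q"
      using cov rB[OF z] unfolding covering_space_def by blast
    have "openin (top_of_set {0..1}) ({0..1} \<inter> r -` W)"
      using rB by (intro continuous_openin_preimage[OF contr _ W(2)]) auto
    then obtain e where e: "e > 0" "\<And>x. x \<in> {0..1} \<Longrightarrow> dist x z < e \<Longrightarrow> r x \<in> W"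
      using z W(1) unfolding openin_euclidean_subtopology_iff by (metis IntD2 IntI vimage_eq)
    let ?N = "{0..1} \<inter> ball z e"
    have "P y" if "x \<in> ?N" "y \<in> ?N" "P x" for x y
    proof (cases "x \<le> y")
      case True
      have "r ` {x..y} \<subseteq> W" using e that by (auto simp: dist_real_def)
      then show ?thesis using ext[OF \<open>P x\<close> True _ W(2) _ _ v] W that by auto
    next
      case False
      obtain r' where r': "continuous_on {0..x} r'" "r' ` {0..x} \<subseteq> C" "r' 0 = a" "\<forall>s\<in>{0..x}. p (r' s) = r s"
        using \<open>P x\<close> unfolding P_def by blast
      then show ?thesis unfolding P_def using False
        by (intro exI[of _ r']) (auto intro: continuous_on_subset)
    qed
    moreover have "openin (top_of_set {0..1}) ?N" by (simp add: openin_open_Int)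
    moreover have "z \<in> ?N" using z e(1) by simp
    ultimately show ?thesis by meson
  qed
  have "P 1"
  proof (rule connected_induction_simple[of "{0..1::real}" 0 1 P])
    fix z :: real assume "z \<in> {0..1}"
    then show "\<exists>N. openin (top_of_set {0..1}) N \<and> z \<in> N \<and> (\<forall>x\<in>N. \<forall>y\<in>N. P x \<longrightarrow> P y)"
      by (rule loc)
  qed (use \<open>P 0\<close> in auto)
  then obtain r' where r': "continuous_on {0..1} r'" "r' ` {0..1} \<subseteq> C" "r' 0 = a" "\<forall>s\<in>{0..1}. p (r' s) = r s"
    using P_def by blast
  show ?thesis
  proof
    show "path r'" "path_image r' \<subseteq> C" "pathstart r' = a" using r' by (simp_all add: path_def path_image_def pathstart_def)
  qed (use r'(4) in blast)
qed

section \<open>Lifting through covers of metric spaces\<close>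

text \<open>
  The lifting theorems of the library are stated for normed spaces. The Kuratowski embedding carries
  them over to metric spaces.
\<close>

lemma metric_embedding_normed:
  obtains \<psi> :: "'a::metric_space \<Rightarrow> ('a \<Rightarrow>\<^sub>C real)" where "\<And>x y. dist (\<psi> x) (\<psi> y) = dist x y"
proof
  \<comment> \<open>Distance functions may be unbounded; subtracting the one of a base point, here
    the arbitrary \<open>undefined\<close>, makes them bounded.\<close>
  let ?f = "\<lambda>x y::'a. dist x y - dist undefined y"
  have b: "?f x \<in> bcontfun" for x
    unfolding bcontfun_def
  proof (intro CollectI conjI)
    have "\<bar>?f x y\<bar> \<le> dist x undefined" for y
      using dist_triangle[of x y undefined] dist_triangle[of undefined y x]
      by (simp add: dist_commute abs_le_iff)
    then show "bounded (range (?f x))" by (auto simp: bounded_iff)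
  qed (intro continuous_intros)
  let ?\<psi> = "\<lambda>x. Bcontfun (?f x)"
  have app: "apply_bcontfun (?\<psi> x) = ?f x" for x using b by (simp add: Bcontfun_inverse)
  show "dist (?\<psi> x) (?\<psi> y) = dist x y" for x y
  proof (rule antisym)
    show "dist (?\<psi> x) (?\<psi> y) \<le> dist x y"
    proof (rule dist_bound)
      fix z
      show "dist (apply_bcontfun (?\<psi> x) z) (apply_bcontfun (?\<psi> y) z) \<le> dist x y"
        using dist_triangle[of x z y] dist_triangle[of y z x] dist_commute[of x y]
        by (simp add: app dist_real_def abs_le_iff dist_commute[of z])
    qed
    \<comment> \<open>The supremum distance of the two functions is attained at
      \<open>y\<close>.\<close>
    have "dist x y = dist (apply_bcontfun (?\<psi> x) y) (apply_bcontfun (?\<psi> y) y)"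
      by (simp add: app dist_real_def)
    also have "\<dots> \<le> dist (?\<psi> x) (?\<psi> y)" by (rule dist_bounded)
    finally show "dist x y \<le> dist (?\<psi> x) (?\<psi> y)" .
  qed
qed

lemma metric_homeomorphic_normed:
  fixes T :: "'a::metric_space set"
  obtains T' :: "('a \<Rightarrow>\<^sub>C real) set" and \<psi> \<phi> where "homeomorphism T T' \<psi> \<phi>"
proof -
  obtain \<psi> :: "'a \<Rightarrow> ('a \<Rightarrow>\<^sub>C real)" where d: "\<And>x y. dist (\<psi> x) (\<psi> y) = dist x y"
    using metric_embedding_normed by blast
  have inj: "inj \<psi>" by (metis d dist_eq_0_iff injI)
  have "homeomorphism T (\<psi> ` T) \<psi> (inv_into UNIV \<psi>)"
    unfolding homeomorphism_def
  proof (intro conjI)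
    show "continuous_on T \<psi>" unfolding continuous_on_iff by (metis d)
    show "continuous_on (\<psi> ` T) (inv_into UNIV \<psi>)" unfolding continuous_on_iff using inj by (auto simp: d)
  qed (use inj in \<open>auto simp: image_image\<close>)
  then show ?thesis using that by blast
qed

lemma covering_space_homeomorphism_compose:
  assumes h: "homeomorphism T' T \<phi> \<psi>" and cov: "covering_space T q R"
  shows "covering_space T' (q \<circ> \<phi>) R"
proof
  show "continuous_on T' (q \<circ> \<phi>)"
    using h cov by (intro continuous_on_compose) (auto simp: homeomorphism_def covering_space_def)
  show "(q \<circ> \<phi>) ` T' = R"
    using h cov by (metis homeomorphism_image1 covering_space_imp_surjective image_comp)
  fix x assume "x \<in> R"
  then obtain W v where W: "x \<in> W" "openin (top_of_set R) W"
      and v: "\<Union>v = T \<inter> q -` W" "\<forall>u\<in>v. openin (top_of_set T) u"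
      "pairwise disjnt v" "\<forall>u\<in>v. \<exists>p. homeomorphism u W q p"
    using cov unfolding covering_space_def by metis
  have sub: "u \<subseteq> T" if "u \<in> v" for u using v that by blast
  have im: "\<phi> ` \<psi> ` u = u" if "u \<in> v" for u
  proof -
    have "\<phi> (\<psi> y) = y" if "y \<in> u" for y
      using homeomorphism_apply2[OF h] sub[OF \<open>u \<in> v\<close>] that by blast
    then show ?thesis by (simp add: image_image)
  qed
  show "\<exists>W. x \<in> W \<and> openin (top_of_set R) W \<and> (\<exists>v. \<Union>v = T' \<inter> (q \<circ> \<phi>) -` W \<and>
            (\<forall>u\<in>v. openin (top_of_set T') u) \<and> pairwise disjnt v \<and> (\<forall>u\<in>v. \<exists>p. homeomorphism u W (q \<circ> \<phi>) p))"
  proof (rule exI[of _ W], intro conjI, goal_cases)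
    case 3
    show ?case
    proof (rule exI[of _ "(`) \<psi> ` v"], intro conjI ballI)
      have "\<Union>((`) \<psi> ` v) = \<psi> ` (T \<inter> q -` W)" using v(1) by blast
      also have "\<dots> = T' \<inter> (q \<circ> \<phi>) -` W"
      proof
        show "\<psi> ` (T \<inter> q -` W) \<subseteq> T' \<inter> (q \<circ> \<phi>) -` W" using h by (auto simp: homeomorphism_def)
        show "T' \<inter> (q \<circ> \<phi>) -` W \<subseteq> \<psi> ` (T \<inter> q -` W)"
        proof
          fix y assume y: "y \<in> T' \<inter> (q \<circ> \<phi>) -` W"
          then have "y = \<psi> (\<phi> y)" "\<phi> y \<in> T \<inter> q -` W" using h by (auto simp: homeomorphism_def)
          then show "y \<in> \<psi> ` (T \<inter> q -` W)" by blast
        qed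
      qed
      finally show "\<Union>((`) \<psi> ` v) = T' \<inter> (q \<circ> \<phi>) -` W" .
      show "openin (top_of_set T') u" if "u \<in> (`) \<psi> ` v" for u
        using that v(2) homeomorphism_imp_open_map[OF homeomorphism_symD[OF h]] by auto
      show "pairwise disjnt ((`) \<psi> ` v)"
      proof (clarsimp simp: pairwise_def disjnt_def)
        fix a b assume ab: "a \<in> v" "b \<in> v" "\<psi> ` a \<noteq> \<psi> ` b"
        then have "a \<inter> b = {}" using v(3) by (auto simp: pairwise_def disjnt_def)
        moreover have "inj_on \<psi> T" using h by (metis homeomorphism_def inj_on_def)
        ultimately show "\<psi> ` a \<inter> \<psi> ` b = {}"
          using sub[OF ab(1)] sub[OF ab(2)] by (metis inj_on_image_Int image_empty)
      qed
      fix u assume "u \<in> (`) \<psi> ` v"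
      then obtain u0 where u0: "u0 \<in> v" "u = \<psi> ` u0" by blast
      then obtain p where p: "homeomorphism u0 W q p" using v by blast
      have "homeomorphism (\<psi> ` u0) u0 \<phi> \<psi>"
      proof (rule homeomorphism_of_subsets[OF h _ subset_refl im[OF u0(1)]])
        show "\<psi> ` u0 \<subseteq> T'" using sub[OF u0(1)] homeomorphism_image2[OF h] by blast
      qed
      then show "\<exists>p. homeomorphism u W (q \<circ> \<phi>) p"
        using homeomorphism_compose p u0 by blast
    qed
  qed (use W in auto)
qed

lemma covering_space_monodromy_metric:
  fixes C :: "'a::metric_space set" and p :: "'a \<Rightarrow> 'b::real_normed_vector"
  assumes cov: "covering_space C p B"
    and h1: "path h1" "path_image h1 \<subseteq> C" and h2: "path h2" "path_image h2 \<subseteq> C"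
    and hom: "homotopic_paths B (p \<circ> h1) (p \<circ> h2)" and start: "pathstart h1 = pathstart h2"
  shows "pathfinish h1 = pathfinish h2"
proof -
  obtain T' :: "('a \<Rightarrow>\<^sub>C real) set" and \<psi> \<phi> where h: "homeomorphism C T' \<psi> \<phi>"
    using metric_homeomorphic_normed by blast
  have cov': "covering_space T' (p \<circ> \<phi>) B"
    by (rule covering_space_homeomorphism_compose[OF homeomorphism_symD[OF h] cov])
  have id: "\<phi> (\<psi> (k t)) = k t" if "path_image k \<subseteq> C" "t \<in> {0..1}" for k t
    using homeomorphism_apply1[OF h, of "k t"] that unfolding path_image_def by blast
  have pk: "path (\<psi> \<circ> k)" "path_image (\<psi> \<circ> k) \<subseteq> T'" if "path k" "path_image k \<subseteq> C" for k
    using h that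
    by (auto intro!: path_continuous_image continuous_on_subset[of C \<psi>] simp: homeomorphism_def path_image_compose)
  have "pathfinish (\<psi> \<circ> h1) = pathfinish (\<psi> \<circ> h2)"
  proof (rule covering_space_monodromy[OF cov' _ _ _ _ hom])
    show "pathstart (\<psi> \<circ> h1) = pathstart (\<psi> \<circ> h2)" using start by (simp add: pathstart_compose)
    show "(p \<circ> \<phi>) ((\<psi> \<circ> h1) t) = (p \<circ> h1) t" if "t \<in> {0..1}" for t using id h1 that by simp
    show "(p \<circ> \<phi>) ((\<psi> \<circ> h2) t) = (p \<circ> h2) t" if "t \<in> {0..1}" for t using id h2 that by simp
  qed (use pk h1 h2 homotopic_paths_imp_path[OF hom] homotopic_paths_imp_subset[OF hom] in blast)+
  then have "\<phi> (\<psi> (h1 1)) = \<phi> (\<psi> (h2 1))" by (simp add: pathfinish_def)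
  then show ?thesis using id h1 h2 by (simp add: pathfinish_def)
qed

lemma simply_connected_homeomorphic:
  assumes h: "homeomorphism T T' \<psi> \<phi>" and T: "simply_connected T"
  shows "simply_connected T'"
  unfolding simply_connected_def
proof (intro allI impI, elim conjE)
  fix p q assume p: "path p" "pathfinish p = pathstart p" "path_image p \<subseteq> T'"
    and q: "path q" "pathfinish q = pathstart q" "path_image q \<subseteq> T'"
  have pk: "path (\<phi> \<circ> k)" "path_image (\<phi> \<circ> k) \<subseteq> T" if "path k" "path_image k \<subseteq> T'" for k
    using h that
    by (auto intro!: path_continuous_image continuous_on_subset[of T' \<phi>] simp: homeomorphism_def path_image_compose)
  have "homotopic_loops T (\<phi> \<circ> p) (\<phi> \<circ> q)"
    using T p q pk unfolding simply_connected_def by (simp add: pathstart_compose pathfinish_compose)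
  then have "homotopic_loops T' (\<psi> \<circ> (\<phi> \<circ> p)) (\<psi> \<circ> (\<phi> \<circ> q))"
    using homeomorphism_cont1[OF h] homeomorphism_image1[OF h]
    by (intro homotopic_loops_continuous_image[of T]) auto
  \<comment> \<open>The round trip through \<open>T\<close> gives back \<open>k\<close> only on the
    unit interval, hence a homotopy instead of an equality.\<close>
  moreover have "homotopic_loops T' k (\<psi> \<circ> (\<phi> \<circ> k))" if "path k" "path_image k \<subseteq> T'" "pathfinish k = pathstart k" for k
  proof (rule homotopic_loops_eq)
    show "k t = (\<psi> \<circ> (\<phi> \<circ> k)) t" if "t \<in> {0..1}" for t
      using homeomorphism_apply2[OF h, of "k t"] that \<open>path_image k \<subseteq> T'\<close> unfolding path_image_def by force
  qed (use that in auto)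
  ultimately show "homotopic_loops T' p q"
    using p q homotopic_loops_trans homotopic_loops_sym by metis
qed

text \<open>Both the cover and the domain are replaced by homeomorphic copies in normed spaces. The
  heights, the deck transformations and the lifts of the diagram curves all come from here.\<close>

lemma covering_space_lift_metric:
  fixes C :: "'a::metric_space set" and p :: "'a \<Rightarrow> 'b::real_normed_vector" and U :: "'c::metric_space set"
  assumes cov: "covering_space C p B" and az: "a \<in> C" "z \<in> U"
    and U: "simply_connected U" "locally path_connected U"
    and f: "continuous_on U f" "f ` U \<subseteq> B" "f z = p a"
  obtains g where "continuous_on U g" "g ` U \<subseteq> C" "g z = a" "\<And>y. y \<in> U \<Longrightarrow> p (g y) = f y"
proof -
  obtain T' :: "('a \<Rightarrow>\<^sub>C real) set" and \<psi> \<phi> where h: "homeomorphism C T' \<psi> \<phi>"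
    using metric_homeomorphic_normed by blast
  obtain U' :: "('c \<Rightarrow>\<^sub>C real) set" and \<sigma> \<tau> where h': "homeomorphism U U' \<sigma> \<tau>"
    using metric_homeomorphic_normed by blast
  have cov': "covering_space T' (p \<circ> \<phi>) B"
    by (rule covering_space_homeomorphism_compose[OF homeomorphism_symD[OF h] cov])
  have U': "locally path_connected U'"
    using homeomorphism_locally[OF h', of path_connected path_connected] U(2) homeomorphic_path_connectedness
    by (metis homeomorphic_def)
  have scU': "simply_connected U'" by (rule simply_connected_homeomorphic[OF h' U(1)])
  have contf: "continuous_on U' (f \<circ> \<tau>)" using h' f
    by (intro continuous_on_compose) (auto simp: homeomorphism_def)
  obtain g where g: "continuous_on U' g" "g \<in> U' \<rightarrow> T'" "g (\<sigma> z) = \<psi> a" "\<And>y. y \<in> U' \<Longrightarrow> (p \<circ> \<phi>) (g y) = (f \<circ> \<tau>) y"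
  proof (rule covering_space_lift_strong[OF cov', of "\<psi> a" "\<sigma> z" U' "f \<circ> \<tau>"])
    show "\<psi> a \<in> T'" using homeomorphism_image1[OF h] az by blast
    show "\<sigma> z \<in> U'" using homeomorphism_image1[OF h'] az by blast
    show "f \<circ> \<tau> \<in> U' \<rightarrow> B" using homeomorphism_image2[OF h'] f(2) by auto
    show "(f \<circ> \<tau>) (\<sigma> z) = (p \<circ> \<phi>) (\<psi> a)"
      using homeomorphism_apply1[OF h az(1)] homeomorphism_apply1[OF h' az(2)] f(3) by simp
  qed (use U' scU' contf in blast)+
  show ?thesis
  proof
    show "continuous_on U (\<phi> \<circ> g \<circ> \<sigma>)"
    proof (intro continuous_on_compose)
      show "continuous_on U \<sigma>" by (rule homeomorphism_cont1[OF h'])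
      show "continuous_on (\<sigma> ` U) g" using g(1) homeomorphism_image1[OF h'] by simp
      show "continuous_on (g ` \<sigma> ` U) \<phi>"
        using homeomorphism_cont2[OF h] homeomorphism_image1[OF h'] g(2)
        by (auto intro: continuous_on_subset simp: image_subset_iff_funcset)
    qed
    show "(\<phi> \<circ> g \<circ> \<sigma>) ` U \<subseteq> C"
      using g(2) homeomorphism_image2[OF h] homeomorphism_image1[OF h'] by (auto simp: Pi_iff)
    show "(\<phi> \<circ> g \<circ> \<sigma>) z = a" using g(3) homeomorphism_apply1[OF h az(1)] by simp
    show "p ((\<phi> \<circ> g \<circ> \<sigma>) y) = f y" if "y \<in> U" for y
      using g(4)[of "\<sigma> y"] homeomorphism_apply1[OF h' that] homeomorphism_image1[OF h'] that by auto
  qed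
qed

section \<open>Trees covering the rose\<close>

lemma isometric_segment_continuous:
  assumes "isometric_segment T l u" shows "continuous_on {0..l} u"
  using assms unfolding isometric_segment_def continuous_on_iff by (metis dist_real_def)

lemma isometric_segment_inj:
  assumes "isometric_segment T l u" shows "inj_on u {0..l}"
  using assms unfolding isometric_segment_def inj_on_def by (metis dist_self abs_0_eq right_minus_eq)

lemma isometric_segment_reverse:
  assumes "isometric_segment T l u" shows "isometric_segment T l (\<lambda>t. u (l - t))"
  using assms unfolding isometric_segment_def by (auto simp: abs_minus_commute)

lemma openin_ballE:
  assumes "openin (top_of_set T) U" "x \<in> U"
  obtains e where "e > 0" "T \<inter> ball x e \<subseteq> U"
  using assms unfolding openin_contains_ball by (metis inf_commute)

text \<open>The circle of radius \<open>k\<close> around \<open>k\<close> has the equation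
  \<open>(norm z)^2 = 2 * k * Re z\<close>. Away from 0 a point thus determines \<open>k\<close> by
  a continuous formula, which makes the open circles disjoint and open in the rose.\<close>

lemma rose_edge_eq:
  assumes "z \<in> rose_edge k" "k \<ge> 1"
  shows "Re z > 0" "(norm z)\<^sup>2 / (2 * Re z) = real k"
proof -
  have "norm (z - of_nat k) = real k" "z \<noteq> 0"
    using assms by (auto simp: rose_edge_def dist_norm norm_minus_commute)
  then have "(Re z - real k)\<^sup>2 + (Im z)\<^sup>2 = (real k)\<^sup>2" by (simp add: cmod_power2 flip: \<open>norm (z - of_nat k) = real k\<close>)
  then have e: "(norm z)\<^sup>2 = 2 * real k * Re z" by (simp add: cmod_power2 power2_diff algebra_simps)
  moreover have "(norm z)\<^sup>2 > 0" using \<open>z \<noteq> 0\<close> by simp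
  ultimately have "0 < (2 * real k) * Re z" by simp
  then show "Re z > 0" by (rule zero_less_mult_pos) (use assms(2) in simp)
  then show "(norm z)\<^sup>2 / (2 * Re z) = real k" using e by (simp add: field_simps)
qed

lemma rose_diff_0: "rose g - {0} = (\<Union>k\<in>{1..g}. rose_edge k)"
  by (auto simp: rose_def rose_edge_def)

lemma rose_edge_0: "0 \<notin> rose_edge k" by (simp add: rose_edge_def)

lemma rose_midpoint_in_edge: "k \<ge> 1 \<Longrightarrow> rose_midpoint k \<in> rose_edge k"
  by (simp add: rose_midpoint_def rose_edge_def dist_norm)

lemma openin_rose_edge: assumes "k \<in> {1..g}" shows "openin (top_of_set (rose g)) (rose_edge k)"
proof -
  \<comment> \<open>On the \<open>j\<close>-th open circle the second condition reads
    \<open>\<bar>j - k\<bar> < 1\<close>, so that an open condition singles out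
    \<open>j = k\<close>.\<close>
  have "rose_edge k = rose g \<inter> ({z. Re z > 0} \<inter> {z. \<bar>(norm z)\<^sup>2 - real k * (2 * Re z)\<bar> < 2 * Re z})"
  proof (intro equalityI subsetI)
    fix z assume z: "z \<in> rose_edge k"
    then show "z \<in> rose g \<inter> ({z. Re z > 0} \<inter> {z. \<bar>(norm z)\<^sup>2 - real k * (2 * Re z)\<bar> < 2 * Re z})"
      using rose_edge_eq[OF z] assms rose_diff_0[of g] by (auto simp: field_simps)
  next
    fix z assume z: "z \<in> rose g \<inter> ({z. Re z > 0} \<inter> {z. \<bar>(norm z)\<^sup>2 - real k * (2 * Re z)\<bar> < 2 * Re z})"
    then have "z \<in> rose g - {0}" by auto
    then obtain j where j: "j \<in> {1..g}" "z \<in> rose_edge j" unfolding rose_diff_0 by blast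
    then have "(norm z)\<^sup>2 = real j * (2 * Re z)" using rose_edge_eq[OF j(2)] by (auto simp: field_simps)
    then have "\<bar>real j * (2 * Re z) - real k * (2 * Re z)\<bar> < 1 * (2 * Re z)" using z by simp
    then have "\<bar>real j - real k\<bar> * (2 * Re z) < 1 * (2 * Re z)"
      using z by (simp add: left_diff_distrib [symmetric] abs_mult)
    then have "\<bar>real j - real k\<bar> < 1" using z by (simp only: mult_less_cancel_right) auto
    then have "j = k" by linarith
    then show "z \<in> rose_edge k" using j by simp
  qed
  moreover have "open ({z. Re z > 0} \<inter> {z::complex. \<bar>(norm z)\<^sup>2 - real k * (2 * Re z)\<bar> < 2 * Re z})"
    by (intro open_Int open_Collect_less continuous_intros)
  ultimately show ?thesis by (auto simp: openin_open)
qed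

lemma rose_closure_edge: "z \<in> closure (rose_edge k) \<Longrightarrow> z \<in> rose_edge k \<or> z = 0"
proof -
  assume z: "z \<in> closure (rose_edge k)"
  have "closure (rose_edge k) \<subseteq> sphere (of_nat k) (real k)"
    by (rule closure_minimal) (auto simp: rose_edge_def)
  then show ?thesis using z by (auto simp: rose_edge_def)
qed

lemma rose_edges_disjoint: "j \<ge> 1 \<Longrightarrow> k \<ge> 1 \<Longrightarrow> z \<in> rose_edge j \<Longrightarrow> z \<in> rose_edge k \<Longrightarrow> j = k"
  using rose_edge_eq(2) by (metis of_nat_eq_iff)

section \<open>Topology and metric of the tree\<close>

locale rose_tree =
  fixes g :: nat and T :: "'a::metric_space set" and q :: "'a \<Rightarrow> complex"
  assumes cover: "rose_universal_cover g T q"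
begin

lemma covering: "covering_space T q (rose g)"
  and simply: "simply_connected T"
  using cover by (auto simp: rose_universal_cover_def)

lemma cont_q: "continuous_on T q" by (rule covering_space_imp_continuous[OF covering])

lemma q_rose: "x \<in> T \<Longrightarrow> q x \<in> rose g"
  using covering_space_imp_surjective[OF covering] by blast

lemma segment:
  assumes "x \<in> T" "y \<in> T"
  obtains v where "isometric_segment T (dist x y) v" "v 0 = x" "v (dist x y) = y"
  using cover assms unfolding rose_universal_cover_def by metis

lemma segment_ball:
  assumes "x \<in> T" "y \<in> T" "dist x y < e"
  obtains C where "path_connected C" "C \<subseteq> T \<inter> ball x e" "x \<in> C" "y \<in> C"
    "\<And>z. z \<in> C \<Longrightarrow> dist x z \<le> dist x y"
proof -
  obtain v where v: "isometric_segment T (dist x y) v" "v 0 = x" "v (dist x y) = y" using segment assms by blast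
  show ?thesis
  proof
    show "path_connected (v ` {0..dist x y})"
      by (intro path_connected_continuous_image isometric_segment_continuous[OF v(1)])
         (simp add: convex_imp_path_connected)
    have d: "dist x (v s) \<le> dist x y" if "s \<in> {0..dist x y}" for s
    proof -
      have "dist (v 0) (v s) = \<bar>0 - s\<bar>" using v(1) that unfolding isometric_segment_def by auto
      then show ?thesis using that v(2) by simp
    qed
    then show "\<And>z. z \<in> v ` {0..dist x y} \<Longrightarrow> dist x z \<le> dist x y" by auto
    show "v ` {0..dist x y} \<subseteq> T \<inter> ball x e"
      using v(1) d assms(3) unfolding isometric_segment_def by force
    show "x \<in> v ` {0..dist x y}" using v(2) by (metis atLeastAtMost_iff image_eqI order_refl zero_le_dist)
    show "y \<in> v ` {0..dist x y}" using v(3) by (metis atLeastAtMost_iff image_eqI order_refl zero_le_dist)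
  qed
qed

lemma path_connected_T: "path_connected T"
proof (clarsimp simp: path_connected_component)
  fix x y assume xy: "x \<in> T" "y \<in> T"
  have "dist x y < dist x y + 1" by simp
  from segment_ball[OF xy this] obtain C where "path_connected C" "C \<subseteq> T" "x \<in> C" "y \<in> C"
    by (metis Int_subset_iff)
  then show "path_component T x y" by (meson path_component_of_subset path_connected_component)
qed

lemma connected_T: "connected T" by (rule path_connected_imp_connected[OF path_connected_T])

text \<open>Segments join the points of a ball to its centre. The lifting criterion asks for this
  property, and it makes components of open sets open.\<close>

lemma locally_path_connected_T: "locally path_connected T"
  unfolding locally_path_connected_im_kleinen
proof (intro allI impI, elim conjE)
  fix V x assume V: "openin (top_of_set T) V" "x \<in> V"
  then obtain e where e: "e > 0" "T \<inter> ball x e \<subseteq> V"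
    by (rule openin_ballE)
  have xT: "x \<in> T" using V openin_imp_subset by blast
  have "\<exists>p. path p \<and> path_image p \<subseteq> V \<and> pathstart p = x \<and> pathfinish p = y" if y: "y \<in> T \<inter> ball x e" for y
  proof -
    have yT: "y \<in> T" "dist x y < e" using y by auto
    from segment_ball[OF xT yT] obtain C where "path_connected C" "C \<subseteq> T \<inter> ball x e" "x \<in> C" "y \<in> C"
      by metis
    then show ?thesis using e unfolding path_connected_def by (meson subset_trans)
  qed
  then show "\<exists>u. openin (top_of_set T) u \<and> x \<in> u \<and> u \<subseteq> V \<and>
               (\<forall>y. y \<in> u \<longrightarrow> (\<exists>p. path p \<and> path_image p \<subseteq> V \<and> pathstart p = x \<and> pathfinish p = y))"
    using e xT by (intro exI[of _ "T \<inter> ball x e"]) (auto simp: openin_open_Int)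
qed

lemma openin_component:
  assumes "openin (top_of_set T) U" "C \<in> components U" shows "openin (top_of_set T) C"
  using assms locally_path_connected_imp_locally_connected[OF locally_path_connected_T]
    locally_connected_open_component by blast

lemma openin_direction:
  assumes "C \<in> components (T - {x})" shows "openin (top_of_set T) C"
proof (rule openin_component[OF _ assms])
  have "openin (top_of_set T) (T \<inter> - {x})" by (rule openin_open_Int) auto
  then show "openin (top_of_set T) (T - {x})" by (simp add: Diff_eq)
qed

lemma locally_injective_q:
  assumes "x \<in> T" obtains e where "e > 0" "inj_on q (T \<inter> ball x e)"
proof -
  obtain N U p where N: "x \<in> N" "openin (top_of_set T) N" "homeomorphism N U q p"
    by (rule covering_space_local_homeomorphism[OF covering assms])
  obtain e where e: "e > 0" "T \<inter> ball x e \<subseteq> N" using N(2,1) by (rule openin_ballE)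
  have "inj_on q N" by (rule inj_on_inverseI[of _ p]) (rule homeomorphism_apply1[OF N(3)])
  then show ?thesis using that[OF e(1)] inj_on_subset[OF _ e(2)] by blast
qed

lemma fibre_isolated:
  assumes "x \<in> T" obtains e where "e > 0" "\<And>y. y \<in> T \<Longrightarrow> dist x y < e \<Longrightarrow> q y = z \<Longrightarrow> y = x"
proof -
  obtain e where e: "e > 0" "inj_on q (T \<inter> ball x e)" using assms by (rule locally_injective_q)
  show ?thesis
  proof (cases "q x = z")
    case True
    then have "y = x" if "y \<in> T" "dist x y < e" "q y = z" for y
      using inj_onD[OF e(2), of y x] that assms e(1) by auto
    then show ?thesis using that e by blast
  next
    case False
    have "openin (top_of_set T) (T \<inter> q -` (- {z}))"
      by (intro continuous_openin_preimage_gen cont_q) auto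
    moreover have "x \<in> T \<inter> q -` (- {z})" using assms False by simp
    ultimately obtain d where "d > 0" "T \<inter> ball x d \<subseteq> T \<inter> q -` (- {z})" by (rule openin_ballE)
    then have "q y \<noteq> z" if "y \<in> T" "dist x y < d" for y using that by auto
    then show ?thesis using that \<open>d > 0\<close> by blast
  qed
qed

text \<open>Uniqueness of lifts, applied to \<open>c\<close> and a constant map.\<close>

lemma constant_if_q_constant:
  assumes "connected C" "c ` C \<subseteq> T" "continuous_on C c" "\<And>x. x \<in> C \<Longrightarrow> q (c x) = z" "x \<in> C" "y \<in> C"
  shows "c x = c y"
proof -
  have "(\<lambda>_. c x) y = c y"
    by (rule covering_space_unique_lift[OF covering \<open>connected C\<close> \<open>x \<in> C\<close> _ _ _ assms(3,2)])
       (use assms in auto)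
  then show ?thesis .
qed

subsection \<open>Edges and their heights\<close>

text \<open>The parametrization belongs to the edge, so edges are oriented;
  \<open>edge_reverse\<close> turns them round.\<close>

definition edge :: "(real \<Rightarrow> 'a) \<Rightarrow> bool" where
  "edge u \<longleftrightarrow> isometric_segment T 1 u \<and> (\<exists>k\<in>{1..g}. u ` {0<..<1} \<in> components {y\<in>T. q y \<in> rose_edge k})"

text \<open>The open circles are disjoint and open in the rose, so \<open>q\<close> maps a connected
  set without vertices into a single one of them. A component of the preimage of that circle is an
  open edge by the definition of the cover.\<close>

lemma nonvertex_connected_in_edge:
  assumes C: "connected C" "C \<subseteq> T" "C \<noteq> {}" "\<And>y. y \<in> C \<Longrightarrow> q y \<noteq> 0"
  obtains u where "edge u" "C \<subseteq> u ` {0<..<1}"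
proof -
  obtain c where c: "c \<in> C" using C by blast
  have "q c \<in> rose g - {0}" using c C q_rose by blast
  then obtain k where k: "k \<in> {1..g}" "q c \<in> rose_edge k" unfolding rose_diff_0 by blast
  have "q y \<in> rose_edge k" if "y \<in> C" for y
  proof (rule connected_induction_simple[OF C(1) c that, of "\<lambda>y. q y \<in> rose_edge k"])
    show "q c \<in> rose_edge k" by (rule k(2))
    fix z assume z: "z \<in> C"
    have "q z \<in> rose g - {0}" using z C q_rose by blast
    then obtain j where j: "j \<in> {1..g}" "q z \<in> rose_edge j" unfolding rose_diff_0 by blast
    have "openin (top_of_set C) (C \<inter> q -` rose_edge j)"
      by (rule continuous_openin_preimage[OF continuous_on_subset[OF cont_q C(2)] _ openin_rose_edge[OF j(1)]])
         (use C q_rose in auto)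
    then show "\<exists>N. openin (top_of_set C) N \<and> z \<in> N \<and> (\<forall>x\<in>N. \<forall>y\<in>N. q x \<in> rose_edge k \<longrightarrow> q y \<in> rose_edge k)"
      using z j rose_edges_disjoint[of j k] k by (intro exI[of _ "C \<inter> q -` rose_edge j"]) auto
  qed
  then have "C \<subseteq> {y\<in>T. q y \<in> rose_edge k}" using C by blast
  then obtain e where e: "e \<in> components {y\<in>T. q y \<in> rose_edge k}" "C \<subseteq> e"
    using exists_component_superset[of C "{y\<in>T. q y \<in> rose_edge k}"] C c by blast
  have "\<forall>k\<in>{1..g}. \<forall>e\<in>components {y\<in>T. q y \<in> rose_edge k}. \<exists>u. isometric_segment T 1 u \<and> u ` {0<..<1} = e"
    using cover unfolding rose_universal_cover_def by (elim conjE)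
  then obtain u where u: "isometric_segment T 1 u" "u ` {0<..<1} = e"
    using k(1) e(1) by meson
  have "edge u" unfolding edge_def using u e(1) k(1) by (intro conjI bexI[of _ k]) simp_all
  moreover have "C \<subseteq> u ` {0<..<1}" using e(2) u(2) by simp
  ultimately show ?thesis by (rule that)
qed

lemma edge_through:
  assumes "x \<in> T" "q x \<noteq> 0" obtains u t where "edge u" "0 < t" "t < 1" "x = u t"
proof -
  have "connected {x}" "{x} \<subseteq> T" "{x} \<noteq> {}" "\<And>y. y \<in> {x} \<Longrightarrow> q y \<noteq> 0" using assms by auto
  then obtain u where u: "edge u" "{x} \<subseteq> u ` {0<..<1}" by (rule nonvertex_connected_in_edge)
  then obtain t where "0 < t" "t < 1" "x = u t" by auto
  then show ?thesis using that u by blast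
qed

context
  fixes u assumes u: "edge u"
begin

lemma edge_dist: "s \<in> {0..1} \<Longrightarrow> t \<in> {0..1} \<Longrightarrow> dist (u s) (u t) = \<bar>s - t\<bar>"
  using u unfolding edge_def isometric_segment_def by blast

lemma edge_in_T: "t \<in> {0..1} \<Longrightarrow> u t \<in> T"
  using u unfolding edge_def isometric_segment_def by blast

lemma edge_eq_iff: "s \<in> {0..1} \<Longrightarrow> t \<in> {0..1} \<Longrightarrow> u s = u t \<longleftrightarrow> s = t"
  using edge_dist[of s t] by (metis abs_0_eq dist_eq_0_iff right_minus_eq)

lemma edge_continuous: "continuous_on {0..1} u"
  using u isometric_segment_continuous unfolding edge_def by blast

lemma edge_interior: "0 < t \<Longrightarrow> t < 1 \<Longrightarrow> q (u t) \<noteq> 0"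
  using u rose_edge_0 unfolding edge_def
  by (metis (no_types, lifting) greaterThanLessThan_iff image_eqI in_components_subset mem_Collect_eq subsetD)

lemma openin_edge: "openin (top_of_set T) (u ` {0<..<1})"
proof -
  obtain k where k: "k \<in> {1..g}" "u ` {0<..<1} \<in> components {y\<in>T. q y \<in> rose_edge k}"
    using u edge_def by blast
  have "openin (top_of_set T) (T \<inter> q -` rose_edge k)"
    by (rule continuous_openin_preimage[OF cont_q _ openin_rose_edge[OF k(1)]]) (use q_rose in auto)
  moreover have "T \<inter> q -` rose_edge k = {y\<in>T. q y \<in> rose_edge k}" by auto
  ultimately show ?thesis using openin_component k(2) by metis
qed

text \<open>If \<open>u 0\<close> were no vertex, its image, a limit of points of one open circle,
  would lie on that circle as well. The half-open edge would then be a connected subset of the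
  preimage that is strictly larger than the component.\<close>

lemma edge_vertex_0: "q (u 0) = 0"
proof (rule ccontr)
  assume n: "q (u 0) \<noteq> 0"
  obtain k where k: "k \<in> {1..g}" "u ` {0<..<1} \<in> components {y\<in>T. q y \<in> rose_edge k}"
    using u edge_def by blast
  have cl: "q ` u ` {0<..<1} \<subseteq> rose_edge k" using k(2) in_components_subset by fastforce
  have "continuous_on {0..1} (q \<circ> u)"
    by (intro continuous_on_compose edge_continuous continuous_on_subset[OF cont_q]) (use edge_in_T in auto)
  then have "(q \<circ> u) ` closure {0<..<1} \<subseteq> closure (rose_edge k)"
    using image_closure_subset[of "{0<..<1::real}" "q \<circ> u" "closure (rose_edge k)"] cl closure_subset
    by (force simp: image_comp)
  then have "q (u 0) \<in> closure (rose_edge k)" by (auto simp: image_subset_iff)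
  then have "q (u 0) \<in> rose_edge k" using n rose_closure_edge by blast
  then have "u ` {0..<1} \<subseteq> {y\<in>T. q y \<in> rose_edge k}"
    using cl edge_in_T by (force simp: image_subset_iff less_le)
  moreover have "connected (u ` {0..<1})"
    by (intro connected_continuous_image continuous_on_subset[OF edge_continuous]) auto
  moreover have "u (1/2) \<in> u ` {0<..<1} \<inter> u ` {0..<1}" by auto
  ultimately have "u ` {0..<1} \<subseteq> u ` {0<..<1}" using components_maximal[OF k(2)] by blast
  then have "u 0 \<in> u ` {0<..<1}" by auto
  then show False using edge_eq_iff by force
qed

lemma edge_reverse: "edge (\<lambda>t. u (1 - t))"
proof -
  have "(\<lambda>t. 1 - t) ` {0<..<1} = {0<..<1::real}"
  proof (intro equalityI subsetI)
    fix t :: real assume "t \<in> {0<..<1}"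
    then show "t \<in> (\<lambda>t. 1 - t) ` {0<..<1}" by (intro image_eqI[of _ _ "1 - t"]) auto
  qed auto
  then have "(\<lambda>t. u (1 - t)) ` {0<..<1} = u ` {0<..<1}" by (metis image_image)
  then show ?thesis using u isometric_segment_reverse unfolding edge_def by metis
qed

lemma compact_edge: "compact (u ` {0..1})"
  by (rule compact_continuous_image[OF edge_continuous compact_Icc])

text \<open>
  The collapse of everything but the edge \<open>u\<close> is a map to the circle. It lifts to \<open>\<real>\<close> because \<open>T\<close> is
  simply connected, and the lift truncated to \<open>[0,1]\<close> is the height \<open>h\<close>.
\<close>
lemma height_exists:
  "\<exists>h :: 'a \<Rightarrow> real. continuous_on T h \<and> (\<forall>x\<in>T. h x \<in> {0..1}) \<and> (\<forall>t\<in>{0..1}. h (u t) = t) \<and>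
     (\<forall>x\<in>T. 0 < h x \<longrightarrow> h x < 1 \<longrightarrow> x = u (h x))"
proof -
  let ?K = "u ` {0..1}" and ?O = "T - u ` {0<..<1}"
  define \<phi> where "\<phi> x = (if x \<in> ?K then exp (2 * pi * \<i> * of_real (dist (u 0) x)) else (1::complex))" for x
  have KT: "?K \<subseteq> T" using edge_in_T by auto
  have phi_u: "\<phi> (u t) = exp (2 * pi * \<i> * of_real t)" if "t \<in> {0..1}" for t
    using that edge_dist[of 0 t] by (simp add: \<phi>_def)
  have phi_1: "\<phi> x = 1" if "x \<in> ?O" for x
  proof (cases "x \<in> ?K")
    case True
    then obtain t where t: "t \<in> {0..1}" "x = u t" by blast
    then have "t = 0 \<or> t = 1" using that by force
    then show ?thesis using phi_u[OF t(1)] t(2) by (auto simp: exp_two_pi_i')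
  qed (simp add: \<phi>_def)
  have "continuous_on (?K \<union> ?O) \<phi>"
  proof (rule continuous_on_Un_local)
    have "?K \<union> ?O = T" using KT by force
    moreover have "closedin (top_of_set T) ?K" by (intro closed_subset KT compact_imp_closed compact_edge)
    ultimately show "closedin (top_of_set (?K \<union> ?O)) ?K" by simp
    show "closedin (top_of_set (?K \<union> ?O)) ?O" using \<open>?K \<union> ?O = T\<close> openin_edge by (simp add: closedin_diff)
    have "continuous_on ?K (\<lambda>x. exp (2 * pi * \<i> * of_real (dist (u 0) x)))" by (intro continuous_intros)
    then show "continuous_on ?K \<phi>" by (rule continuous_on_eq) (simp add: \<phi>_def)
    show "continuous_on ?O \<phi>" by (rule continuous_on_eq[OF continuous_on_const]) (simp add: phi_1)
  qed
  moreover have "?K \<union> ?O = T" using KT by force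
  ultimately have cphi: "continuous_on T \<phi>" by simp
  have "\<phi> ` T \<subseteq> - {0}" by (auto simp: \<phi>_def)
  moreover have "\<phi> (u 0) = exp (0::complex)" using phi_u[of 0] by simp
  moreover have "u 0 \<in> T" using edge_in_T by simp
  ultimately obtain G where G: "continuous_on T G" "G (u 0) = 0" "\<And>x. x \<in> T \<Longrightarrow> exp (G x) = \<phi> x"
    using covering_space_lift_metric[OF covering_space_exp_punctured_plane UNIV_I, of "u 0" T \<phi> 0]
      simply locally_path_connected_T cphi by metis
  define H where "H x = Im (G x) / (2 * pi)" for x
  \<comment> \<open>Along the edge the lift is explicit: both sides lift the same loop of the circle
    and start at 0.\<close>
  have Gu: "G (u t) = 2 * pi * \<i> * of_real t" if "t \<in> {0..1}" for t
  proof (rule covering_space_unique_lift[OF covering_space_exp_punctured_plane, of "{0..1}" 0 "\<lambda>t. G (u t)" "\<lambda>t. 2 * pi * \<i> * of_real t"])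
    show "continuous_on {0..1} (\<lambda>t. G (u t))"
      by (intro continuous_on_compose2[OF G(1) edge_continuous]) (use edge_in_T in auto)
    show "exp (G (u s)) = exp (2 * pi * \<i> * of_real s)" if "s \<in> {0..1}" for s
      using that G(3) edge_in_T phi_u by simp
  qed (use G that in \<open>auto intro!: continuous_intros\<close>)
  have cH: "continuous_on T H" unfolding H_def by (intro continuous_intros G) simp
  let ?h = "\<lambda>x. max 0 (min 1 (H x))"
  have "x = u (H x)" if x: "x \<in> T" "0 < H x" "H x < 1" for x
  proof -
    have "x \<in> u ` {0<..<1}"
    proof (rule ccontr)
      assume "x \<notin> u ` {0<..<1}"
      then have "exp (G x) = 1" using G(3) phi_1 x by simp
      \<comment> \<open>Off the open edge \<open>H\<close> takes integer values, so a value strictly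
        between 0 and 1 occurs only on the edge.\<close>
      then obtain n :: int where n: "Im (G x) = of_int (2 * n) * pi" using exp_eq_1 by blast
      then have "H x = of_int n" by (simp add: H_def)
      then show False using x by simp
    qed
    then obtain t where "t \<in> {0<..<1}" "x = u t" by blast
    then show ?thesis using Gu[of t] by (simp add: H_def)
  qed
  moreover have "?h (u t) = t" if "t \<in> {0..1}" for t using Gu[OF that] that by (simp add: H_def)
  moreover have "continuous_on T ?h" by (intro continuous_intros cH)
  ultimately show ?thesis by (intro exI[of _ ?h]) (auto simp: max_def min_def split: if_splits)
qed

text \<open>Off the edge the height is 0 or 1, which tells the side of the edge. This replaces the
  statement that an inner point of an edge disconnects the tree.\<close>

definition height :: "'a \<Rightarrow> real" where
  "height = (SOME h. continuous_on T h \<and> (\<forall>x\<in>T. h x \<in> {0..1}) \<and> (\<forall>t\<in>{0..1}. h (u t) = t) \<and>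
     (\<forall>x\<in>T. 0 < h x \<longrightarrow> h x < 1 \<longrightarrow> x = u (h x)))"

lemma height: "continuous_on T height \<and> (\<forall>x\<in>T. height x \<in> {0..1}) \<and> (\<forall>t\<in>{0..1}. height (u t) = t) \<and>
     (\<forall>x\<in>T. 0 < height x \<longrightarrow> height x < 1 \<longrightarrow> x = u (height x))"
  unfolding height_def by (rule someI_ex[OF height_exists])

lemma height_continuous: "continuous_on T height"
  and height_edge: "\<And>t. 0 \<le> t \<Longrightarrow> t \<le> 1 \<Longrightarrow> height (u t) = t"
  and height_interior: "\<And>x. x \<in> T \<Longrightarrow> 0 < height x \<Longrightarrow> height x < 1 \<Longrightarrow> u (height x) = x"
  using height by simp_all

end

end

lemma openin_restrict:
  assumes "openin (top_of_set T) A" "K \<subseteq> T" shows "openin (top_of_set K) (K \<inter> A)"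
proof -
  obtain W where "open W" "A = T \<inter> W" using assms(1) openin_open by blast
  moreover from this have "K \<inter> A = K \<inter> W" using assms(2) by blast
  ultimately show ?thesis by (simp add: openin_open_Int)
qed

lemma connected_separation:
  assumes "connected K" "openin (top_of_set K) U" "openin (top_of_set K) V"
    "K \<subseteq> U \<union> V" "U \<inter> V = {}" "U \<noteq> {}"
  shows "V = {}"
  using assms unfolding connected_openin by meson

context rose_tree
begin

subsection \<open>Directions\<close>

text \<open>Every component contains the upper part of the edge. A component without points of
  height below 1 would be open and closed in \<open>T\<close>, hence all of \<open>T\<close>, but
  \<open>u 0\<close> has height 0.\<close>

lemma superlevel_connected:
  assumes u: "edge u" and t: "0 \<le> t" "t < 1"
  shows "connected {y\<in>T. height u y > t}"
proof -
  let ?A = "{y\<in>T. height u y > t}"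
  have oA: "openin (top_of_set T) ?A"
  proof -
    have "openin (top_of_set T) (T \<inter> height u -` {t<..})"
      by (intro continuous_openin_preimage_gen height_continuous u) auto
    moreover have "T \<inter> height u -` {t<..} = ?A" by auto
    ultimately show ?thesis by simp
  qed
  have cu: "connected (u ` {t<..<1})"
    by (intro connected_continuous_image continuous_on_subset[OF edge_continuous[OF u]]) (use t in auto)
  have uA: "u ` {t<..<1} \<subseteq> ?A" using t edge_in_T[OF u] height_edge[OF u] by auto
  have main: "u ` {t<..<1} \<subseteq> K" if K: "K \<in> components ?A" for K
  proof -
    have "\<exists>z\<in>K. height u z < 1"
    proof (rule ccontr)
      assume "\<not> (\<exists>z\<in>K. height u z < 1)"
      moreover have "K \<subseteq> ?A" by (rule in_components_subset[OF K])
      ultimately have KB: "K \<subseteq> {y\<in>T. height u y \<ge> 1}" by force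
      have "closedin (top_of_set {y\<in>T. height u y \<ge> 1}) K"
        by (rule closedin_subset_trans[OF closedin_component[OF K] KB]) (use t in auto)
      moreover have "closedin (top_of_set T) {y\<in>T. height u y \<ge> 1}"
      proof -
        have "closedin (top_of_set T) (T \<inter> height u -` {1..})"
          by (intro continuous_closedin_preimage height_continuous u) auto
        moreover have "T \<inter> height u -` {1..} = {y\<in>T. height u y \<ge> 1}" by auto
        ultimately show ?thesis by simp
      qed
      ultimately have "closedin (top_of_set T) K" by (rule closedin_trans)
      then have "K = T"
        using connected_T openin_component[OF oA K] in_components_nonempty[OF K] unfolding connected_clopen by blast
      then show False using KB edge_in_T[OF u, of 0] height_edge[OF u, of 0] by auto
    qed
    then obtain z where z: "z \<in> K" "height u z < 1" by blast
    then have zA: "z \<in> T" "height u z > t" using in_components_subset[OF K] by auto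
    then have "z = u (height u z)" using z t height_interior[OF u] by simp
    then have "z \<in> u ` {t<..<1}" using zA z by (metis greaterThanLessThan_iff image_eqI)
    then show ?thesis using components_maximal[OF K cu uA] z by blast
  qed
  have "u ((t + 1) / 2) \<in> u ` {t<..<1}" using t by auto
  then have "K = K'" if "K \<in> components ?A" "K' \<in> components ?A" for K K'
    using main[OF that(1)] main[OF that(2)] components_eq[OF that] by blast
  then show ?thesis unfolding connected_eq_connected_components_eq by blast
qed

lemma superlevel_direction:
  assumes u: "edge u" and t: "0 \<le> t" "t < 1"
  shows "{y\<in>T. height u y > t} \<in> components (T - {u t})"
proof -
  let ?A = "{y\<in>T. height u y > t}"
  \<comment> \<open>The second part of \<open>?B\<close> is there for \<open>t = 0\<close>, where
    \<open>u t\<close> and the points behind it all have height 0.\<close>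
  let ?B = "{y\<in>T. height u y < t} \<union> ({y\<in>T. height u y < 1} \<inter> (T - u ` {0..1}))"
  have "u ((t + 1) / 2) \<in> ?A" using t edge_in_T[OF u] height_edge[OF u] by auto
  then have neA: "?A \<noteq> {}" by blast
  have "?A \<subseteq> T - {u t}" using height_edge[OF u] t by auto
  moreover have "T - {u t} \<noteq> {}" using calculation neA by blast
  ultimately obtain K where K: "K \<in> components (T - {u t})" "?A \<subseteq> K"
    using exists_component_superset[of ?A "T - {u t}"] superlevel_connected[OF u t] by blast
  have op: "openin (top_of_set T) {y\<in>T. height u y \<in> W}" if "open W" for W
  proof -
    have "openin (top_of_set T) (T \<inter> height u -` W)"
      by (intro continuous_openin_preimage_gen height_continuous u that)
    moreover have "T \<inter> height u -` W = {y\<in>T. height u y \<in> W}" by auto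
    ultimately show ?thesis by simp
  qed
  have oA: "openin (top_of_set T) ?A" using op[of "{t<..}"] by simp
  have "openin (top_of_set T) (T \<inter> - u ` {0..1})"
    by (intro openin_open_Int) (simp add: closed_def[symmetric] compact_imp_closed compact_edge[OF u])
  then have oB: "openin (top_of_set T) ?B"
    using op[of "{..<t}"] op[of "{..<1}"] by (intro openin_Un openin_Int) (simp_all add: Diff_eq)
  have AB: "?A \<inter> ?B = {}"
  proof -
    have "height u y \<le> t" if "y \<in> T" "height u y < 1" "y \<notin> u ` {0..1}" for y
    proof (rule ccontr)
      assume "\<not> height u y \<le> t"
      then have "0 < height u y" using t by simp
      then have "u (height u y) = y" using height_interior[OF u] that by simp
      moreover have "height u y \<in> {0..1}" using \<open>0 < height u y\<close> that by simp
      ultimately have "y \<in> u ` {0..1}" by (metis image_eqI)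
      then show False using that by simp
    qed
    then show ?thesis by force
  qed
  have sub: "T - {u t} \<subseteq> ?A \<union> ?B"
  proof
    fix y assume y: "y \<in> T - {u t}"
    show "y \<in> ?A \<union> ?B"
    proof (cases "height u y = t")
      case True
      have "y \<notin> u ` {0..1}" using True y height_edge[OF u] by auto
      then show ?thesis using y True t by simp
    next
      case False
      then show ?thesis using y by auto
    qed
  qed
  have KT: "K \<subseteq> T" "K \<subseteq> ?A \<union> ?B" using in_components_subset[OF K(1)] sub by blast+
  have KB: "K \<inter> ?B = {}"
  proof (rule connected_separation[OF in_components_connected[OF K(1)]])
    show "openin (top_of_set K) (K \<inter> ?A)" "openin (top_of_set K) (K \<inter> ?B)"
      by (rule openin_restrict[OF _ KT(1)], rule oA oB)+
    show "K \<inter> ?A \<noteq> {}" using K(2) neA by blast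
    show "K \<subseteq> (K \<inter> ?A) \<union> (K \<inter> ?B)" using KT(2) by auto
    show "(K \<inter> ?A) \<inter> (K \<inter> ?B) = {}" using AB by auto
  qed
  have "K = ?A" using KT(2) K(2) KB by blast
  then show ?thesis using K(1) by simp
qed

text \<open>In a small ball \<open>x\<close> is the only possible vertex, so the segment from
  \<open>x\<close> to \<open>y\<close> has no vertex in its interior and runs in one closed
  edge.\<close>

lemma near_same_edge:
  assumes x: "x \<in> T"
  obtains e where "e > 0" "\<And>y. y \<in> T \<Longrightarrow> dist x y < e \<Longrightarrow> y \<noteq> x \<Longrightarrow> \<exists>u. edge u \<and> x \<in> u ` {0..1} \<and> y \<in> u ` {0..1}"
proof -
  obtain e where e: "e > 0" "\<And>y. y \<in> T \<Longrightarrow> dist x y < e \<Longrightarrow> q y = 0 \<Longrightarrow> y = x"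
    using fibre_isolated[OF x, of 0] by metis
  have "\<exists>u. edge u \<and> x \<in> u ` {0..1} \<and> y \<in> u ` {0..1}" if y: "y \<in> T" "dist x y < e" "y \<noteq> x" for y
  proof -
    let ?L = "dist x y"
    have L: "0 < ?L" using y by simp
    obtain v where v: "isometric_segment T ?L v" "v 0 = x" "v ?L = y" using segment x y(1) by blast
    have cv: "continuous_on {0..?L} v" by (rule isometric_segment_continuous[OF v(1)])
    let ?C = "v ` {0<..<?L}"
    have dv: "dist x (v s) = s" if "s \<in> {0..?L}" for s
    proof -
      have "dist (v 0) (v s) = \<bar>0 - s\<bar>" using v(1) that unfolding isometric_segment_def by auto
      then show ?thesis using v(2) that by simp
    qed
    have vT: "v s \<in> T" if "s \<in> {0..?L}" for s using v(1) that unfolding isometric_segment_def by blast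
    have "connected ?C" by (intro connected_continuous_image continuous_on_subset[OF cv]) auto
    moreover have "?C \<subseteq> T" using vT by auto
    moreover have "?C \<noteq> {}" using L by simp
    moreover have "q z \<noteq> 0" if z: "z \<in> ?C" for z
    proof
      assume "q z = 0"
      obtain s where s: "0 < s" "s < ?L" "z = v s" using z by auto
      then have "z \<in> T" "dist x z = s" using vT[of s] dv[of s] by simp_all
      then show False using e(2)[of z] \<open>q z = 0\<close> s y by simp
    qed
    ultimately obtain u where u: "edge u" "?C \<subseteq> u ` {0<..<1}" by (rule nonvertex_connected_in_edge)
    have "v ` closure {0<..<?L} \<subseteq> u ` {0..1}"
    proof (rule image_closure_subset)
      show "closed (u ` {0..1})" by (intro compact_imp_closed compact_edge u)
      show "v ` {0<..<?L} \<subseteq> u ` {0..1}" using u(2) by (rule order_trans) auto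
    qed (use cv L in auto)
    then have "v 0 \<in> u ` {0..1}" "v ?L \<in> u ` {0..1}" using L by (auto simp: image_subset_iff)
    then show ?thesis using u(1) v by auto
  qed
  then show ?thesis using that[OF e(1)] by blast
qed

text \<open>Converse of \<open>superlevel_direction\<close>, which gives all directions an explicit
  form. A short initial piece of a segment from \<open>x\<close> into \<open>\<delta>\<close> runs
  in one edge, and the edge is reversed if the height decreases on the way.\<close>

lemma direction_superlevel:
  assumes d: "\<delta> \<in> components (T - {x})" and x: "x \<in> T"
  obtains u t where "edge u" "0 \<le> t" "t < 1" "x = u t" "\<delta> = {y\<in>T. height u y > t}"
proof -
  note thesisI = that
  obtain e where e: "e > 0"
    "\<And>y. y \<in> T \<Longrightarrow> dist x y < e \<Longrightarrow> y \<noteq> x \<Longrightarrow> \<exists>u. edge u \<and> x \<in> u ` {0..1} \<and> y \<in> u ` {0..1}"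
    using near_same_edge[OF x] by metis
  obtain y where "y \<in> \<delta>" using in_components_nonempty[OF d] by blast
  then have y: "y \<in> T" "y \<noteq> x" using in_components_subset[OF d] by auto
  let ?L = "dist x y"
  obtain v where v: "isometric_segment T ?L v" "v 0 = x" "v ?L = y" using segment x y(1) by blast
  have cv: "continuous_on {0..?L} v" by (rule isometric_segment_continuous[OF v(1)])
  have dv: "dist x (v s) = s" "v s \<in> T" if "0 \<le> s" "s \<le> ?L" for s
  proof -
    have "dist (v 0) (v s) = \<bar>0 - s\<bar>" using v(1) that unfolding isometric_segment_def by auto
    then show "dist x (v s) = s" using v(2) that by simp
    show "v s \<in> T" using v(1) that unfolding isometric_segment_def by auto
  qed
  \<comment> \<open>Small enough for the ball of \<open>near_same_edge\<close>, and still on the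
    segment.\<close>
  define s where "s = min ?L (e / 2)"
  have s: "0 < s" "s \<le> ?L" "s < e" using e(1) y(2) by (auto simp: s_def)
  have sd: "v s \<in> \<delta>"
  proof -
    have "connected (v ` {0<..?L})" by (intro connected_continuous_image continuous_on_subset[OF cv]) auto
    moreover have "v ` {0<..?L} \<subseteq> T - {x}"
    proof (rule image_subsetI)
      fix a assume a: "a \<in> {0<..?L}"
      then have "dist x (v a) = a" "v a \<in> T" using dv[of a] by auto
      then show "v a \<in> T - {x}" using a by auto
    qed
    moreover have "y \<in> v ` {0<..?L}" using y v(3) by (metis greaterThanAtMost_iff image_eqI order_refl zero_less_dist_iff)
    ultimately have "v ` {0<..?L} \<subseteq> \<delta>" using components_maximal[OF d] \<open>y \<in> \<delta>\<close> by blast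
    then show ?thesis using s by auto
  qed
  have "v s \<noteq> x" using dv(1)[of s] s by auto
  then obtain u where u: "edge u" "x \<in> u ` {0..1}" "v s \<in> u ` {0..1}" using e(2)[of "v s"] dv[of s] s by auto
  then obtain a b where ab: "a \<in> {0..1}" "b \<in> {0..1}" "x = u a" "v s = u b" by blast
  have *: ?thesis if u: "edge u" and ab: "a \<in> {0..1}" "b \<in> {0..1}" "x = u a" "v s = u b" "a < b" for u a b
  proof -
    have a: "0 \<le> a" "a < 1" using ab by auto
    have "v s \<in> {y\<in>T. height u y > a}" using ab height_edge[OF u] edge_in_T[OF u] by auto
    then have "\<delta> = {y\<in>T. height u y > a}"
      using components_eq[OF d superlevel_direction[OF u a, folded ab(3)]] sd by blast
    then show ?thesis using thesisI[OF u a ab(3)] by blast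
  qed
  show ?thesis
  proof (cases "a < b")
    case True
    show ?thesis by (rule *[OF u(1) ab True])
  next
    case False
    then have "b < a" using ab \<open>v s \<noteq> x\<close> by (metis linorder_neqE)
    show ?thesis by (rule *[OF edge_reverse[OF u(1)], of "1 - a" "1 - b"]) (use ab \<open>b < a\<close> in auto)
  qed
qed

text \<open>\<open>D\<close> looks back over \<open>x\<close> from a point of the edge that leads
  into \<open>\<delta>\<close>. It stands in for the complement of \<open>\<delta>\<close>, which
  need not be a direction, and meets \<open>\<delta>\<close> only in a piece of this edge.\<close>

lemma direction_shrink:
  assumes d: "\<delta> \<in> components (T - {x})" and x: "x \<in> T"
  obtains x' D where "x' \<in> T" "D \<in> components (T - {x'})" "x \<in> D" "\<And>y. y \<in> D \<Longrightarrow> y \<in> \<delta> \<Longrightarrow> dist x y \<le> 1"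
proof -
  obtain u t where u: "edge u" and t: "0 \<le> t" "t < 1" and xt: "x = u t" and dt: "\<delta> = {y\<in>T. height u y > t}"
    by (rule direction_superlevel[OF assms])
  \<comment> \<open>Any parameter strictly between \<open>x\<close> and the far end of the edge
    would do.\<close>
  define r where "r = (t + 1) / 2"
  have r: "t < r" "r < 1" "0 \<le> r" using t by (auto simp: r_def)
  let ?u' = "\<lambda>s. u (1 - s)"
  have u': "edge ?u'" by (rule edge_reverse[OF u])
  let ?D = "{y\<in>T. height ?u' y > 1 - r}"
  have D: "?D \<in> components (T - {u r})"
    using superlevel_direction[OF u', of "1 - r"] r t by simp
  have xD: "x \<in> ?D" using height_edge[OF u', of "1 - t"] t r xt edge_in_T[OF u, of t] by simp
  have xh: "height u x = t" using height_edge[OF u, of t] t xt by simp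
  have "{y\<in>T. height u y > r} \<inter> ?D = {}"
  proof -
    have "x \<notin> {y\<in>T. height u y > r}" using xh r by simp
    then show ?thesis using components_eq[OF superlevel_direction[OF u r(3,2)] D] xD by blast
  qed
  then have "dist x y \<le> 1" if "y \<in> ?D" "y \<in> \<delta>" for y
  proof -
    have y: "y \<in> T" "t < height u y" "height u y \<le> r" using that dt \<open>_ \<inter> ?D = {}\<close> by auto
    then have "u (height u y) = y" using height_interior[OF u] t r by simp
    then have "dist x y = \<bar>t - height u y\<bar>"
      using edge_dist[OF u, of t "height u y"] y t r xt by simp
    then show ?thesis using y t r by simp
  qed
  then show ?thesis using that[OF _ D xD] edge_in_T[OF u, of r] r by simp
qed

text \<open>The base point slides back along its edge to the vertex \<open>u 0\<close>, so only a
  piece of that edge is added. Directions based at vertices are the ones that paths inside a cell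
  cannot leave.\<close>

lemma direction_enlarge:
  assumes d: "\<delta> \<in> components (T - {x})" and x: "x \<in> T"
  obtains v \<delta>' where "v \<in> T" "q v = 0" "\<delta>' \<in> components (T - {v})" "\<delta> \<subseteq> \<delta>'"
    "\<And>y. y \<in> \<delta>' \<Longrightarrow> y \<notin> \<delta> \<Longrightarrow> dist x y \<le> 1"
proof -
  obtain u t where u: "edge u" and t: "0 \<le> t" "t < 1" and xt: "x = u t" and dt: "\<delta> = {y\<in>T. height u y > t}"
    by (rule direction_superlevel[OF assms])
  show ?thesis
  proof (rule that[of "u 0" "{y\<in>T. height u y > 0}"])
    show "u 0 \<in> T" using edge_in_T[OF u] by simp
    show "q (u 0) = 0" by (rule edge_vertex_0[OF u])
    show "{y\<in>T. height u y > 0} \<in> components (T - {u 0})" using superlevel_direction[OF u, of 0] by simp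
    show "\<delta> \<subseteq> {y\<in>T. height u y > 0}" using dt t by auto
    fix y assume "y \<in> {y\<in>T. height u y > 0}" "y \<notin> \<delta>"
    then have y: "y \<in> T" "0 < height u y" "height u y \<le> t" using dt by auto
    then have "u (height u y) = y" using height_interior[OF u] t by simp
    then have "dist x y = \<bar>t - height u y\<bar>"
      using edge_dist[OF u, of t "height u y"] y t xt by simp
    then show "dist x y \<le> 1" using y t by simp
  qed
qed

text \<open>The segment from \<open>y\<close> to \<open>z\<close> is too short to reach
  \<open>x\<close>.\<close>

lemma far_in_direction:
  assumes d: "\<delta> \<in> components (T - {x})" and y: "y \<in> \<delta>" and z: "z \<in> T" and far: "dist y z < dist x y"
  shows "z \<in> \<delta>"
proof -
  have yT: "y \<in> T" using in_components_subset[OF d] y by blast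
  from segment_ball[OF yT z far]
  obtain C where C: "path_connected C" "C \<subseteq> T \<inter> ball y (dist x y)" "y \<in> C" "z \<in> C" by metis
  have "C \<subseteq> T - {x}" using C(2) by (auto simp: dist_commute)
  then show ?thesis using components_maximal[OF d path_connected_imp_connected[OF C(1)]] C y by blast
qed

text \<open>To enter and leave \<open>\<delta>\<close> the segment would have to pass
  \<open>x\<close> twice, but isometric segments are injective.\<close>

lemma segment_avoids_direction:
  assumes d: "\<delta> \<in> components (T - {x})" and v: "isometric_segment T l v" and ends: "v 0 \<notin> \<delta>" "v l \<notin> \<delta>"
    and s: "s \<in> {0..l}"
  shows "v s \<notin> \<delta>"
proof
  assume vs: "v s \<in> \<delta>"
  have cv: "continuous_on {0..l} v" by (rule isometric_segment_continuous[OF v])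
  have vT: "v ` {0..l} \<subseteq> T" using v unfolding isometric_segment_def by blast
  have *: "\<exists>r\<in>{a..b}. v r = x" if "{a..b} \<subseteq> {0..l}" "s \<in> {a..b}" "c \<in> {a..b}" "v c \<notin> \<delta>" for a b c
  proof (rule ccontr)
    assume n: "\<not> (\<exists>r\<in>{a..b}. v r = x)"
    have "connected (v ` {a..b})" by (intro connected_continuous_image continuous_on_subset[OF cv] that) auto
    moreover have "v ` {a..b} \<subseteq> T - {x}" using n vT that(1) by blast
    ultimately have "v ` {a..b} \<subseteq> \<delta>" using components_maximal[OF d] vs that(2) by blast
    then show False using that by blast
  qed
  obtain r1 where r1: "r1 \<in> {0..s}" "v r1 = x" using *[of 0 s 0] s ends by auto
  obtain r2 where r2: "r2 \<in> {s..l}" "v r2 = x" using *[of s l l] s ends by auto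
  have "r1 = r2" using inj_onD[OF isometric_segment_inj[OF v], of r1 r2] r1 r2 s by auto
  then have "v s = x" using r1 r2 by auto
  then show False using vs in_components_subset[OF d] by blast
qed

subsection \<open>Deck transformations\<close>

definition deck :: "('a \<Rightarrow> 'a) \<Rightarrow> bool" where
  "deck h \<longleftrightarrow> (\<exists>h'. homeomorphism T T h h') \<and> (\<forall>y\<in>T. q (h y) = q y)"

lemma deck_in_T: "deck h \<Longrightarrow> y \<in> T \<Longrightarrow> h y \<in> T"
  unfolding deck_def using homeomorphism_image1 by blast

lemma deck_q: "deck h \<Longrightarrow> y \<in> T \<Longrightarrow> q (h y) = q y"
  unfolding deck_def by blast

lemma deck_continuous: "deck h \<Longrightarrow> continuous_on T h"
  unfolding deck_def using homeomorphism_cont1 by blast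

lemma lifts_agree:
  assumes "continuous_on T h" "h ` T \<subseteq> T" "\<And>y. y \<in> T \<Longrightarrow> q (h y) = q y"
    and "continuous_on T k" "k ` T \<subseteq> T" "\<And>y. y \<in> T \<Longrightarrow> q (k y) = q y"
    and "a \<in> T" "h a = k a" "y \<in> T"
  shows "h y = k y"
  using covering_space_unique_lift[OF covering connected_T assms(7,8,1,2,4,5)] assms by simp

lemma deck_unique:
  assumes "deck h" "deck k" "a \<in> T" "h a = k a" "y \<in> T"
  shows "h y = k y"
  by (rule lifts_agree[of h k a]) (use assms deck_in_T deck_q deck_continuous in auto)

text \<open>As \<open>T\<close> is simply connected, \<open>q\<close> lifts through itself, once
  with \<open>a\<close> sent to \<open>b\<close> and once the other way round. Both composites are
  lifts with a fixed point, hence the identity.\<close>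

lemma deck_exists:
  assumes "a \<in> T" "b \<in> T" "q a = q b"
  obtains h where "deck h" "h a = b"
proof -
  have *: "\<exists>h. continuous_on T h \<and> h ` T \<subseteq> T \<and> h a = b \<and> (\<forall>y\<in>T. q (h y) = q y)"
    if "a \<in> T" "b \<in> T" "q a = q b" for a b
    using covering_space_lift_metric[OF covering that(2,1) simply locally_path_connected_T cont_q _ that(3)] q_rose
    by (metis image_subsetI)
  obtain h where h: "continuous_on T h" "h ` T \<subseteq> T" "h a = b" "\<forall>y\<in>T. q (h y) = q y" using *[OF assms] by blast
  obtain k where k: "continuous_on T k" "k ` T \<subseteq> T" "k b = a" "\<forall>y\<in>T. q (k y) = q y"
    using *[OF assms(2,1)] assms(3) by auto
  have kh: "(k \<circ> h) y = id y" if "y \<in> T" for y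
  proof (rule lifts_agree[of "k \<circ> h" id a y])
    show "continuous_on T (k \<circ> h)" by (rule continuous_on_compose[OF h(1) continuous_on_subset[OF k(1) h(2)]])
  qed (use h k assms that in \<open>auto simp: image_subset_iff\<close>)
  have hk: "(h \<circ> k) y = id y" if "y \<in> T" for y
  proof (rule lifts_agree[of "h \<circ> k" id b y])
    show "continuous_on T (h \<circ> k)" by (rule continuous_on_compose[OF k(1) continuous_on_subset[OF h(1) k(2)]])
  qed (use h k assms that in \<open>auto simp: image_subset_iff\<close>)
  have "homeomorphism T T h k"
    by (rule homeomorphismI) (use h k kh hk in auto)
  then have "deck h" using h unfolding deck_def by blast
  then show ?thesis using that h(3) by blast
qed

text \<open>Deck transformations preserve vertices, so the image of an open edge lies in an open
  edge. The bound does not depend on \<open>h\<close>.\<close>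

lemma deck_edge_diameter:
  assumes h: "deck h" and u: "edge u" and st: "s \<in> {0..1}" "t \<in> {0..1}"
  shows "dist (h (u s)) (h (u t)) \<le> 1"
proof -
  have c: "continuous_on {0..1} (h \<circ> u)"
    using edge_in_T[OF u]
    by (intro continuous_on_compose edge_continuous u continuous_on_subset[OF deck_continuous[OF h]]) auto
  let ?C = "(h \<circ> u) ` {0<..<1}"
  have "connected ?C" by (intro connected_continuous_image continuous_on_subset[OF c]) auto
  moreover have "?C \<subseteq> T" using edge_in_T[OF u] deck_in_T[OF h] by auto
  moreover have "?C \<noteq> {}" by simp
  moreover have "q z \<noteq> 0" if "z \<in> ?C" for z
    using that edge_interior[OF u] deck_q[OF h] edge_in_T[OF u] by auto
  ultimately obtain u' where u': "edge u'" "?C \<subseteq> u' ` {0<..<1}" by (rule nonvertex_connected_in_edge)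
  have "(h \<circ> u) ` closure {0<..<1} \<subseteq> u' ` {0..1}"
  proof (rule image_closure_subset)
    show "closed (u' ` {0..1})" by (intro compact_imp_closed compact_edge u')
    show "(h \<circ> u) ` {0<..<1} \<subseteq> u' ` {0..1}" using u'(2) by (rule order_trans) auto
  qed (use c in auto)
  then have "h (u s) \<in> u' ` {0..1}" "h (u t) \<in> u' ` {0..1}" using st by (auto simp: image_subset_iff)
  then obtain a b where "a \<in> {0..1}" "b \<in> {0..1}" "h (u s) = u' a" "h (u t) = u' b" by blast
  then show ?thesis using edge_dist[OF u'(1), of a b] by auto
qed

text \<open>
  Deck transformations need not be isometries here, since the lengths inside an edge are not
  required to be equivariant. They are quasi-isometries, which is all that matters for heaviness.
\<close>
lemma deck_displacement_bounded:
  assumes "y \<in> T" "z \<in> T"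
  obtains B where "\<And>h. deck h \<Longrightarrow> dist (h y) (h z) \<le> B"
proof -
  have "\<exists>B. \<forall>h. deck h \<longrightarrow> dist (h y) (h z) \<le> B"
  \<comment> \<open>Having orbits at bounded distance from each other is an equivalence relation on
    \<open>T\<close>. Its classes are open, since nearby points lie on a common edge and
    \<open>deck_edge_diameter\<close> then gives the bound 1 for all \<open>h\<close> at
    once.\<close>
  proof (rule connected_equivalence_relation[OF connected_T assms])
    show "\<exists>B. \<forall>h. deck h \<longrightarrow> dist (h y) (h x) \<le> B" if "\<exists>B. \<forall>h. deck h \<longrightarrow> dist (h x) (h y) \<le> B" for x y
      using that by (simp add: dist_commute)
    show "\<exists>B. \<forall>h. deck h \<longrightarrow> dist (h x) (h z) \<le> B"
      if xy: "\<exists>B. \<forall>h. deck h \<longrightarrow> dist (h x) (h y) \<le> B" and yz: "\<exists>B. \<forall>h. deck h \<longrightarrow> dist (h y) (h z) \<le> B" for x y z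
    proof -
      obtain B1 B2 where B: "\<forall>h. deck h \<longrightarrow> dist (h x) (h y) \<le> B1" "\<forall>h. deck h \<longrightarrow> dist (h y) (h z) \<le> B2"
        using xy yz by blast
      have "dist (h x) (h z) \<le> B1 + B2" if "deck h" for h
        using dist_triangle[of "h x" "h z" "h y"] B that by force
      then show ?thesis by blast
    qed
    fix x assume x: "x \<in> T"
    obtain e where e: "e > 0"
      "\<And>y. y \<in> T \<Longrightarrow> dist x y < e \<Longrightarrow> y \<noteq> x \<Longrightarrow> \<exists>u. edge u \<and> x \<in> u ` {0..1} \<and> y \<in> u ` {0..1}"
      using near_same_edge[OF x] by metis
    have "dist (h x) (h y) \<le> 1" if y: "y \<in> T" "dist x y < e" and h: "deck h" for y h
    proof (cases "y = x")
      case False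
      then obtain u a b where "edge u" "x = u a" "y = u b" "a \<in> {0..1}" "b \<in> {0..1}" using e(2) y by blast
      then show ?thesis using deck_edge_diameter[OF h] by blast
    qed simp
    then have "\<forall>y\<in>T \<inter> ball x e. \<exists>B. \<forall>h. deck h \<longrightarrow> dist (h x) (h y) \<le> B"
      by (metis IntE mem_ball)
    moreover have "openin (top_of_set T) (T \<inter> ball x e)" "x \<in> T \<inter> ball x e"
      using e(1) x by (simp_all add: openin_open_Int)
    ultimately show "\<exists>N. openin (top_of_set T) N \<and> x \<in> N \<and> (\<forall>y\<in>N. \<exists>B. \<forall>h. deck h \<longrightarrow> dist (h x) (h y) \<le> B)"
      by blast
  qed
  then show ?thesis using that by blast
qed

text \<open>This evaluates the definite description. By monodromy all lifts at \<open>t\<close> of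
  loops in \<open>c\<close> end at the same point, and a deck transformation is determined by one
  value; \<open>restrict\<close> meets the extensionality clause.\<close>

lemma deck_action_eq:
  assumes h: "deck h" and l: "path l" "path_image l \<subseteq> T" "pathstart l = t" "pathfinish l = h t" "q \<circ> l \<in> c"
    and c: "\<And>r r'. r \<in> c \<Longrightarrow> r' \<in> c \<Longrightarrow> homotopic_paths (rose g) r r'" and y: "y \<in> T"
  shows "deck_action T q t c y = h y"
proof -
  have tT: "t \<in> T" using l by (metis pathstart_in_path_image subsetD)
  have "deck_action T q t c = restrict h T"
    unfolding deck_action_def
  proof (rule the_equality)
    obtain h' where h': "homeomorphism T T h h'" using h deck_def by blast
    have "homeomorphism T T (restrict h T) h'"
      by (rule homeomorphism_cong[OF h']) auto
    then show "restrict h T \<in> extensional T \<and> (\<exists>h'. homeomorphism T T (restrict h T) h') \<and>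
      (\<forall>y\<in>T. q (restrict h T y) = q y) \<and>
      (\<exists>l. path l \<and> path_image l \<subseteq> T \<and> pathstart l = t \<and> pathfinish l = restrict h T t \<and> q \<circ> l \<in> c)"
      using l tT deck_q[OF h] by auto
  next
    fix k assume "k \<in> extensional T \<and> (\<exists>h'. homeomorphism T T k h') \<and> (\<forall>y\<in>T. q (k y) = q y) \<and>
      (\<exists>l. path l \<and> path_image l \<subseteq> T \<and> pathstart l = t \<and> pathfinish l = k t \<and> q \<circ> l \<in> c)"
    then obtain l' where k: "k \<in> extensional T" "deck k"
      and l': "path l'" "path_image l' \<subseteq> T" "pathstart l' = t" "pathfinish l' = k t" "q \<circ> l' \<in> c"
      unfolding deck_def by blast
    have "pathfinish l' = pathfinish l"
      by (rule covering_space_monodromy_metric[OF covering l'(1,2) l(1,2) c]) (use l l' in auto)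
    then have "k t = h t" using l l' by simp
    then have "k y = h y" if "y \<in> T" for y using deck_unique[OF k(2) h tT _ that] by simp
    then show "k = restrict h T" using k(1) by (intro extensionalityI[of k T]) auto
  qed
  then show ?thesis using y by simp
qed

end

section \<open>Lines in the tree\<close>

text \<open>An injective continuous function on the line is monotone. The limit is common to all
  shifts \<open>s\<close> because \<open>K (n + s)\<close> lies between \<open>K n\<close> and
  \<open>K (n + 1)\<close>; \<open>line_meets_vertex\<close> turns this into constancy of a periodic
  function.\<close>

lemma bounded_injective_limit:
  fixes K :: "real \<Rightarrow> real"
  assumes cont: "continuous_on UNIV K" and inj: "inj K" and b: "\<And>x. \<bar>K x\<bar> \<le> B"
  obtains L where "\<And>s. 0 \<le> s \<Longrightarrow> s \<le> 1 \<Longrightarrow> (\<lambda>n. K (real n + s)) \<longlonglongrightarrow> L"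
proof -
  have *: "\<exists>L. \<forall>s. 0 \<le> s \<and> s \<le> 1 \<longrightarrow> (\<lambda>n. K (real n + s)) \<longlonglongrightarrow> L"
    if m: "mono K" and b: "\<And>x. \<bar>K x\<bar> \<le> B" for K
  proof -
    have "monoseq (\<lambda>n. K (real n))" unfolding monoseq_def using monoD[OF m] by simp
    moreover have "Bseq (\<lambda>n. K (real n))" using b by (intro BseqI'[of _ B]) simp
    ultimately obtain L where L: "(\<lambda>n. K (real n)) \<longlonglongrightarrow> L"
      using Bseq_monoseq_convergent convergent_def by blast
    have "(\<lambda>n. K (real n + s)) \<longlonglongrightarrow> L" if s: "0 \<le> s" "s \<le> 1" for s
    proof (rule tendsto_sandwich[OF _ _ L LIMSEQ_Suc[OF L]])
      show "\<forall>\<^sub>F n in sequentially. K (real n) \<le> K (real n + s)" using monoD[OF m] s by simp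
      show "\<forall>\<^sub>F n in sequentially. K (real n + s) \<le> K (real (Suc n))" using monoD[OF m] s by simp
    qed
    then show ?thesis by blast
  qed
  consider "strict_mono K" | "strict_antimono_on UNIV K"
    using injective_eq_monotone_map[of UNIV K] cont inj by auto
  then show ?thesis
  proof cases
    case 1
    then show ?thesis using *[of K] b that strict_mono_mono by blast
  next
    case 2
    then have "mono (\<lambda>x. - K x)" unfolding monotone_on_def by (auto simp: le_less)
    then obtain L where L: "\<forall>s. 0 \<le> s \<and> s \<le> 1 \<longrightarrow> (\<lambda>n. - K (real n + s)) \<longlonglongrightarrow> L"
      using *[of "\<lambda>x. - K x"] b by auto
    have "(\<lambda>n. K (real n + s)) \<longlonglongrightarrow> - L" if "0 \<le> s" "s \<le> 1" for s
      using tendsto_minus[of "\<lambda>n. - K (real n + s)" L] L that by simp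
    then show ?thesis using that by blast
  qed
qed

section \<open>Locally injective lines with periodic projection: injectivity and divergence\<close>

context rose_tree
begin

text \<open>By the intermediate value theorem the height would take the value \<open>t\<close> on
  \<open>J\<close>, and an inner point of the edge is the only point of its height.\<close>

lemma separated_by_edge_point:
  assumes u: "edge u" and t: "0 < t" "t < 1" and J: "connected J" "J \<subseteq> T" "u t \<notin> J"
    and ab: "a \<in> J" "b \<in> J" "height u a < t"
  shows "height u b < t"
proof (rule ccontr)
  assume "\<not> height u b < t"
  moreover have "connected (height u ` J)"
    by (intro connected_continuous_image continuous_on_subset[OF height_continuous[OF u]] J)
  ultimately have "t \<in> height u ` J"
    using connected_contains_Icc[of "height u ` J" "height u a" "height u b"] ab by force
  then obtain y where y: "y \<in> J" "height u y = t" by blast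
  then have "y = u t" using height_interior[OF u, of y] J(2) t by auto
  then show False using y J by blast
qed

text \<open>Near \<open>c\<close> the path stays on the open edge, where the height is a coordinate,
  and an injective continuous real function is strictly monotone.\<close>

lemma injective_path_crosses:
  assumes u: "edge u" and t: "0 < t" "t < 1" and c: "l c = u t" and e: "e > (0::real)"
    and l: "continuous_on (ball c e) l" "l ` ball c e \<subseteq> T" "inj_on l (ball c e)"
  obtains a b where "c - e < a" "a < c" "c < b" "b < c + e"
    "height u (l a) < t \<and> t < height u (l b) \<or> height u (l b) < t \<and> t < height u (l a)"
proof -
  have "openin (top_of_set (ball c e)) (ball c e \<inter> l -` (u ` {0<..<1}))"
    by (rule continuous_openin_preimage[OF l(1) _ openin_edge[OF u]]) (use l(2) in auto)
  moreover have "c \<in> ball c e \<inter> l -` (u ` {0<..<1})" using c t e by auto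
  ultimately obtain d where d: "d > 0" "ball c e \<inter> ball c d \<subseteq> ball c e \<inter> l -` (u ` {0<..<1})"
    by (rule openin_ballE)
  define r where "r = min d e / 2"
  have r: "0 < r" "r < d" "r < e" using d e by (auto simp: r_def)
  have sub: "{c - r..c + r} \<subseteq> ball c e" using r by (auto simp: dist_real_def)
  let ?H = "\<lambda>s. height u (l s)"
  have lu: "l s = u (?H s)" if s: "s \<in> {c - r..c + r}" for s
  proof -
    have "s \<in> ball c e \<inter> ball c d" using s r by (auto simp: dist_real_def)
    then have "l s \<in> u ` {0<..<1}" using d(2) by blast
    then show ?thesis using height_edge[OF u] by auto
  qed
  have "continuous_on {c - r..c + r} ?H"
    by (rule continuous_on_compose2[OF height_continuous[OF u] continuous_on_subset[OF l(1) sub]])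
       (use l(2) sub in auto)
  moreover have "inj_on ?H {c - r..c + r}"
  proof (rule inj_onI)
    fix x y assume xy: "x \<in> {c - r..c + r}" "y \<in> {c - r..c + r}" "?H x = ?H y"
    then have "l x = l y" using lu by metis
    then show "x = y" using inj_onD[OF l(3)] xy sub by blast
  qed
  ultimately have "?H (c - r) < ?H c \<and> ?H c < ?H (c + r) \<or> ?H (c + r) < ?H c \<and> ?H c < ?H (c - r)"
    using continuous_inj_imp_mono[of "c - r" c "c + r" ?H] r by simp
  moreover have "?H c = t" using c height_edge[OF u] t by simp
  ultimately show ?thesis using that[of "c - r" "c + r"] r by auto
qed

text \<open>These are the lifts of closed curves in the rose, so only the projection is periodic.
  Injectivity is demanded locally and becomes global in \<open>line_inj\<close>.\<close>

definition line :: "(real \<Rightarrow> 'a) \<Rightarrow> bool" where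
  "line l \<longleftrightarrow> continuous_on UNIV l \<and> range l \<subseteq> T \<and> (\<forall>t. \<exists>e>0. inj_on l (ball t e)) \<and>
     (\<forall>t. q (l (t + 1)) = q (l t))"

lemma nonvertex_time:
  assumes l: "continuous_on UNIV l" "range l \<subseteq> T" and ab: "a < (b::real)" and inj: "inj_on l {a<..<b}"
  obtains c where "a < c" "c < b" "q (l c) \<noteq> 0"
proof (rule ccontr)
  note I = that
  assume n: "\<not> thesis"
  have "q (l x) = 0" if "x \<in> {a<..<b}" for x using n I[of x] that by auto
  then have "l ((2 * a + b) / 3) = l ((a + 2 * b) / 3)"
    using l ab by (intro constant_if_q_constant[of "{a<..<b}" l 0]) (auto intro: continuous_on_subset)
  then show False using inj_onD[OF inj] ab by fastforce
qed

text \<open>A pair of distinct times with equal values and minimal distance bounds a simple loop. At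
  an inner time \<open>c\<close> off the vertices the loop crosses the point \<open>l c\<close> of
  an edge, which separates its two sides; but they are also joined through
  \<open>l s = l t\<close>.\<close>

lemma line_inj:
  assumes "line l" shows "inj l"
proof (rule ccontr)
  have l: "continuous_on UNIV l" "range l \<subseteq> T" "\<And>t. \<exists>e>0. inj_on l (ball t e)"
    using assms by (auto simp: line_def)
  obtain e where e: "\<And>t. e t > 0" "\<And>t. inj_on l (ball t (e t))" using l(3) by metis
  assume "\<not> inj l"
  then obtain a b where ab: "a < b" "l a = l b" unfolding inj_def by (metis linorder_neqE)
  \<comment> \<open>Near the diagonal \<open>l\<close> is injective. Removing this open
    neighbourhood keeps the trivial pairs out of \<open>P\<close> and leaves it compact, so that a
    minimal pair exists.\<close>
  define N where "N = (\<Union>t. ball t (e t) \<times> ball t (e t))"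
  define P where "P = ({a..b} \<times> {a..b}) \<inter> ({p. fst p \<le> snd p} \<inter> {p. dist (l (fst p)) (l (snd p)) \<le> 0}) \<inter> - N"
  have cl: "continuous_on UNIV (\<lambda>p :: real \<times> real. l (fst p))" "continuous_on UNIV (\<lambda>p :: real \<times> real. l (snd p))"
    by (auto intro!: continuous_on_compose2[OF l(1)] continuous_intros)
  have cP: "compact P" unfolding P_def
  proof (intro compact_Int_closed)
    show "closed (- N)" unfolding N_def by (auto intro: open_Times)
    show "closed ({p. fst p \<le> snd p} \<inter> {p. dist (l (fst p)) (l (snd p)) \<le> 0})"
      by (intro closed_Int closed_Collect_le continuous_intros cl)
    show "compact ({a..b} \<times> {a..b})" by (intro compact_Times) auto
  qed
  have inP: "(x, y) \<in> P" if "a \<le> x" "x < y" "y \<le> b" "l x = l y" for x y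
    using that inj_onD[OF e(2)] unfolding P_def N_def by fastforce
  then have "P \<noteq> {}" using inP[of a b] ab by auto
  moreover have "continuous_on P (\<lambda>p. snd p - fst p)" by (intro continuous_intros)
  ultimately have "\<exists>p\<in>P. \<forall>r\<in>P. snd p - fst p \<le> snd r - fst r"
    using cP by (intro continuous_attains_inf)
  then obtain p where p: "p \<in> P" "\<And>r. r \<in> P \<Longrightarrow> snd p - fst p \<le> snd r - fst r"
    by blast
  obtain s t where st: "p = (s, t)" by fastforce
  have s: "a \<le> s" "t \<le> b" "s \<le> t" "l s = l t" "(s, t) \<notin> N" using p(1) st by (auto simp: P_def)
  have "s \<noteq> t"
  proof
    assume "s = t"
    then have "(s, t) \<in> ball t (e t) \<times> ball t (e t)" using e(1)[of t] by simp
    then have "(s, t) \<in> N" unfolding N_def by blast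
    then show False using s by simp
  qed
  then have "s < t" using s by simp
  have min: "x = s \<and> y = t" if "s \<le> x" "x < y" "y \<le> t" "l x = l y" for x y
    using p(2)[OF inP[of x y]] that s st by auto
  have inj: "inj_on l {s<..<t}"
  proof (rule inj_onI, rule ccontr)
    fix x y assume xy: "x \<in> {s<..<t}" "y \<in> {s<..<t}" "l x = l y" "x \<noteq> y"
    then show False using min[of x y] min[of y x] by (cases "x < y") auto
  qed
  obtain c where c: "s < c" "c < t" "q (l c) \<noteq> 0"
    using nonvertex_time[OF l(1,2) \<open>s < t\<close> inj] by metis
  have "l c \<in> T" using l(2) by blast
  then obtain u r where u: "edge u" "0 < r" "r < 1" "l c = u r" using c(3) by (rule edge_through)
  define d where "d = min (c - s) (t - c)"
  have d: "d > 0" "ball c d \<subseteq> {s<..<t}" using c by (auto simp: d_def dist_real_def)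
  obtain x y where xy: "c - d < x" "x < c" "c < y" "y < c + d"
    "height u (l x) < r \<and> r < height u (l y) \<or> height u (l y) < r \<and> r < height u (l x)"
  proof (rule injective_path_crosses[where l=l and c=c and e=d, OF u d(1)])
    show "continuous_on (ball c d) l" using l(1) continuous_on_subset by blast
    show "inj_on l (ball c d)" by (rule inj_on_subset[OF inj d(2)])
  qed (use l(2) in auto)
  let ?J = "l ` {s..<c} \<union> l ` {c<..t}"
  have "connected ?J"
  proof (rule connected_Un)
    show "connected (l ` {s..<c})" "connected (l ` {c<..t})"
      by (auto intro!: connected_continuous_image continuous_on_subset[OF l(1)])
    have "l s \<in> l ` {s..<c}" "l t \<in> l ` {c<..t}" using c by auto
    then have "l s \<in> l ` {s..<c}" "l s \<in> l ` {c<..t}" using s(4) by simp_all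
    then show "l ` {s..<c} \<inter> l ` {c<..t} \<noteq> {}" by blast
  qed
  moreover have "?J \<subseteq> T" using l(2) by auto
  moreover have "u r \<notin> ?J"
  proof
    assume "u r \<in> ?J"
    then obtain z where "z \<in> {s..<c} \<union> {c<..t}" "l z = l c" using u(4) by force
    then show False using min[of z c] min[of c z] c by auto
  qed
  moreover have "l x \<in> ?J" "l y \<in> ?J" using xy d(2) c by (auto simp: d_def)
  ultimately show False
    using separated_by_edge_point[OF u(1-3), of ?J "l x" "l y"] separated_by_edge_point[OF u(1-3), of ?J "l y" "l x"] xy(5)
    by fastforce
qed

text \<open>Otherwise the two rays of the line on either side of \<open>c\<close>, joined by
  \<open>C\<close>, form a connected set that misses \<open>l c\<close> and yet has points on both
  sides of it.\<close>

lemma line_between_nonvertex: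
  assumes ln: "line l" and abc: "a < c" "c < b" and nv: "q (l c) \<noteq> 0"
    and C: "connected C" "C \<subseteq> T" "l a \<in> C" "l b \<in> C"
  shows "l c \<in> C"
proof (rule ccontr)
  assume lc: "l c \<notin> C"
  have l: "continuous_on UNIV l" "range l \<subseteq> T" "inj l"
    using ln line_inj by (auto simp: line_def)
  have "l c \<in> T" using l(2) by blast
  then obtain u t where u: "edge u" "0 < t" "t < 1" "l c = u t" using nv by (rule edge_through)
  obtain x y where xy: "c - 1 < x" "x < c" "c < y" "y < c + 1"
    "height u (l x) < t \<and> t < height u (l y) \<or> height u (l y) < t \<and> t < height u (l x)"
  proof (rule injective_path_crosses[where l=l and c=c and e=1, OF u])
    show "continuous_on (ball c 1) l" using l(1) continuous_on_subset by blast
    show "inj_on l (ball c 1)" using l(3) inj_on_subset by blast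
  qed (use l(2) in auto)
  let ?A = "l ` {..<c}" and ?B = "l ` {c<..}"
  have conn: "connected ?A" "connected ?B"
    by (auto intro!: connected_continuous_image continuous_on_subset[OF l(1)])
  have nin: "u t \<notin> ?A" "u t \<notin> ?B" using l(3) u(4) by (auto dest: injD)
  have "connected (?A \<union> C)" by (rule connected_Un[OF conn(1) C(1)]) (use C abc in auto)
  then have "connected (?A \<union> C \<union> ?B)" by (rule connected_Un[OF _ conn(2)]) (use C abc in auto)
  moreover have "?A \<union> C \<union> ?B \<subseteq> T" using l(2) C(2) by auto
  moreover have "u t \<notin> ?A \<union> C \<union> ?B" using nin lc u(4) by auto
  moreover have "l x \<in> ?A \<union> C \<union> ?B" "l y \<in> ?A \<union> C \<union> ?B" using xy by auto
  ultimately show False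
    using separated_by_edge_point[OF u(1-3), of "?A \<union> C \<union> ?B" "l x" "l y"]
      separated_by_edge_point[OF u(1-3), of "?A \<union> C \<union> ?B" "l y" "l x"] xy(5)
    by fastforce
qed

text \<open>Points of the line off the vertices lie on the segment from \<open>l a\<close> to
  \<open>l b\<close>, which gives the equation for them. Their times are dense, and the defect
  \<open>?F\<close> is continuous.\<close>

lemma line_dist_additive:
  assumes ln: "line l" and abc: "a \<le> c" "c \<le> b"
  shows "dist (l a) (l b) = dist (l a) (l c) + dist (l c) (l b)"
proof (rule ccontr)
  have l: "continuous_on UNIV l" "range l \<subseteq> T" "inj l"
    using ln line_inj by (auto simp: line_def)
  have lT: "l s \<in> T" for s using l(2) by blast
  let ?F = "\<lambda>c. dist (l a) (l c) + dist (l c) (l b) - dist (l a) (l b)"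
  assume "dist (l a) (l b) \<noteq> dist (l a) (l c) + dist (l c) (l b)"
  then have Fc: "?F c \<noteq> 0" by simp
  then have "a \<noteq> c" "c \<noteq> b" by auto
  then have c: "a < c" "c < b" using abc by auto
  have "continuous_on UNIV ?F" by (intro continuous_intros l)
  then have "open {c. ?F c \<noteq> 0}" by (intro open_Collect_neq) (auto intro: continuous_intros)
  then have "open ({c. ?F c \<noteq> 0} \<inter> {a<..<b})" by auto
  moreover have "c \<in> {c. ?F c \<noteq> 0} \<inter> {a<..<b}" using Fc c by simp
  ultimately obtain d where d: "d > 0" "ball c d \<subseteq> {c. ?F c \<noteq> 0} \<inter> {a<..<b}" by (meson openE)
  have "c - d < c + d" "inj_on l {c - d<..<c + d}" using d(1) inj_on_subset[OF l(3)] by auto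
  then obtain s where s: "c - d < s" "s < c + d" "q (l s) \<noteq> 0"
    using nonvertex_time[OF l(1,2)] by metis
  then have "s \<in> ball c d" by (auto simp: dist_real_def)
  then have F: "?F s \<noteq> 0" "a < s" "s < b" using d(2) by auto
  let ?L = "dist (l a) (l b)"
  obtain v where v: "isometric_segment T ?L v" "v 0 = l a" "v ?L = l b" using segment lT by metis
  have "l s \<in> v ` {0..?L}"
  proof (rule line_between_nonvertex[OF ln F(2,3) s(3)])
    show "connected (v ` {0..?L})"
      by (intro connected_continuous_image isometric_segment_continuous[OF v(1)]) auto
    show "v ` {0..?L} \<subseteq> T" using v(1) unfolding isometric_segment_def by blast
    show "l a \<in> v ` {0..?L}" using v(2) by (metis atLeastAtMost_iff image_eqI order_refl zero_le_dist)
    show "l b \<in> v ` {0..?L}" using v(3) by (metis atLeastAtMost_iff image_eqI order_refl zero_le_dist)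
  qed
  then obtain r where r: "0 \<le> r" "r \<le> ?L" "l s = v r" by auto
  have "dist (v 0) (v r) = \<bar>0 - r\<bar>" "dist (v r) (v ?L) = \<bar>r - ?L\<bar>"
    using v(1) r unfolding isometric_segment_def by auto
  then show False using F(1) r v(2,3) by simp
qed

text \<open>The direction at \<open>x\<close> that contains \<open>y\<close> begins with an edge at
  \<open>x\<close>, and \<open>y\<close> has height 1 over it. On the way from \<open>x\<close> to
  \<open>y\<close> every height below 1 is taken, at a distance from \<open>x\<close> equal to that
  height.\<close>

lemma vertices_far:
  assumes xy: "x \<in> T" "y \<in> T" "x \<noteq> y" "q x = 0" "q y = 0"
  shows "dist x y \<ge> 1"
proof (rule ccontr)
  assume n: "\<not> dist x y \<ge> 1"
  have "y \<in> T - {x}" using xy by auto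
  then obtain \<delta> where d: "\<delta> \<in> components (T - {x})" "y \<in> \<delta>" by (metis UnionE Union_components)
  obtain u t where u: "edge u" and t: "0 \<le> t" "t < 1" and xt: "x = u t" and dt: "\<delta> = {y\<in>T. height u y > t}"
    using d(1) xy(1) by (rule direction_superlevel)
  have "t = 0" using edge_interior[OF u, of t] xt xy(4) t by force
  have "height u y \<ge> 1"
  proof (rule ccontr)
    assume "\<not> height u y \<ge> 1"
    then have h: "0 < height u y" "height u y < 1" using d dt \<open>t = 0\<close> by auto
    then have "q y \<noteq> 0" using edge_interior[OF u h] height_interior[OF u xy(2) h] by simp
    then show False using xy by simp
  qed
  \<comment> \<open>Any number strictly between \<open>dist x y\<close> and 1 would do.\<close>
  define s where "s = (dist x y + 1) / 2"
  have s: "0 < s" "s < 1" "dist x y < s" using n xy by (auto simp: s_def intro: add_nonneg_pos)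
  have lt: "dist x y < dist x y + 1" by simp
  obtain C where C: "path_connected C" "C \<subseteq> T \<inter> ball x (dist x y + 1)" "x \<in> C" "y \<in> C"
    "\<And>z. z \<in> C \<Longrightarrow> dist x z \<le> dist x y"
    using segment_ball[OF xy(1,2) lt] by metis
  have "connected (height u ` C)"
    by (intro connected_continuous_image continuous_on_subset[OF height_continuous[OF u]] path_connected_imp_connected C)
       (use C in auto)
  moreover have "height u x = 0" using xt \<open>t = 0\<close> height_edge[OF u, of 0] by simp
  ultimately have "s \<in> height u ` C"
    using connected_contains_Icc[of "height u ` C" "height u x" "height u y"] C(3,4) s \<open>height u y \<ge> 1\<close> by force
  then obtain z where z: "z \<in> C" "height u z = s" by blast
  then have "z = u s" using height_interior[OF u, of z] C(2) s by auto
  then have "dist x z = s" using edge_dist[OF u, of 0 s] xt \<open>t = 0\<close> s by simp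
  then show False using C(5)[OF z(1)] s by simp
qed

lemma line_period: "line l \<Longrightarrow> q (l (t + of_int n)) = q (l t)"
proof (induction n rule: int_induct[of _ 0])
  case (step1 i)
  then show ?case unfolding line_def by (metis add.assoc of_int_1 of_int_add)
next
  case (step2 i)
  have "q (l (t + of_int (i - 1) + 1)) = q (l (t + of_int (i - 1)))"
    using step2.prems unfolding line_def by blast
  then show ?case using step2 by simp
qed simp

text \<open>A line without vertices lies in one open edge, so its height converges. As the
  projection is periodic, the sequence \<open>q (l (n + s))\<close> is constant, and its limit is
  the same for all \<open>s\<close> between 0 and 1. So \<open>l\<close> is constant there, against
  injectivity.\<close>

lemma line_meets_vertex:
  assumes ln: "line l" obtains c where "q (l c) = 0"
proof (rule ccontr)
  assume "\<not> thesis"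
  then have nv: "q (l t) \<noteq> 0" for t using that by blast
  have l: "continuous_on UNIV l" "range l \<subseteq> T" "inj l"
    using ln line_inj by (auto simp: line_def)
  have "connected (range l)" by (rule connected_continuous_image[OF l(1)]) simp
  moreover note l(2)
  moreover have "range l \<noteq> {}" by simp
  moreover have "q y \<noteq> 0" if "y \<in> range l" for y using that nv by blast
  ultimately obtain u where u: "edge u" "range l \<subseteq> u ` {0<..<1}" by (rule nonvertex_connected_in_edge)
  let ?H = "\<lambda>t. height u (l t)"
  have lu: "l t = u (?H t) \<and> 0 < ?H t \<and> ?H t < 1" for t
  proof -
    have "l t \<in> u ` {0<..<1}" using u(2) by blast
    then obtain s where "0 < s" "s < 1" "l t = u s" by auto
    then show ?thesis using height_edge[OF u(1), of s] by simp
  qed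
  have "continuous_on UNIV ?H"
    by (rule continuous_on_compose2[OF height_continuous[OF u(1)] l(1,2)])
  moreover have "inj ?H"
  proof (rule injI)
    fix x y assume "?H x = ?H y"
    then have "l x = l y" using lu[of x] lu[of y] by metis
    then show "x = y" by (rule injD[OF l(3)])
  qed
  moreover have "\<bar>?H t\<bar> \<le> 1" for t using lu[of t] by simp
  ultimately obtain L where L: "\<And>s. 0 \<le> s \<Longrightarrow> s \<le> 1 \<Longrightarrow> (\<lambda>n. ?H (real n + s)) \<longlonglongrightarrow> L"
    by (rule bounded_injective_limit) blast
  have L01: "L \<in> {0..1}"
    using LIMSEQ_le_const[OF L[of 0], of 0] LIMSEQ_le_const2[OF L[of 0], of 1] lu by (simp add: less_imp_le)
  have qL: "q (l s) = q (u L)" if s: "s \<in> {0<..<1}" for s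
  proof -
    have "continuous_on {0..1} (q \<circ> u)"
      by (intro continuous_on_compose edge_continuous u continuous_on_subset[OF cont_q])
         (use edge_in_T[OF u(1)] in auto)
    then have "(\<lambda>n. (q \<circ> u) (?H (real n + s))) \<longlonglongrightarrow> (q \<circ> u) L"
      by (rule continuous_on_tendsto_compose[OF _ L L01]) (use s lu in \<open>auto simp: less_imp_le\<close>)
    moreover have "(q \<circ> u) (?H (real n + s)) = q (l s)" for n
      using lu[of "real n + s"] line_period[OF ln, of s "int n"] by (simp add: add.commute)
    ultimately show ?thesis using LIMSEQ_unique[OF tendsto_const] by auto
  qed
  have "l (1/3) = l (1/2)"
    by (rule constant_if_q_constant[of "{0<..<1}" l "q (u L)"]) (use l qL in \<open>auto intro: continuous_on_subset\<close>)
  then show False using injD[OF l(3)] by fastforce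
qed

text \<open>Vertices recur with period 1, consecutive ones are at distance at least 1, and distances
  add up along a line.\<close>

lemma line_diverges:
  assumes ln: "line l"
  shows "filterlim (\<lambda>n. dist (l 0) (l (real n))) at_top sequentially"
proof -
  have l: "continuous_on UNIV l" "range l \<subseteq> T" "inj l"
    using ln line_inj by (auto simp: line_def)
  obtain c' where "q (l c') = 0" using ln by (rule line_meets_vertex)
  \<comment> \<open>The vertex time is shifted into \<open>{0..<1}\<close>, so that \<open>n\<close>
    full periods after it fit in before time \<open>n + 1\<close>.\<close>
  then have c: "q (l (frac c')) = 0"
    using line_period[OF ln, of "frac c'" "\<lfloor>c'\<rfloor>"] by (simp add: frac_def)
  let ?c = "frac c'"
  have c01: "0 \<le> ?c" "?c < 1" by (auto simp: frac_lt_1)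
  have qn: "q (l (?c + real n)) = 0" for n using line_period[OF ln, of ?c "int n"] c by simp
  have far: "dist (l ?c) (l (?c + real n)) \<ge> real n" for n
  proof (induction n)
    case (Suc n)
    have "l (?c + real n) \<noteq> l (?c + real (Suc n))" using l(3) by (auto dest: injD)
    then have "dist (l (?c + real n)) (l (?c + real (Suc n))) \<ge> 1"
      using vertices_far qn l(2) by (metis rangeI subsetD)
    then show ?case using line_dist_additive[OF ln, of ?c "?c + real n" "?c + real (Suc n)"] Suc by simp
  qed simp
  have "dist (l 0) (l (real (Suc n))) \<ge> real n" for n
  proof -
    have "dist (l 0) (l (real (Suc n))) = dist (l 0) (l ?c) + dist (l ?c) (l (real (Suc n)))"
      by (rule line_dist_additive[OF ln]) (use c01 in auto)
    moreover have "dist (l ?c) (l (real (Suc n))) = dist (l ?c) (l (?c + real n)) + dist (l (?c + real n)) (l (real (Suc n)))"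
      by (rule line_dist_additive[OF ln]) (use c01 in auto)
    moreover note far[of n] zero_le_dist[of "l 0" "l ?c"] zero_le_dist[of "l (?c + real n)" "l (real (Suc n))"]
    ultimately show ?thesis by linarith
  qed
  then have "filterlim (\<lambda>n. dist (l 0) (l (real (Suc n)))) at_top sequentially"
    by (intro filterlim_at_top_mono[OF filterlim_real_sequentially]) auto
  then show ?thesis by (subst (asm) filterlim_sequentially_Suc)
qed

lemma line_reverse: "line l \<Longrightarrow> line (\<lambda>t. l (- t))"
  unfolding line_def
proof (elim conjE, intro conjI allI)
  assume l: "continuous_on UNIV l" "range l \<subseteq> T" "\<forall>t. \<exists>e>0. inj_on l (ball t e)" "\<forall>t. q (l (t + 1)) = q (l t)"
  show "continuous_on UNIV (\<lambda>t. l (- t))" by (intro continuous_on_compose2[OF l(1)] continuous_intros) simp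
  show "range (\<lambda>t. l (- t)) \<subseteq> T" using l(2) by auto
  fix t
  show "q (l (- (t + 1))) = q (l (- t))" using l(4)[rule_format, of "- (t + 1)"] by simp
  obtain e where e: "e > 0" "inj_on l (ball (- t) e)" using l(3) by blast
  have "inj_on (\<lambda>t. l (- t)) (ball t e)"
  proof (rule inj_onI)
    fix x y assume xy: "x \<in> ball t e" "y \<in> ball t e" "l (- x) = l (- y)"
    then have "- x \<in> ball (- t) e" "- y \<in> ball (- t) e" by (auto simp: dist_real_def)
    then show "x = y" using inj_onD[OF e(2) xy(3)] by simp
  qed
  then show "\<exists>e>0. inj_on (\<lambda>t. l (- t)) (ball t e)" using e by blast
qed

text \<open>
  An injective line passes the base point of a direction at most once, so one of its two rays stays
  inside.
\<close>
lemma line_ray_in_direction: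
  assumes ln: "line l" and d: "\<delta> \<in> components (T - {x})" "l 0 \<in> \<delta>"
  obtains \<epsilon> :: real where "\<epsilon> \<in> {1, - 1}" "\<And>n::nat. l (\<epsilon> * real n) \<in> \<delta>"
    "filterlim (\<lambda>n. dist (l 0) (l (\<epsilon> * real n))) at_top sequentially"
proof -
  have l: "continuous_on UNIV l" "range l \<subseteq> T" "inj l"
    using ln line_inj by (auto simp: line_def)
  have ray: "l ` R \<subseteq> \<delta>" if "x \<notin> l ` R" "connected R" "0 \<in> R" for R
  proof (rule components_maximal[OF d(1)])
    show "connected (l ` R)" by (intro connected_continuous_image continuous_on_subset[OF l(1)] that) auto
    show "l ` R \<subseteq> T - {x}" using l(2) that(1) by blast
    show "\<delta> \<inter> l ` R \<noteq> {}" using d(2) that(3) by blast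
  qed
  consider "x \<notin> l ` {0..}" | "x \<notin> l ` {..0}"
  proof (cases "x \<in> l ` {0..} \<and> x \<in> l ` {..0}")
    case True
    then obtain a b where "a \<ge> 0" "b \<le> 0" "l a = x" "l b = x" by auto
    then have "l 0 = x" using injD[OF l(3), of a b] by auto
    then show ?thesis using d in_components_subset by blast
  qed blast
  then show ?thesis
  proof cases
    case 1
    then have "l (1 * real n) \<in> \<delta>" for n using ray[of "{0..}"] by auto
    moreover have "filterlim (\<lambda>n. dist (l 0) (l (1 * real n))) at_top sequentially"
      using line_diverges[OF ln] by simp
    ultimately show ?thesis using that[of 1] by blast
  next
    case 2
    then have "l (- 1 * real n) \<in> \<delta>" for n using ray[of "{..0}"] by auto
    moreover have "filterlim (\<lambda>n. dist (l 0) (l (- 1 * real n))) at_top sequentially"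
      using line_diverges[OF line_reverse[OF ln]] by simp
    ultimately show ?thesis using that[of "- 1"] by blast
  qed
qed

end

section \<open>Square complexes and their covers\<close>

text \<open>The complement in \<open>X\<close> of a path component of \<open>U\<close> is a finite
  union of compact sets, since convexity of \<open>C\<close> makes the part of \<open>C\<close> that
  is mapped into the component open in \<open>C\<close>. In a Hausdorff space this union is
  closed.\<close>

lemma locally_path_connected_finite_compact_union:
  fixes X :: "'a::t2_space set" and F :: "(('b::real_normed_vector \<Rightarrow> 'a) \<times> 'b set) set"
  assumes fin: "finite F" and X: "X = (\<Union>(\<phi>, C)\<in>F. \<phi> ` C)"
    and F: "\<And>\<phi> C. (\<phi>, C) \<in> F \<Longrightarrow> compact C \<and> convex C \<and> continuous_on C \<phi>"
  shows "locally path_connected X"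
  unfolding locally_path_connected_open_path_component
proof (intro allI impI, elim conjE)
  fix U x assume U: "openin (top_of_set X) U" "x \<in> U"
  let ?P = "path_component_set U x"
  have PU: "?P \<subseteq> U" by (rule path_component_subset)
  have UX: "U \<subseteq> X" by (rule openin_imp_subset[OF U(1)])
  have cl: "compact (\<phi> ` C - ?P)" if p: "(\<phi>, C) \<in> F" for \<phi> C
  proof -
    have C: "compact C" "convex C" "continuous_on C \<phi>" using F[OF p] by auto
    have CX: "\<phi> ` C \<subseteq> X" using p X by auto
    have oU: "openin (top_of_set C) (C \<inter> \<phi> -` U)"
      by (rule continuous_openin_preimage[OF C(3) _ U(1)]) (use CX in auto)
    have "openin (top_of_set C) (C \<inter> \<phi> -` ?P)"
    proof (subst openin_subopen, intro ballI)
      fix z assume z: "z \<in> C \<inter> \<phi> -` ?P"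
      then have "z \<in> C \<inter> \<phi> -` U" using PU by blast
      with oU obtain r where r: "r > 0" "C \<inter> ball z r \<subseteq> C \<inter> \<phi> -` U" by (rule openin_ballE)
      have sub: "C \<inter> ball z r \<subseteq> C \<inter> \<phi> -` ?P"
      proof
        fix w assume w: "w \<in> C \<inter> ball z r"
        have "path_connected (\<phi> ` (C \<inter> ball z r))"
          by (intro path_connected_continuous_image continuous_on_subset[OF C(3)] convex_imp_path_connected convex_Int C)
             auto
        moreover have "\<phi> ` (C \<inter> ball z r) \<subseteq> U" using r(2) by blast
        moreover have "\<phi> z \<in> \<phi> ` (C \<inter> ball z r)" "\<phi> w \<in> \<phi> ` (C \<inter> ball z r)" using z w r(1) by auto
        ultimately have "path_component U (\<phi> z) (\<phi> w)"
          by (meson path_component_of_subset path_connected_component)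
        moreover have "path_component U x (\<phi> z)" using z by simp
        ultimately have "path_component U x (\<phi> w)" using path_component_trans by metis
        then show "w \<in> C \<inter> \<phi> -` ?P" using w by simp
      qed
      have "openin (top_of_set C) (C \<inter> ball z r)" by (simp add: openin_open_Int)
      moreover have "z \<in> C \<inter> ball z r" using z r(1) by simp
      ultimately show "\<exists>N. openin (top_of_set C) N \<and> z \<in> N \<and> N \<subseteq> C \<inter> \<phi> -` ?P" using sub by blast
    qed
    then have "closedin (top_of_set C) (C - (C \<inter> \<phi> -` ?P))" by (intro closedin_diff) auto
    then have "compact (C - (C \<inter> \<phi> -` ?P))" by (rule closedin_compact[OF C(1)])
    then have "compact (\<phi> ` (C - (C \<inter> \<phi> -` ?P)))"
      by (intro compact_continuous_image continuous_on_subset[OF C(3)]) auto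
    moreover have "\<phi> ` (C - (C \<inter> \<phi> -` ?P)) = \<phi> ` C - ?P" by auto
    ultimately show ?thesis by simp
  qed
  have "X - ?P = (\<Union>(\<phi>, C)\<in>F. \<phi> ` C - ?P)" unfolding X by blast
  moreover have "compact (\<Union>(\<phi>, C)\<in>F. \<phi> ` C - ?P)"
    by (intro compact_UN fin) (use cl in auto)
  ultimately have "closed (X - ?P)" by (simp add: compact_imp_closed)
  then have "openin (top_of_set X) (X \<inter> - (X - ?P))" by (intro openin_open_Int) (simp add: closed_def)
  moreover have "X \<inter> - (X - ?P) = ?P" using PU UX by blast
  ultimately show "openin (top_of_set X) ?P" by simp
qed

lemma square_complex_locally_path_connected:
  assumes sc: "square_complex X V E Q" shows "locally path_connected X"
proof -
  let ?I = "{0..1::real}"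
  \<comment> \<open>Vertices and edges also get domains in the plane, because all pieces need
    domains of one type.\<close>
  let ?FV = "(\<lambda>v. (\<lambda>_::real\<times>real. v, {0})) ` V" and ?FE = "(\<lambda>e. (e \<circ> fst, ?I \<times> {0::real})) ` E"
    and ?FQ = "(\<lambda>s. (s, ?I \<times> ?I)) ` Q"
  let ?F = "?FV \<union> ?FE \<union> ?FQ"
  have fin: "finite V \<and> finite E \<and> finite Q"
    using sc unfolding square_complex_def by (elim conjE) (intro conjI)
  have un: "\<Union>(open_cells V E Q) = X"
    using sc unfolding square_complex_def by (elim conjE)
  have "\<forall>e\<in>E. continuous_on ?I e \<and> inj_on e {0<..<1} \<and> e 0 \<in> V \<and> e 1 \<in> V"
    using sc unfolding square_complex_def by (elim conjE)
  then have E: "\<And>e. e \<in> E \<Longrightarrow> continuous_on ?I e \<and> e 0 \<in> V \<and> e 1 \<in> V" by simp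
  have Q': "\<forall>s\<in>Q. continuous_on (?I \<times> ?I) s \<and> inj_on s ({0<..<1} \<times> {0<..<1}) \<and>
        (\<forall>side\<in>{\<lambda>t. s (t, 0), \<lambda>t. s (t, 1), \<lambda>t. s (0, t), \<lambda>t. s (1, t)}.
           \<exists>e\<in>E. (\<forall>t\<in>?I. side t = e t) \<or> (\<forall>t\<in>?I. side t = e (1 - t)))"
    using sc unfolding square_complex_def by (elim conjE)
  then have Q: "\<And>s. s \<in> Q \<Longrightarrow> continuous_on (?I \<times> ?I) s" by (meson)
  have sides: "\<And>s side. s \<in> Q \<Longrightarrow> side \<in> {\<lambda>t. s (t, 0), \<lambda>t. s (t, 1), \<lambda>t. s (0, t), \<lambda>t. s (1, t)} \<Longrightarrow>
       \<exists>e\<in>E. (\<forall>t\<in>?I. side t = e t) \<or> (\<forall>t\<in>?I. side t = e (1 - t))"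
    using Q' by meson
  have eX: "e t \<in> X" if "e \<in> E" "t \<in> ?I" for e t
  proof -
    have "t = 0 \<or> t = 1 \<or> t \<in> {0<..<1}" using that by auto
    then have "e t \<in> V \<union> open_edge e" using E[OF that(1)] by (auto simp: open_edge_def)
    then show ?thesis using un that(1) unfolding open_cells_def by blast
  qed
  have sX: "s (a, b) \<in> X" if s: "s \<in> Q" and ab: "a \<in> ?I" "b \<in> ?I" for s a b
  proof (cases "a \<in> {0<..<1} \<and> b \<in> {0<..<1}")
    case True
    then have "s (a, b) \<in> open_square s" by (auto simp: open_square_def)
    then show ?thesis using un s unfolding open_cells_def by blast
  next
    case False
    have side: "side t \<in> X" if sd: "side \<in> {\<lambda>t. s (t, 0), \<lambda>t. s (t, 1), \<lambda>t. s (0, t), \<lambda>t. s (1, t)}" "t \<in> ?I" for side t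
    proof -
      obtain e where "e \<in> E" "side t = e t \<or> side t = e (1 - t)" using sides[OF s sd(1)] sd(2) by blast
      then show ?thesis using eX[of e t] eX[of e "1 - t"] sd(2) by auto
    qed
    have "a = 0 \<or> a = 1 \<or> b = 0 \<or> b = 1" using False ab by auto
    then show ?thesis
      using side[of "\<lambda>t. s (t, 0)" a] side[of "\<lambda>t. s (t, 1)" a] side[of "\<lambda>t. s (0, t)" b] side[of "\<lambda>t. s (1, t)" b] ab
      by auto
  qed
  show ?thesis
  proof (rule locally_path_connected_finite_compact_union[of ?F])
    show "finite ?F" using fin by simp
    show "X = (\<Union>(\<phi>, C)\<in>?F. \<phi> ` C)"
    proof
      have VX: "V \<subseteq> X" using un unfolding open_cells_def by blast
      show "(\<Union>(\<phi>, C)\<in>?F. \<phi> ` C) \<subseteq> X" using VX eX sX by auto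
      have UI: "\<And>\<phi> C F x. (\<phi>, C) \<in> F \<Longrightarrow> x \<in> \<phi> ` C \<Longrightarrow> x \<in> (\<Union>(\<phi>, C)\<in>F. \<phi> ` C)" by blast
      show "X \<subseteq> (\<Union>(\<phi>, C)\<in>?F. \<phi> ` C)"
      proof
        fix x assume "x \<in> X"
        then consider "x \<in> V" | e where "e \<in> E" "x \<in> open_edge e" | s where "s \<in> Q" "x \<in> open_square s"
          using un unfolding open_cells_def by blast
        then show "x \<in> (\<Union>(\<phi>, C)\<in>?F. \<phi> ` C)"
        proof cases
          case 1
          then have "(\<lambda>_. x, {0}) \<in> ?FV" by blast
          then show ?thesis by (intro UI[of "\<lambda>_. x" "{0}"] UnI1) simp_all
        next
          case (2 e)
          then have F: "(e \<circ> fst, ?I \<times> {0}) \<in> ?FE" by blast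
          obtain t where "t \<in> {0<..<1}" "x = e t" using 2(2) unfolding open_edge_def by blast
          then have "x \<in> (e \<circ> fst) ` (?I \<times> {0::real})" by (intro image_eqI[of _ _ "(t, 0)"]) auto
          with F show ?thesis by (intro UI[of "e \<circ> fst" "?I \<times> {0}"] UnI1 UnI2[of _ ?FE])
        next
          case (3 s)
          then have F: "(s, ?I \<times> ?I) \<in> ?FQ" by blast
          obtain t where "t \<in> {0<..<1} \<times> {0<..<1}" "x = s t" using 3(2) unfolding open_square_def by blast
          then have "x \<in> s ` (?I \<times> ?I)" by (intro image_eqI[of _ _ t]) auto
          with F show ?thesis by (intro UI[of s "?I \<times> ?I"] UnI2[of _ ?FQ])
        qed
      qed
    qed
    fix \<phi> C assume "(\<phi>, C) \<in> ?F"
    then consider v where "\<phi> = (\<lambda>_. v)" "C = {0}" | e where "e \<in> E" "\<phi> = e \<circ> fst" "C = ?I \<times> {0}"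
      | "\<phi> \<in> Q" "C = ?I \<times> ?I"
      by (elim UnE) blast+
    then show "compact C \<and> convex C \<and> continuous_on C \<phi>"
    proof cases
      case (2 e)
      have "continuous_on C (e \<circ> fst)"
        by (rule continuous_on_compose[OF continuous_on_fst[OF continuous_on_id]])
           (use E[OF 2(1)] in \<open>auto simp: 2(3) intro: continuous_on_subset\<close>)
      then show ?thesis by (simp add: 2 compact_Times convex_Times)
    next
      case 3
      then show ?thesis using Q by (simp add: compact_Times convex_Times)
    qed simp
  qed
qed

text \<open>Local path connectedness lifts through the sheets, so path components of
  \<open>C\<close> are open.\<close>

lemma covering_space_path_connected:
  fixes C :: "'a::topological_space set" and B :: "'b::topological_space set"
  assumes cov: "covering_space C p B" and "connected C" and lpc: "locally path_connected B"
  shows "path_connected C"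
proof -
  have "path_component C a b" if ab: "a \<in> C" "b \<in> C" for a b
  proof (rule connected_equivalence_relation[OF \<open>connected C\<close> ab])
    fix x assume "x \<in> C"
    then obtain N U q where N: "x \<in> N" "openin (top_of_set C) N" "p x \<in> U" "openin (top_of_set B) U" "homeomorphism N U p q"
      by (rule covering_space_local_homeomorphism[OF cov])
    obtain W where W: "openin (top_of_set B) W" "path_connected W" "p x \<in> W" "W \<subseteq> U"
      using lpc N(3,4) unfolding locally_path_connected by meson
    have "openin (top_of_set U) W"
      using W(1,4) openin_imp_subset[OF N(4)] by (meson openin_subset_trans)
    then have "openin (top_of_set N) (q ` W)"
      by (rule homeomorphism_imp_open_map[OF homeomorphism_symD[OF N(5)]])
    then have o: "openin (top_of_set C) (q ` W)" using N(2) openin_trans by blast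
    have pc: "path_connected (q ` W)"
      by (intro path_connected_continuous_image W continuous_on_subset[OF homeomorphism_cont2[OF N(5)]])
    have x: "x \<in> q ` W" using homeomorphism_apply1[OF N(5,1)] W(3) by (metis image_eqI)
    have "path_component C x y" if "y \<in> q ` W" for y
      using pc x that openin_imp_subset[OF o] by (meson path_component_of_subset path_connected_component)
    then show "\<exists>T. openin (top_of_set C) T \<and> x \<in> T \<and> (\<forall>y\<in>T. path_component C x y)"
      using o x by blast
  next
    show "path_component C y x" if "path_component C x y" for x y using that by (rule path_component_sym)
    show "path_component C x z" if "path_component C x y" "path_component C y z" for x y z
      using that by (rule path_component_trans)
  qed
  then show ?thesis unfolding path_connected_component by blast
qed

section \<open>Closed curves and their lifts\<close>

text \<open>The curve is a copy of the unit circle and is parametrized by the angle in units of a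
  full turn. The offset \<open>?\<theta>\<close> makes it start at \<open>x\<close>.\<close>

lemma simple_closed_curve_periodic:
  fixes \<gamma> :: "'a::t2_space set"
  assumes g: "simple_closed_curve \<gamma>" and x: "x \<in> \<gamma>"
  obtains C :: "real \<Rightarrow> 'a" where "continuous_on UNIV C" "range C \<subseteq> \<gamma>" "C 0 = x" "\<And>t. C (t + 1) = C t"
    "\<And>s t. \<bar>s - t\<bar> < 1 \<Longrightarrow> C s = C t \<Longrightarrow> s = t"
proof -
  obtain c where c: "simple_path c" "pathfinish c = pathstart c" "path_image c = \<gamma>"
    using g unfolding simple_closed_curve_def by blast
  have "\<gamma> homeomorphic sphere (0::complex) 1"
    using homeomorphic_simple_path_image_circle[OF c(1,2), of 1 0] c(3) by simp
  then obtain k h where h: "homeomorphism \<gamma> (sphere (0::complex) 1) k h" unfolding homeomorphic_def by blast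
  have "k x \<in> sphere 0 1" using homeomorphism_image1[OF h] x by blast
  then have "norm (k x) = 1" by simp
  then have th: "k x = cis (Arg (k x))" by (metis Arg_def cis_Arg norm_zero sgn_div_norm scaleR_one inverse_1 zero_neq_one)
  let ?\<theta> = "Arg (k x)"
  let ?C = "\<lambda>t. h (cis (2 * pi * t + ?\<theta>))"
  have s: "cis a \<in> sphere 0 1" for a by simp
  show ?thesis
  proof
    show "continuous_on UNIV ?C"
      by (rule continuous_on_compose2[OF homeomorphism_cont2[OF h]]) (auto intro!: continuous_intros)
    show "range ?C \<subseteq> \<gamma>" using homeomorphism_image2[OF h] s by blast
    show "?C 0 = x" using homeomorphism_apply1[OF h x] th by simp
    show "?C (t + 1) = ?C t" for t
    proof -
      have "cis (2 * pi * (t + 1) + ?\<theta>) = cis (2 * pi * t + ?\<theta>) * cis (2 * pi)"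
        by (simp add: cis_mult algebra_simps)
      then show ?thesis by simp
    qed
    show "a = b" if ab: "\<bar>a - b\<bar> < 1" "?C a = ?C b" for a b
    proof -
      have "k (?C a) = k (?C b)" using ab by simp
      then have "cis (2 * pi * a + ?\<theta>) = cis (2 * pi * b + ?\<theta>)"
        using homeomorphism_apply2[OF h s] by simp
      then have "cis (2 * pi * a + ?\<theta>) / cis (2 * pi * b + ?\<theta>) = 1" by simp
      then have "cis (2 * pi * (a - b)) = 1" by (simp add: cis_divide algebra_simps)
      then have "cos (2 * pi * (a - b)) = 1" by (metis cis.simps(1) one_complex.simps(1))
      then obtain n :: int where "2 * pi * (a - b) = of_int n * 2 * pi" using cos_one_2pi_int by blast
      then have n: "a - b = of_int n" by simp
      then have "n = 0" using ab(1) by linarith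
      then show "a = b" using n by simp
    qed
  qed
qed

context rose_tree
begin

text \<open>The real line is simply connected, so the periodic curve lifts for all times at once;
  local injectivity of the projection passes to the lift.\<close>

lemma lift_curve_line:
  fixes C :: "real \<Rightarrow> 'b::topological_space"
  assumes C: "continuous_on UNIV C" "range C \<subseteq> \<Sigma>" "\<And>t. C (t + 1) = C t"
    and F: "continuous_on \<Sigma> F" "F ` \<Sigma> \<subseteq> rose g"
    and inj: "\<And>t. \<exists>e>0. inj_on (F \<circ> C) (ball t e)"
    and w: "w \<in> T" "q w = F (C 0)"
  obtains l where "line l" "l 0 = w" "\<And>t. q (l t) = F (C t)"
proof -
  have cont: "continuous_on UNIV (F \<circ> C)"
    by (intro continuous_on_compose C continuous_on_subset[OF F(1)])
  have sc: "simply_connected (UNIV :: real set)" by (rule convex_imp_simply_connected) simp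
  have im: "(F \<circ> C) ` UNIV \<subseteq> rose g" using F(2) C(2) by auto
  have "(F \<circ> C) 0 = q w" using w(2) by simp
  from covering_space_lift_metric[OF covering w(1) UNIV_I sc locally_path_connected_UNIV cont im this]
  obtain l where l: "continuous_on UNIV l" "l ` UNIV \<subseteq> T" "l 0 = w" "\<And>t. q (l t) = (F \<circ> C) t"
    by (metis UNIV_I)
  have "line l" unfolding line_def
  proof (intro conjI allI)
    fix t
    show "q (l (t + 1)) = q (l t)" using l(4) C(3) by simp
    obtain e where "e > 0" "inj_on (F \<circ> C) (ball t e)" using inj by blast
    then show "\<exists>e>0. inj_on l (ball t e)" using l(4) unfolding inj_on_def by metis
  qed (use l in auto)
  then show ?thesis using that l by simp
qed

subsection \<open>The action of the fundamental group\<close>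

text \<open>The class in the rose consists of paths homotopic to \<open>F \<circ> r\<close>. The
  projected lift agrees with \<open>F \<circ> r\<close> only on the unit interval, so its membership
  in the class takes a homotopy.\<close>

lemma loop_action:
  fixes \<Sigma> :: "'b::topological_space set"
  assumes F: "continuous_on \<Sigma> F" "F ` \<Sigma> \<subseteq> rose g" and r: "path r" "path_image r \<subseteq> \<Sigma>"
    and l: "path l" "path_image l \<subseteq> T" "\<And>s. s \<in> {0..1} \<Longrightarrow> q (l s) = F (r s)"
    and h: "deck h" "h (pathstart l) = pathfinish l" and y: "y \<in> T"
  shows "deck_action T q (pathstart l) (pi1_map (rose g) F (path_class \<Sigma> r)) y = h y"
proof (rule deck_action_eq[OF h(1) l(1,2) refl h(2)[symmetric] _ _ y])
  have *: "homotopic_paths (rose g) (F \<circ> r) c" if c: "c \<in> pi1_map (rose g) F (path_class \<Sigma> r)" for c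
  proof -
    obtain p where p: "homotopic_paths \<Sigma> r p" "homotopic_paths (rose g) (F \<circ> p) c"
      using c unfolding pi1_map_def path_class_def by blast
    have "homotopic_paths (rose g) (F \<circ> r) (F \<circ> p)"
      by (rule homotopic_paths_continuous_image[OF p(1) F(1)]) (use F(2) in auto)
    then show ?thesis using p(2) homotopic_paths_trans by blast
  qed
  show "homotopic_paths (rose g) c c'"
    if "c \<in> pi1_map (rose g) F (path_class \<Sigma> r)" "c' \<in> pi1_map (rose g) F (path_class \<Sigma> r)" for c c'
    using homotopic_paths_trans[OF homotopic_paths_sym[OF *[OF that(1)]] *[OF that(2)]] .
  have "homotopic_paths (rose g) (F \<circ> r) (q \<circ> l)"
  proof (rule homotopic_paths_eq)
    show "path (F \<circ> r)" by (intro path_continuous_image r continuous_on_subset[OF F(1)])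
    show "path_image (F \<circ> r) \<subseteq> rose g" using r(2) F(2) by (auto simp: path_image_compose)
  qed (use l(3) in auto)
  moreover have "homotopic_paths \<Sigma> r r" using r by simp
  ultimately show "q \<circ> l \<in> pi1_map (rose g) F (path_class \<Sigma> r)"
    unfolding pi1_map_def path_class_def by blast
qed

text \<open>The lift of the conjugated loop runs along \<open>p'\<close> and \<open>c'\<close> and
  returns along the translate of \<open>p'\<close> by \<open>h\<close>. So the deck transformation
  that belongs to the base point is the one that moves the end of \<open>p'\<close> to the end of
  \<open>c'\<close>.\<close>

lemma conjugate_loop_action:
  fixes \<Sigma> :: "'b::topological_space set"
  assumes F: "continuous_on \<Sigma> F" "F ` \<Sigma> \<subseteq> rose g" and p: "path p" "path_image p \<subseteq> \<Sigma>"
    and c: "path c" "path_image c \<subseteq> \<Sigma>" "pathstart c = pathfinish p" "pathfinish c = pathfinish p"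
    and p': "path p'" "path_image p' \<subseteq> T" "\<And>s. s \<in> {0..1} \<Longrightarrow> q (p' s) = F (p s)"
    and c': "path c'" "path_image c' \<subseteq> T" "\<And>s. s \<in> {0..1} \<Longrightarrow> q (c' s) = F (c s)" "pathstart c' = pathfinish p'"
  obtains h where "deck h" "h (pathfinish p') = pathfinish c'"
    "\<And>y. y \<in> T \<Longrightarrow> deck_action T q (pathstart p') (pi1_map (rose g) F (path_class \<Sigma> (p +++ c +++ reversepath p))) y = h y"
proof -
  have T: "p' 1 \<in> T" "c' 1 \<in> T" using p'(2) c'(2) unfolding path_image_def by auto
  have "q (p' 1) = q (c' 1)"
    using p'(3)[of 1] c'(3)[of 1] c by (simp add: pathfinish_def)
  then obtain h where h: "deck h" "h (p' 1) = c' 1" using deck_exists[OF T] by metis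
  let ?l = "p' +++ c' +++ reversepath (h \<circ> p')"
  have hp: "path (h \<circ> p')" "path_image (h \<circ> p') \<subseteq> T"
    using p' deck_in_T[OF h(1)]
    by (auto intro!: path_continuous_image continuous_on_subset[OF deck_continuous[OF h(1)]] simp: path_image_compose)
  have s1: "pathfinish c' = pathstart (reversepath (h \<circ> p'))" using h(2) by (simp add: pathfinish_def)
  have l: "path ?l" using p' c' hp s1 by (auto intro!: path_join_imp)
  have lT: "path_image ?l \<subseteq> T" using p' c' hp by (intro subset_path_image_join) simp_all
  have ql: "q (?l s) = F ((p +++ c +++ reversepath p) s)" if s: "s \<in> {0..1}" for s
  proof -
    have "q (h (p' a)) = F (p a)" if "a \<in> {0..1}" for a
    proof -
      have "p' a \<in> T" using p'(2) that unfolding path_image_def by blast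
      then show ?thesis using deck_q[OF h(1)] p'(3)[OF that] by simp
    qed
    then show ?thesis using s p'(3) c'(3) by (auto simp: joinpaths_def reversepath_def)
  qed
  have r: "path (p +++ c +++ reversepath p)" using p c by (auto intro!: path_join_imp)
  have r\<Sigma>: "path_image (p +++ c +++ reversepath p) \<subseteq> \<Sigma>"
    using p c by (intro subset_path_image_join) simp_all
  have st: "pathstart ?l = pathstart p'" "pathfinish ?l = h (pathstart p')"
    by (simp_all add: pathstart_def pathfinish_def reversepath_def joinpaths_def)
  have act: "deck_action T q (pathstart p') (pi1_map (rose g) F (path_class \<Sigma> (p +++ c +++ reversepath p))) y = h y"
    if "y \<in> T" for y
    using loop_action[OF F r r\<Sigma> l lT ql h(1) _ that] st by simp
  show ?thesis by (rule that[OF h(1) _ act]) (use h(2) in \<open>simp add: pathfinish_def\<close>)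
qed

subsection \<open>Cells and directions\<close>

text \<open>Over the wedge point the path is constant; over an open circle it meets no vertex, in
  particular not \<open>v\<close>.\<close>

lemma path_stays_in_direction:
  assumes d: "\<delta> \<in> components (T - {v})" "q v = 0" and l: "path l" "path_image l \<subseteq> T" "pathstart l \<in> \<delta>"
    and a: "a \<in> rose_cells g" "\<And>s. s \<in> {0..1} \<Longrightarrow> q (l s) \<in> a"
  shows "pathfinish l \<in> \<delta>"
proof (cases "a = {0}")
  case True
  have "l 0 = l 1"
    by (rule constant_if_q_constant[of "{0..1}" l 0]) (use l(1,2) a(2) True in \<open>auto simp: path_def path_image_def\<close>)
  then show ?thesis using l(3) by (simp add: pathstart_def pathfinish_def)
next
  case False
  then have "0 \<notin> a" using a(1) rose_edge_0 unfolding rose_cells_def by auto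
  then have "v \<notin> path_image l" using a(2) d(2) unfolding path_image_def by fastforce
  then have "path_image l \<subseteq> T - {v}" using l(2) by blast
  then have "path_image l \<subseteq> \<delta>"
    using components_maximal[OF d(1) connected_path_image[OF l(1)]] l(3) pathstart_in_path_image by blast
  then show ?thesis using pathfinish_in_path_image by blast
qed

text \<open>Beyond distance 1 from \<open>x\<close> the set \<open>D\<close> has no point in
  \<open>\<delta>\<close>, so \<open>y\<close> lies in another direction at \<open>x\<close>, and
  \<open>z\<close> is too near to \<open>y\<close> to be outside of it.\<close>

lemma shrunk_direction_far:
  assumes d: "\<delta> \<in> components (T - {x})" and near: "\<And>y. y \<in> D \<Longrightarrow> y \<in> \<delta> \<Longrightarrow> dist x y \<le> 1"
    and y: "y \<in> D" "y \<in> T" "dist x y > 1" and z: "z \<in> T" "dist y z < dist x y"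
  shows "z \<noteq> x" "z \<notin> \<delta>"
proof -
  have "y \<notin> \<delta>" using near y by force
  have "y \<in> T - {x}" using y by auto
  then obtain \<delta>' where d': "\<delta>' \<in> components (T - {x})" "y \<in> \<delta>'" by (metis UnionE Union_components)
  have "z \<in> \<delta>'" by (rule far_in_direction[OF d' z])
  then show "z \<noteq> x" using in_components_subset[OF d'(1)] by blast
  show "z \<notin> \<delta>" using components_eq[OF d d'(1)] \<open>z \<in> \<delta>'\<close> \<open>y \<notin> \<delta>\<close> d'(2) by blast
qed

text \<open>A segment between two points of the set avoids each of the directions separately. The
  fibres of the core have this form.\<close>

lemma convex_avoiding_directions_connected:
  assumes D: "\<And>\<delta>. \<delta> \<in> \<D> \<Longrightarrow> \<delta> \<in> directions T"
  shows "connected (T - \<Union>\<D>)"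
  unfolding connected_iff_connected_component
proof (intro ballI)
  fix a b assume a: "a \<in> T - \<Union>\<D>" and b: "b \<in> T - \<Union>\<D>"
  obtain v where v: "isometric_segment T (dist a b) v" "v 0 = a" "v (dist a b) = b" using segment a b by blast
  let ?C = "v ` {0..dist a b}"
  have "connected ?C" by (intro connected_continuous_image isometric_segment_continuous[OF v(1)]) auto
  moreover have "?C \<subseteq> T - \<Union>\<D>"
  proof (rule image_subsetI)
    fix s assume s: "s \<in> {0..dist a b}"
    have "v s \<notin> \<delta>" if "\<delta> \<in> \<D>" for \<delta>
    proof -
      obtain x where x: "\<delta> \<in> components (T - {x})" using D[OF \<open>\<delta> \<in> \<D>\<close>] unfolding directions_def by blast
      show ?thesis by (rule segment_avoids_direction[OF x v(1) _ _ s]) (use v a b that in auto)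
    qed
    moreover have "v s \<in> T" using v(1) s unfolding isometric_segment_def by blast
    ultimately show "v s \<in> T - \<Union>\<D>" by blast
  qed
  moreover have "a \<in> ?C" using v(2) by (metis atLeastAtMost_iff image_eqI order_refl zero_le_dist)
  moreover have "b \<in> ?C" using v(3) by (metis atLeastAtMost_iff image_eqI order_refl zero_le_dist)
  ultimately show "connected_component (T - \<Union>\<D>) a b" unfolding connected_component_def by blast
qed

lemma trivial_tree: assumes "g = 0" "x \<in> T" "y \<in> T" shows "x = y"
proof -
  have "q z = 0" if "z \<in> T" for z using q_rose[OF that] assms(1) by (simp add: rose_def)
  then have "id x = id y" using constant_if_q_constant[OF connected_T, of id 0 x y] assms by simp
  then show ?thesis by simp
qed

lemma nontrivial_tree: assumes "g \<ge> 1" "x \<in> T" obtains y where "y \<in> T" "y \<noteq> x"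
proof -
  have "rose_midpoint 1 \<in> rose g" using rose_midpoint_in_edge[of 1] rose_diff_0[of g] assms by auto
  moreover have "0 \<in> rose g" by (simp add: rose_def)
  ultimately obtain y z where "y \<in> T" "z \<in> T" "q y = 0" "q z = rose_midpoint 1"
    using covering_space_imp_surjective[OF covering] by (metis imageE)
  moreover have "rose_midpoint 1 \<noteq> 0" by (simp add: rose_midpoint_def)
  ultimately have "y \<in> T" "z \<in> T" "y \<noteq> z" by auto
  then show ?thesis using that by metis
qed

lemma direction_imp_pos: assumes "\<delta> \<in> components (T - {x})" "x \<in> T" shows "g \<ge> 1"
proof -
  obtain u t where "edge u" "0 \<le> t" "t < 1" "x = u t" "\<delta> = {y\<in>T. height u y > t}"
    using assms by (rule direction_superlevel)
  then show ?thesis unfolding edge_def by auto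
qed

end

section \<open>Heavy quadrants\<close>

lemma heavy_far_element:
  assumes "heavy G a1 a2 u1 u2 R"
  obtains \<gamma> where "\<gamma> \<in> carrier G" "(a1 \<gamma> u1, a2 \<gamma> u2) \<in> R" "dist u1 (a1 \<gamma> u1) > K" "dist u2 (a2 \<gamma> u2) > K"
proof -
  obtain \<gamma> where g: "\<forall>n. \<gamma> n \<in> carrier G \<and> (a1 (\<gamma> n) u1, a2 (\<gamma> n) u2) \<in> R"
    "filterlim (\<lambda>n. dist u1 (a1 (\<gamma> n) u1)) at_top sequentially"
    "filterlim (\<lambda>n. dist u2 (a2 (\<gamma> n) u2)) at_top sequentially"
    using assms unfolding heavy_def by blast
  have "eventually (\<lambda>n. dist u1 (a1 (\<gamma> n) u1) > K \<and> dist u2 (a2 (\<gamma> n) u2) > K) sequentially"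
    using g(2,3) unfolding filterlim_at_top_dense by (intro eventually_conj) blast+
  then obtain n where "dist u1 (a1 (\<gamma> n) u1) > K" "dist u2 (a2 (\<gamma> n) u2) > K"
    unfolding eventually_sequentially by blast
  then show ?thesis using that g(1) by blast
qed

lemma filterlim_dist_change_base:
  fixes b c :: "nat \<Rightarrow> 'z::metric_space"
  assumes l: "filterlim (\<lambda>n. dist w (b n)) at_top sequentially" and B: "\<And>n. dist (b n) (c n) \<le> B"
  shows "filterlim (\<lambda>n. dist u (c (n + N))) at_top sequentially"
proof (rule filterlim_at_top_mono)
  have "filterlim (\<lambda>n. dist w (b (n + N))) at_top sequentially"
    using filterlim_compose[OF l filterlim_add_const_nat_at_top[of N]] by simp
  then show "filterlim (\<lambda>n. (- (dist w u + B)) + dist w (b (n + N))) at_top sequentially"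
    by (intro filterlim_tendsto_add_at_top[OF tendsto_const])
  have "- (dist w u + B) + dist w (b (n + N)) \<le> dist u (c (n + N))" for n
    using B[of "n + N"] dist_triangle[of w "b (n + N)" u] dist_triangle[of u "b (n + N)" "c (n + N)"]
      dist_commute[of "b (n + N)" "c (n + N)"] by linarith
  then show "\<forall>\<^sub>F n in sequentially. - (dist w u + B) + dist w (b (n + N)) \<le> dist u (c (n + N))"
    by simp
qed

text \<open>The orbits of the two base points stay at bounded distance. Dropping finitely many
  elements makes all displacements exceed \<open>K\<close>, which leaves room for \<open>R\<close>
  and \<open>R'\<close> to differ by a bounded amount.\<close>

lemma heavy_change_base:
  assumes h: "heavy G a1 a2 w1 w2 R"
    and B: "\<And>\<gamma>. \<gamma> \<in> carrier G \<Longrightarrow> dist (a1 \<gamma> w1) (a1 \<gamma> u1) \<le> B" "\<And>\<gamma>. \<gamma> \<in> carrier G \<Longrightarrow> dist (a2 \<gamma> w2) (a2 \<gamma> u2) \<le> B"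
    and R: "\<And>\<gamma>. \<gamma> \<in> carrier G \<Longrightarrow> (a1 \<gamma> w1, a2 \<gamma> w2) \<in> R \<Longrightarrow> dist w1 (a1 \<gamma> w1) > K \<Longrightarrow> dist w2 (a2 \<gamma> w2) > K \<Longrightarrow>
       (a1 \<gamma> u1, a2 \<gamma> u2) \<in> R'"
  shows "heavy G a1 a2 u1 u2 R'"
proof -
  obtain \<gamma> where g: "\<forall>n. \<gamma> n \<in> carrier G \<and> (a1 (\<gamma> n) w1, a2 (\<gamma> n) w2) \<in> R"
    "filterlim (\<lambda>n. dist w1 (a1 (\<gamma> n) w1)) at_top sequentially"
    "filterlim (\<lambda>n. dist w2 (a2 (\<gamma> n) w2)) at_top sequentially"
    using h unfolding heavy_def by blast
  have "eventually (\<lambda>n. dist w1 (a1 (\<gamma> n) w1) > K \<and> dist w2 (a2 (\<gamma> n) w2) > K) sequentially"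
    using g(2,3) unfolding filterlim_at_top_dense by (intro eventually_conj) blast+
  then obtain N where N: "\<And>n. n \<ge> N \<Longrightarrow> dist w1 (a1 (\<gamma> n) w1) > K \<and> dist w2 (a2 (\<gamma> n) w2) > K"
    unfolding eventually_sequentially by blast
  show ?thesis unfolding heavy_def
  proof (intro exI[of _ "\<lambda>n. \<gamma> (n + N)"] conjI allI)
    show "filterlim (\<lambda>n. dist u1 (a1 (\<gamma> (n + N)) u1)) at_top sequentially" by (rule filterlim_dist_change_base[OF g(2)]) (use B(1) g(1) in blast)
    show "filterlim (\<lambda>n. dist u2 (a2 (\<gamma> (n + N)) u2)) at_top sequentially" by (rule filterlim_dist_change_base[OF g(3)]) (use B(2) g(1) in blast)
    fix n
    show "\<gamma> (n + N) \<in> carrier G" using g(1) by blast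
    show "(a1 (\<gamma> (n + N)) u1, a2 (\<gamma> (n + N)) u2) \<in> R'" using R g(1) N[of "n + N"] by simp
  qed
qed

lemma guirardel_core_fibres_connected:
  assumes "rose_tree g T1 q1" "rose_tree g T2 q2"
  shows "fibres_connected T1 T2 (guirardel_core G T1 a1 T2 a2 u1 u2)"
  unfolding fibres_connected_def
proof (intro conjI ballI)
  interpret T1: rose_tree g T1 q1 by fact
  interpret T2: rose_tree g T2 q2 by fact
  let ?core = "guirardel_core G T1 a1 T2 a2 u1 u2"
  let ?L = "\<lambda>\<delta>1 \<delta>2. \<delta>1 \<in> directions T1 \<and> \<delta>2 \<in> directions T2 \<and> \<not> heavy G a1 a2 u1 u2 (\<delta>1 \<times> \<delta>2)"
  have core: "(x, y) \<in> ?core \<longleftrightarrow> x \<in> T1 \<and> y \<in> T2 \<and> \<not> (\<exists>\<delta>1 \<delta>2. ?L \<delta>1 \<delta>2 \<and> x \<in> \<delta>1 \<and> y \<in> \<delta>2)" for x y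
    unfolding guirardel_core_def quadrants_def by blast
  show "connected (fst -` {t} \<inter> ?core)" if t: "t \<in> T1" for t
  proof -
    \<comment> \<open>The fibre over \<open>t\<close> loses exactly the second factors of the light
      quadrants whose first factor contains \<open>t\<close>.\<close>
    let ?D = "{\<delta>2. \<exists>\<delta>1. ?L \<delta>1 \<delta>2 \<and> t \<in> \<delta>1}"
    have *: "(x, y) \<in> fst -` {t} \<inter> ?core \<longleftrightarrow> (x, y) \<in> {t} \<times> (T2 - \<Union>?D)" for x y
      using core[of x y] t by (simp add: vimage_def) blast
    have "fst -` {t} \<inter> ?core = {t} \<times> (T2 - \<Union>?D)"
    proof (rule Set.set_eqI)
      fix z show "z \<in> fst -` {t} \<inter> ?core \<longleftrightarrow> z \<in> {t} \<times> (T2 - \<Union>?D)" by (cases z) (simp only: *)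
    qed
    moreover have "connected (T2 - \<Union>?D)" by (rule T2.convex_avoiding_directions_connected) blast
    ultimately show ?thesis by (simp add: connected_Times)
  qed
  show "connected (snd -` {t} \<inter> ?core)" if t: "t \<in> T2" for t
  proof -
    let ?D = "{\<delta>1. \<exists>\<delta>2. ?L \<delta>1 \<delta>2 \<and> t \<in> \<delta>2}"
    have *: "(x, y) \<in> snd -` {t} \<inter> ?core \<longleftrightarrow> (x, y) \<in> (T1 - \<Union>?D) \<times> {t}" for x y
      using core[of x y] t by (simp add: vimage_def) blast
    have "snd -` {t} \<inter> ?core = (T1 - \<Union>?D) \<times> {t}"
    proof (rule Set.set_eqI)
      fix z show "z \<in> snd -` {t} \<inter> ?core \<longleftrightarrow> z \<in> (T1 - \<Union>?D) \<times> {t}" by (cases z) (simp only: *)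
    qed
    moreover have "connected (T1 - \<Union>?D)" by (rule T1.convex_avoiding_directions_connected) blast
    ultimately show ?thesis by (simp add: connected_Times)
  qed
qed

section \<open>The core of a combinatorial locally injective map\<close>

lemma rose_cells_path_connected:
  assumes "a \<in> rose_cells g" shows "path_connected a"
proof -
  have "path_connected (rose_edge k)" for k
  proof -
    have "rose_edge k = sphere (of_nat k) (real k) - {0}" by (simp add: rose_edge_def)
    moreover have "path_connected (sphere (of_nat k :: complex) (real k) - {0})"
    proof (cases "k = 0")
      case False
      \<comment> \<open>The wedge point is the point of the circle at angle \<open>\<pi>\<close>, so
        the open interval of angles omits just this point.\<close>
      have "sphere (of_nat k) (real k) - {0::complex} = (\<lambda>t. of_nat k + of_nat k * cis t) ` {-pi<..<pi}"
      proof (intro equalityI subsetI)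
        fix z assume z: "z \<in> sphere (of_nat k) (real k) - {0::complex}"
        define w where "w = (z - of_nat k) / of_nat k"
        have "norm w = 1" using z False by (simp add: w_def norm_divide dist_norm norm_minus_commute)
        then have w: "w = cis (Arg w)" by (metis cis_Arg norm_zero sgn_div_norm scaleR_one inverse_1 zero_neq_one)
        have zw: "z = of_nat k + of_nat k * w" using False by (simp add: w_def)
        have "Arg w \<noteq> pi"
        proof
          assume "Arg w = pi"
          then have "w = -1" using w by simp
          then show False using zw z by simp
        qed
        then have "Arg w \<in> {-pi<..<pi}" using Arg_bounded[of w] by auto
        then show "z \<in> (\<lambda>t. of_nat k + of_nat k * cis t) ` {-pi<..<pi}" using zw w by (intro image_eqI[of _ _ "Arg w"]) auto
      next
        fix z assume "z \<in> (\<lambda>t. of_nat k + of_nat k * cis t) ` {-pi<..<pi}"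
        then obtain t where t: "-pi < t" "t < pi" "z = of_nat k + of_nat k * cis t" by auto
        have "norm (of_nat k * cis t) = real k" by (simp add: norm_mult)
        then have "z \<in> sphere (of_nat k) (real k)" using t(3) by (simp add: dist_norm)
        moreover have "z \<noteq> 0"
        proof
          assume "z = 0"
          then have "of_nat k * (1 + cis t) = 0" using t(3) by (simp add: algebra_simps)
          then have "cis t = -1" using False by (simp add: add_eq_0_iff)
          then have "cos t = -1" by (metis cis.simps(1) uminus_complex.simps(1) one_complex.simps(1))
          then have "cos \<bar>t\<bar> = cos pi" by simp
          have "\<bar>t\<bar> = pi" by (rule cos_inj_pi[OF _ _ _ _ \<open>cos \<bar>t\<bar> = cos pi\<close>]) (use t in auto)
          then show False using t by auto
        qed
        ultimately show "z \<in> sphere (of_nat k) (real k) - {0}" by simp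
      qed
      moreover have "path_connected ((\<lambda>t. of_nat k + of_nat k * cis t :: complex) ` {-pi<..<pi})"
        by (intro path_connected_continuous_image continuous_intros convex_imp_path_connected) simp
      ultimately show ?thesis by simp
    qed simp
    ultimately show ?thesis by simp
  qed
  then show ?thesis using assms unfolding rose_cells_def by auto
qed

text \<open>\<open>a\<close> and \<open>b\<close> stand for the two projections in either order:
  where one coordinate of \<open>f\<close> is constant along a curve, the other is as injective as
  \<open>f\<close>.\<close>

lemma locally_injective_coordinate:
  fixes C :: "real \<Rightarrow> 'a"
  assumes "\<exists>e>0. inj_on (f \<circ> C) (ball t e)" and "\<And>s. a (f (C s)) = m"
    and "\<And>z z'. a z = a z' \<Longrightarrow> b z = b z' \<Longrightarrow> z = z'"
  shows "\<exists>e>0. inj_on ((b \<circ> f) \<circ> C) (ball t e)"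
proof -
  obtain e where "e > 0" "inj_on (f \<circ> C) (ball t e)" using assms(1) by blast
  moreover have "f (C x) = f (C y)" if "b (f (C x)) = b (f (C y))" for x y
    using assms(2)[of x] assms(2)[of y] by (intro assms(3) that) simp
  ultimately show ?thesis by (intro exI[of _ e]) (auto simp: inj_on_def)
qed

section \<open>The lifted map, the group action and the diagram curves\<close>

locale combinatorial_lift =
  T1: rose_tree g T1 q1 + T2: rose_tree g T2 q2
  for g and T1 :: "'a::metric_space set" and q1 and T2 :: "'b::metric_space set" and q2 +
  fixes \<Sigma> :: "'m::t2_space set" and f V E Q and S :: "'s::topological_space set" and \<pi> s0 fhat
  assumes f: "continuous_on \<Sigma> f" "f ` \<Sigma> \<subseteq> rose g \<times> rose g"
    and locally_inj: "locally_injective \<Sigma> f"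
    and diagram: "has_heegaard_diagram g \<Sigma> f"
    and complex: "square_complex \<Sigma> V E Q"
    and combinatorial: "combinatorial_to_rose_product g f V E Q"
    and cover_S: "covering_space S \<pi> \<Sigma>" and conn_S: "connected S" and s0: "s0 \<in> S"
    and cont_fhat: "continuous_on S fhat" and fhat_T: "fhat ` S \<subseteq> T1 \<times> T2"
    and lift: "\<And>s. s \<in> S \<Longrightarrow> map_prod q1 q2 (fhat s) = f (\<pi> s)"
begin

abbreviation "act1 \<equiv> \<lambda>\<alpha>. deck_action T1 q1 (fst (fhat s0)) (pi1_map (rose g) (fst \<circ> f) \<alpha>)"
abbreviation "act2 \<equiv> \<lambda>\<alpha>. deck_action T2 q2 (snd (fhat s0)) (pi1_map (rose g) (snd \<circ> f) \<alpha>)"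
abbreviation "\<Gamma> \<equiv> pi1 \<Sigma> (\<pi> s0)"

lemma pi_\<Sigma>: "s \<in> S \<Longrightarrow> \<pi> s \<in> \<Sigma>"
  using covering_space_imp_surjective[OF cover_S] by blast

lemma fhat_in: "s \<in> S \<Longrightarrow> fst (fhat s) \<in> T1" "s \<in> S \<Longrightarrow> snd (fhat s) \<in> T2"
  using fhat_T by force+

lemma q_fhat: "s \<in> S \<Longrightarrow> q1 (fst (fhat s)) = fst (f (\<pi> s))" "s \<in> S \<Longrightarrow> q2 (snd (fhat s)) = snd (f (\<pi> s))"
  using lift by (metis fst_map_prod) (metis lift snd_map_prod)

lemma f1: "continuous_on \<Sigma> (fst \<circ> f)" "(fst \<circ> f) ` \<Sigma> \<subseteq> rose g"
  and f2: "continuous_on \<Sigma> (snd \<circ> f)" "(snd \<circ> f) ` \<Sigma> \<subseteq> rose g"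
  using f by (auto intro!: continuous_on_fst continuous_on_snd simp: o_def image_subset_iff mem_Times_iff)

lemma fhat1: "continuous_on S (fst \<circ> fhat)" and fhat2: "continuous_on S (snd \<circ> fhat)"
  using cont_fhat by (auto intro!: continuous_on_fst continuous_on_snd simp: o_def)

lemma path_lift:
  assumes r: "path r" "path_image r \<subseteq> \<Sigma>" and s: "s \<in> S" "\<pi> s = pathstart r"
  obtains r' where "path r'" "path_image r' \<subseteq> S" "pathstart r' = s" "\<And>t. t \<in> {0..1} \<Longrightarrow> \<pi> (r' t) = r t"
    "\<And>t. t \<in> {0..1} \<Longrightarrow> r' t \<in> S"
proof -
  obtain r' where r': "path r'" "path_image r' \<subseteq> S" "pathstart r' = s" "\<And>t. t \<in> {0..1} \<Longrightarrow> \<pi> (r' t) = r t"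
    using covering_space_path_lift[OF cover_S r s] by metis
  moreover have "r' t \<in> S" if "t \<in> {0..1}" for t using r'(2) that unfolding path_image_def by blast
  ultimately show ?thesis using that by blast
qed

lemma lifted_path:
  assumes r: "path r" "path_image r \<subseteq> S"
  shows "path (fst \<circ> fhat \<circ> r)" "path_image (fst \<circ> fhat \<circ> r) \<subseteq> T1"
    "path (snd \<circ> fhat \<circ> r)" "path_image (snd \<circ> fhat \<circ> r) \<subseteq> T2"
    "path (\<pi> \<circ> r)" "path_image (\<pi> \<circ> r) \<subseteq> \<Sigma>"
  using r fhat_in pi_\<Sigma> continuous_on_subset[OF fhat1 r(2)] continuous_on_subset[OF fhat2 r(2)]
    continuous_on_subset[OF covering_space_imp_continuous[OF cover_S] r(2)]
  by (auto intro!: path_continuous_image simp: path_image_compose)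

text \<open>Both deck transformations are read off from the lift of one loop to \<open>S\<close>,
  which ends at \<open>s\<close>. So the orbit of \<open>fhat s0\<close> lies in the image of
  \<open>fhat\<close>, and minimality rests on this.\<close>

lemma action:
  assumes "\<alpha> \<in> carrier \<Gamma>"
  obtains h1 h2 s where "T1.deck h1" "T2.deck h2" "\<And>y. y \<in> T1 \<Longrightarrow> act1 \<alpha> y = h1 y" "\<And>y. y \<in> T2 \<Longrightarrow> act2 \<alpha> y = h2 y"
    "s \<in> S" "h1 (fst (fhat s0)) = fst (fhat s)" "h2 (snd (fhat s0)) = snd (fhat s)"
proof -
  obtain r where r: "path r" "path_image r \<subseteq> \<Sigma>" "pathstart r = \<pi> s0" "pathfinish r = \<pi> s0" and \<alpha>: "\<alpha> = path_class \<Sigma> r"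
    using assms unfolding pi1_def loops_at_def by auto
  obtain r' where r': "path r'" "path_image r' \<subseteq> S" "pathstart r' = s0" "\<And>t. t \<in> {0..1} \<Longrightarrow> \<pi> (r' t) = r t"
    "\<And>t. t \<in> {0..1} \<Longrightarrow> r' t \<in> S"
    using path_lift[OF r(1,2) s0 r(3)[symmetric]] by metis
  have end_S: "r' 1 \<in> S" and "\<pi> (r' 1) = \<pi> s0" using r'(4)[of 1] r'(5)[of 1] r(4) by (auto simp: pathfinish_def)
  then have q: "q1 (fst (fhat s0)) = q1 (fst (fhat (r' 1)))" "q2 (snd (fhat s0)) = q2 (snd (fhat (r' 1)))"
    using q_fhat s0 by simp_all
  obtain h1 where h1: "T1.deck h1" "h1 (fst (fhat s0)) = fst (fhat (r' 1))"
    using T1.deck_exists[OF _ _ q(1)] fhat_in s0 end_S by metis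
  obtain h2 where h2: "T2.deck h2" "h2 (snd (fhat s0)) = snd (fhat (r' 1))"
    using T2.deck_exists[OF _ _ q(2)] fhat_in s0 end_S by metis
  note l = lifted_path[OF r'(1,2)]
  have st: "pathstart (fst \<circ> fhat \<circ> r') = fst (fhat s0)" "pathfinish (fst \<circ> fhat \<circ> r') = fst (fhat (r' 1))"
    "pathstart (snd \<circ> fhat \<circ> r') = snd (fhat s0)" "pathfinish (snd \<circ> fhat \<circ> r') = snd (fhat (r' 1))"
    using r'(3) by (auto simp: pathstart_def pathfinish_def)
  have a1: "act1 \<alpha> y = h1 y" if "y \<in> T1" for y
    using T1.loop_action[OF f1 r(1,2) l(1,2) _ h1(1) _ that] st h1(2) q_fhat r'(4,5) by (simp add: \<alpha>)
  have a2: "act2 \<alpha> y = h2 y" if "y \<in> T2" for y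
    using T2.loop_action[OF f2 r(1,2) l(3,4) _ h2(1) _ that] st h2(2) q_fhat r'(4,5) by (simp add: \<alpha>)
  show ?thesis by (rule that[OF h1(1) h2(1) a1 a2 end_S h1(2) h2(2)])
qed

lemma path_connected_S: "path_connected S"
  by (rule covering_space_path_connected[OF cover_S conn_S square_complex_locally_path_connected[OF complex]])

lemma diagram_curve:
  assumes c: "\<gamma> \<in> diagram_curves g \<Sigma> f" and x: "x \<in> \<gamma>"
  obtains C :: "real \<Rightarrow> 'm" where "continuous_on UNIV C" "range C \<subseteq> \<gamma>" "range C \<subseteq> \<Sigma>" "C 0 = x" "\<And>t. C (t + 1) = C t"
    "\<And>s t. \<bar>s - t\<bar> < 1 \<Longrightarrow> C s = C t \<Longrightarrow> s = t" "\<And>t. \<exists>e>0. inj_on (f \<circ> C) (ball t e)"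
proof -
  obtain C :: "real \<Rightarrow> 'm" where C: "continuous_on UNIV C" "range C \<subseteq> \<gamma>" "C 0 = x" "\<And>t. C (t + 1) = C t"
    "\<And>s t. \<bar>s - t\<bar> < 1 \<Longrightarrow> C s = C t \<Longrightarrow> s = t"
    using simple_closed_curve_periodic[OF _ x] diagram c unfolding has_heegaard_diagram_def by metis
  have "\<gamma> \<subseteq> \<Sigma>" using c unfolding diagram_curves_def midpoint_preimages_def by auto
  then have C\<Sigma>: "range C \<subseteq> \<Sigma>" using C(2) by blast
  have "\<exists>e>0. inj_on (f \<circ> C) (ball t e)" for t
  proof -
    have "C t \<in> \<Sigma>" using C\<Sigma> by blast
    then obtain U where U: "openin (top_of_set \<Sigma>) U" "C t \<in> U" "inj_on f U"
      using locally_inj unfolding locally_injective_def by blast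
    have "openin (top_of_set UNIV) (UNIV \<inter> C -` U)"
      by (rule continuous_openin_preimage[OF C(1) _ U(1)]) (use C\<Sigma> in auto)
    moreover have "t \<in> UNIV \<inter> C -` U" using U(2) by simp
    ultimately obtain e where e: "e > 0" "UNIV \<inter> ball t e \<subseteq> UNIV \<inter> C -` U" by (rule openin_ballE)
    \<comment> \<open>The radius 1/2 keeps two times less than one period apart, where
      \<open>C\<close> is injective.\<close>
    have "inj_on (f \<circ> C) (ball t (min e (1/2)))"
    proof (rule inj_onI)
      fix a b assume ab: "a \<in> ball t (min e (1/2))" "b \<in> ball t (min e (1/2))" "(f \<circ> C) a = (f \<circ> C) b"
      then have "C a \<in> U" "C b \<in> U" using e(2) by auto
      then have "C a = C b" using inj_onD[OF U(3)] ab(3) by auto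
      moreover have "\<bar>t - a\<bar> < 1/2" "\<bar>t - b\<bar> < 1/2" using ab(1,2) by (auto simp: dist_real_def)
      then have "\<bar>a - b\<bar> < 1" by linarith
      ultimately show "a = b" using C(5) by blast
    qed
    then show ?thesis using e(1) by (intro exI[of _ "min e (1/2)"]) simp
  qed
  then show ?thesis using that C C\<Sigma> by blast
qed

lemma diagram_curve1:
  assumes x: "x \<in> \<Sigma>" "k \<in> {1..g}" "fst (f x) = rose_midpoint k"
  obtains C :: "real \<Rightarrow> 'm" where "continuous_on UNIV C" "range C \<subseteq> \<Sigma>" "C 0 = x" "\<forall>t. C (t + 1) = C t"
    "\<forall>t. fst (f (C t)) = rose_midpoint k" "\<forall>t. \<exists>e>0. inj_on (f \<circ> C) (ball t e)"
    "\<forall>t. \<exists>e>0. inj_on ((snd \<circ> f) \<circ> C) (ball t e)"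
proof -
  let ?\<gamma> = "{x\<in>\<Sigma>. (fst \<circ> f) x = rose_midpoint k}"
  have "?\<gamma> \<in> diagram_curves g \<Sigma> f" "x \<in> ?\<gamma>" using x unfolding diagram_curves_def midpoint_preimages_def by auto
  then obtain C :: "real \<Rightarrow> 'm" where C: "continuous_on UNIV C" "range C \<subseteq> ?\<gamma>" "range C \<subseteq> \<Sigma>" "C 0 = x" "\<And>t. C (t + 1) = C t"
    "\<And>t. \<exists>e>0. inj_on (f \<circ> C) (ball t e)"
    by (rule diagram_curve) blast
  have m: "fst (f (C t)) = rose_midpoint k" for t using C(2) by auto
  have "\<exists>e>0. inj_on ((snd \<circ> f) \<circ> C) (ball t e)" for t
    by (rule locally_injective_coordinate[OF C(6), of fst "rose_midpoint k"]) (use m in \<open>auto simp: prod_eq_iff\<close>)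
  then show ?thesis using that C m by blast
qed

lemma diagram_curve2:
  assumes x: "x \<in> \<Sigma>" "k \<in> {1..g}" "snd (f x) = rose_midpoint k"
  obtains C :: "real \<Rightarrow> 'm" where "continuous_on UNIV C" "range C \<subseteq> \<Sigma>" "C 0 = x" "\<forall>t. C (t + 1) = C t"
    "\<forall>t. snd (f (C t)) = rose_midpoint k" "\<forall>t. \<exists>e>0. inj_on (f \<circ> C) (ball t e)"
    "\<forall>t. \<exists>e>0. inj_on ((fst \<circ> f) \<circ> C) (ball t e)"
proof -
  let ?\<gamma> = "{x\<in>\<Sigma>. (snd \<circ> f) x = rose_midpoint k}"
  have "?\<gamma> \<in> diagram_curves g \<Sigma> f" "x \<in> ?\<gamma>" using x unfolding diagram_curves_def midpoint_preimages_def by auto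
  then obtain C :: "real \<Rightarrow> 'm" where C: "continuous_on UNIV C" "range C \<subseteq> ?\<gamma>" "range C \<subseteq> \<Sigma>" "C 0 = x" "\<And>t. C (t + 1) = C t"
    "\<And>t. \<exists>e>0. inj_on (f \<circ> C) (ball t e)"
    by (rule diagram_curve) blast
  have m: "snd (f (C t)) = rose_midpoint k" for t using C(2) by auto
  have "\<exists>e>0. inj_on ((fst \<circ> f) \<circ> C) (ball t e)" for t
    by (rule locally_injective_coordinate[OF C(6), of snd "rose_midpoint k"]) (use m in \<open>auto simp: prod_eq_iff\<close>)
  then show ?thesis using that C m by blast
qed

end

section \<open>Quadrants that meet the image are heavy\<close>

lemma periodic_of_int:
  fixes C :: "real \<Rightarrow> 'a"
  assumes per: "\<And>t. C (t + 1) = C t" shows "C (of_int n) = C 0"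
proof (induction n rule: int_induct[of _ 0])
  case (step1 i)
  then show ?case using per[of "of_int i"] by simp
next
  case (step2 i)
  then show ?case using per[of "of_int (i - 1)"] by simp
qed simp

lemma path_scaled:
  assumes "continuous_on UNIV A" shows "path (\<lambda>t. A (a * t))"
  unfolding path_def by (intro continuous_on_compose2[OF assms] continuous_intros) auto

lemma dist_far_move:
  fixes w v x z z' :: "'a::metric_space"
  assumes "dist w z > B + 1 + dist w v + dist w x" "dist z z' \<le> B"
  shows "B < dist v z" "1 < dist x z'"
proof -
  have "dist w z \<le> dist w v + dist v z" by (rule dist_triangle)
  moreover have "dist w z \<le> dist w x + dist x z' + dist z z'"
    using dist_triangle[of w z x] dist_triangle[of x z z'] dist_commute[of z z'] by linarith
  moreover note zero_le_dist[of w v] zero_le_dist[of w x]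
  ultimately show "B < dist v z" "1 < dist x z'" using assms by linarith+
qed

context combinatorial_lift
begin

text \<open>
  At the centre of a square the two diagram curves give elements that translate one of the two trees
  along a line and act trivially on the other, so the two coordinates can be moved independently.
\<close>
lemma centre_heavy:
  assumes s: "s \<in> S" and k: "k1 \<in> {1..g}" "k2 \<in> {1..g}" "f (\<pi> s) = (rose_midpoint k1, rose_midpoint k2)"
    and d1: "\<delta>1 \<in> components (T1 - {x1})" "fst (fhat s) \<in> \<delta>1"
    and d2: "\<delta>2 \<in> components (T2 - {x2})" "snd (fhat s) \<in> \<delta>2"
  shows "heavy \<Gamma> act1 act2 (fst (fhat s)) (snd (fhat s)) (\<delta>1 \<times> \<delta>2)"
proof -
  let ?w1 = "fst (fhat s)" and ?w2 = "snd (fhat s)"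
  have w: "?w1 \<in> T1" "?w2 \<in> T2" "q1 ?w1 = rose_midpoint k1" "q2 ?w2 = rose_midpoint k2"
    using fhat_in q_fhat s k(3) by simp_all
  have fk: "fst (f (\<pi> s)) = rose_midpoint k1" "snd (f (\<pi> s)) = rose_midpoint k2" using k(3) by simp_all
  obtain C :: "real \<Rightarrow> 'm" where C': "continuous_on UNIV C" "range C \<subseteq> \<Sigma>" "C 0 = \<pi> s" "\<forall>t. C (t + 1) = C t"
    "\<forall>t. fst (f (C t)) = rose_midpoint k1" "\<forall>t. \<exists>e>0. inj_on (f \<circ> C) (ball t e)"
    "\<forall>t. \<exists>e>0. inj_on ((snd \<circ> f) \<circ> C) (ball t e)"
    by (rule diagram_curve1[OF pi_\<Sigma>[OF s] k(1) fk(1)])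
  note C = C'[rule_format]
  obtain D :: "real \<Rightarrow> 'm" where D': "continuous_on UNIV D" "range D \<subseteq> \<Sigma>" "D 0 = \<pi> s" "\<forall>t. D (t + 1) = D t"
    "\<forall>t. snd (f (D t)) = rose_midpoint k2" "\<forall>t. \<exists>e>0. inj_on (f \<circ> D) (ball t e)"
    "\<forall>t. \<exists>e>0. inj_on ((fst \<circ> f) \<circ> D) (ball t e)"
    by (rule diagram_curve2[OF pi_\<Sigma>[OF s] k(2) fk(2)])
  note D = D'[rule_format]
  have q0: "q1 ?w1 = (fst \<circ> f) (D 0)" "q2 ?w2 = (snd \<circ> f) (C 0)" using w D(3) C(3) fk by simp_all
  obtain l1 where l1: "T1.line l1" "l1 0 = ?w1" "\<And>t. q1 (l1 t) = (fst \<circ> f) (D t)"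
    by (rule T1.lift_curve_line[OF D(1,2,4) f1 D(7) w(1) q0(1)]) (rule that)
  obtain l2 where l2: "T2.line l2" "l2 0 = ?w2" "\<And>t. q2 (l2 t) = (snd \<circ> f) (C t)"
    by (rule T2.lift_curve_line[OF C(1,2,4) f2 C(7) w(2) q0(2)]) (rule that)
  obtain \<epsilon>1 where e1: "\<epsilon>1 \<in> {1, -1::real}" "\<And>n::nat. l1 (\<epsilon>1 * real n) \<in> \<delta>1"
    "filterlim (\<lambda>n. dist (l1 0) (l1 (\<epsilon>1 * real n))) at_top sequentially"
    by (rule T1.line_ray_in_direction[OF l1(1) d1(1)]) (use d1(2) l1(2) in auto)
  obtain \<epsilon>2 where e2: "\<epsilon>2 \<in> {1, -1::real}" "\<And>n::nat. l2 (\<epsilon>2 * real n) \<in> \<delta>2"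
    "filterlim (\<lambda>n. dist (l2 0) (l2 (\<epsilon>2 * real n))) at_top sequentially"
    by (rule T2.line_ray_in_direction[OF l2(1) d2(1)]) (use d2(2) l2(2) in auto)
  obtain p where p: "path p" "path_image p \<subseteq> S" "pathstart p = s0" "pathfinish p = s"
    using path_connected_S s0 s unfolding path_connected_def by blast
  note lp = lifted_path[OF p(1,2)]
  have pS: "p t \<in> S" if "t \<in> {0..1}" for t using p(2) that unfolding path_image_def by blast
  have sub1: "path (\<lambda>t. l1 (a * t))" "path_image (\<lambda>t. l1 (a * t)) \<subseteq> T1"
    and sub2: "path (\<lambda>t. l2 (a * t))" "path_image (\<lambda>t. l2 (a * t)) \<subseteq> T2"
    and subC: "path (\<lambda>t. C (a * t))" "path_image (\<lambda>t. C (a * t)) \<subseteq> \<Sigma>"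
    and subD: "path (\<lambda>t. D (a * t))" "path_image (\<lambda>t. D (a * t)) \<subseteq> \<Sigma>" for a
    using l1(1) l2(1) C(1,2) D(1,2) unfolding T1.line_def T2.line_def
    by (auto intro!: path_scaled simp: path_image_def image_subset_iff)
  have "\<exists>\<alpha>\<in>carrier \<Gamma>. act1 \<alpha> ?w1 = l1 (\<epsilon>1 * real n) \<and> act2 \<alpha> ?w2 = l2 (\<epsilon>2 * real n)" for n
  proof -
    let ?a = "\<epsilon>1 * real n" and ?b = "\<epsilon>2 * real n"
    \<comment> \<open>At integer times the curves are back at \<open>\<pi> s\<close>, so that
      \<open>?r\<close> closes up.\<close>
    obtain i j :: int where ij: "?a = of_int i" "?b = of_int j"
      using e1(1) e2(1) by (metis empty_iff insert_iff mult_1 mult_minus1 of_int_minus of_int_of_nat_eq)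
    have per: "D ?a = \<pi> s" "C ?b = \<pi> s"
      using periodic_of_int[of D i] periodic_of_int[of C j] C(3,4) D(3,4) ij by metis+
    \<comment> \<open>The loop follows \<open>C\<close>, along which the first coordinate is
      constant, and then \<open>D\<close>, along which the second is.\<close>
    let ?c = "(\<lambda>t. C (?b * t)) +++ (\<lambda>t. D (?a * t))"
    let ?r = "(\<pi> \<circ> p) +++ ?c +++ reversepath (\<pi> \<circ> p)"
    have pf: "pathstart (\<pi> \<circ> p) = \<pi> s0" "pathfinish (\<pi> \<circ> p) = \<pi> s"
      using p(3,4) by (simp_all add: pathstart_compose pathfinish_compose)
    have cs: "pathstart ?c = pathfinish (\<pi> \<circ> p)" "pathfinish ?c = pathfinish (\<pi> \<circ> p)"
      using per C(3) pf by (simp_all add: pathstart_def pathfinish_def joinpaths_def)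
    have mid: "pathfinish (\<lambda>t. C (?b * t)) = pathstart (\<lambda>t. D (?a * t))"
      using per D(3) by (simp add: pathstart_def pathfinish_def)
    have c: "path ?c" by (rule path_join_imp[OF subC(1) subD(1) mid])
    have c\<Sigma>: "path_image ?c \<subseteq> \<Sigma>" by (rule subset_path_image_join[OF subC(2) subD(2)])
    have r: "path ?r" using lp(5) subC(1) subD(1) mid cs by (intro path_join_imp) auto
    have r\<Sigma>: "path_image ?r \<subseteq> \<Sigma>" using lp(6) c\<Sigma> by (intro subset_path_image_join[OF lp(6)] subset_path_image_join[OF c\<Sigma>]) simp
    have "?r \<in> loops_at \<Sigma> (\<pi> s0)"
      unfolding loops_at_def
    proof (intro CollectI conjI r r\<Sigma>)
      show "pathstart ?r = \<pi> s0" "pathfinish ?r = \<pi> s0" using pf(1) by simp_all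
    qed
    then have \<alpha>: "path_class \<Sigma> ?r \<in> carrier \<Gamma>" unfolding pi1_def by simp
    \<comment> \<open>In \<open>T1\<close> the lift rests during \<open>C\<close> and follows
      \<open>l1\<close> during \<open>D\<close>. In \<open>T2\<close> it follows \<open>l2\<close>
      during \<open>C\<close> and then rests at the point reached.\<close>
    let ?c1 = "(\<lambda>_. ?w1) +++ (\<lambda>t. l1 (?a * t))"
    have c1: "path ?c1"
      by (rule path_join_imp[OF _ sub1(1)]) (simp_all add: path_def pathstart_def pathfinish_def l1(2))
    have c1T: "path_image ?c1 \<subseteq> T1"
      by (rule subset_path_image_join[OF _ sub1(2)]) (use w(1) in \<open>auto simp: path_image_def\<close>)
    have c1q: "q1 (?c1 t) = (fst \<circ> f) (?c t)" for t
      using C(5) l1(3) w(3) by (simp add: joinpaths_def)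
    have c1s: "pathstart ?c1 = pathfinish (fst \<circ> fhat \<circ> p)"
      using p(4) by (simp add: pathfinish_compose) (simp add: pathstart_def)
    have p1q: "q1 ((fst \<circ> fhat \<circ> p) t) = (fst \<circ> f) ((\<pi> \<circ> p) t)" if "t \<in> {0..1}" for t
      using q_fhat(1)[OF pS[OF that]] by simp
    obtain h1 where "T1.deck h1" and h1: "h1 (pathfinish (fst \<circ> fhat \<circ> p)) = pathfinish ?c1"
      "\<And>y. y \<in> T1 \<Longrightarrow> deck_action T1 q1 (pathstart (fst \<circ> fhat \<circ> p)) (pi1_map (rose g) (fst \<circ> f) (path_class \<Sigma> ?r)) y = h1 y"
      by (rule T1.conjugate_loop_action[OF f1 lp(5,6) c c\<Sigma> cs lp(1,2) p1q c1 c1T c1q c1s], assumption) (rule that)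
    have a1: "act1 (path_class \<Sigma> ?r) ?w1 = l1 ?a"
      using h1(1) h1(2)[OF w(1)] p(3,4) by (simp add: pathstart_compose pathfinish_compose) (simp add: pathfinish_def)
    let ?c2 = "(\<lambda>t. l2 (?b * t)) +++ (\<lambda>_. l2 ?b)"
    have l2T: "l2 ?b \<in> T2" using l2(1) unfolding T2.line_def by blast
    have c2: "path ?c2"
      by (rule path_join_imp[OF sub2(1)]) (simp_all add: path_def pathstart_def pathfinish_def)
    have c2T: "path_image ?c2 \<subseteq> T2"
      by (rule subset_path_image_join[OF sub2(2)]) (use l2T in \<open>auto simp: path_image_def\<close>)
    have c2q: "q2 (?c2 t) = (snd \<circ> f) (?c t)" for t
      using D(5) l2(3) per(2) fk(2) by (simp add: joinpaths_def)
    have c2s: "pathstart ?c2 = pathfinish (snd \<circ> fhat \<circ> p)"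
      using p(4) l2(2) by (simp add: pathfinish_compose) (simp add: pathstart_def)
    have p2q: "q2 ((snd \<circ> fhat \<circ> p) t) = (snd \<circ> f) ((\<pi> \<circ> p) t)" if "t \<in> {0..1}" for t
      using q_fhat(2)[OF pS[OF that]] by simp
    obtain h2 where "T2.deck h2" and h2: "h2 (pathfinish (snd \<circ> fhat \<circ> p)) = pathfinish ?c2"
      "\<And>y. y \<in> T2 \<Longrightarrow> deck_action T2 q2 (pathstart (snd \<circ> fhat \<circ> p)) (pi1_map (rose g) (snd \<circ> f) (path_class \<Sigma> ?r)) y = h2 y"
      by (rule T2.conjugate_loop_action[OF f2 lp(5,6) c c\<Sigma> cs lp(3,4) p2q c2 c2T c2q c2s], assumption) (rule that)
    have a2: "act2 (path_class \<Sigma> ?r) ?w2 = l2 ?b"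
      using h2(1) h2(2)[OF w(2)] p(3,4) by (simp add: pathstart_compose pathfinish_compose) (simp add: pathfinish_def)
    show ?thesis using \<alpha> a1 a2 by blast
  qed
  then obtain \<gamma> where g: "\<And>n. \<gamma> n \<in> carrier \<Gamma>" "\<And>n. act1 (\<gamma> n) ?w1 = l1 (\<epsilon>1 * real n)"
    "\<And>n. act2 (\<gamma> n) ?w2 = l2 (\<epsilon>2 * real n)" by metis
  show ?thesis unfolding heavy_def
    by (intro exI[of _ \<gamma>]) (use g e1 e2 l1(2) l2(2) in simp)
qed

text \<open>\<open>f\<close> identifies the cell with a product of cells of the rose, so the cell is
  path connected. In each tree the lifted path lies over a single cell of the rose and cannot leave
  a direction based at a vertex.\<close>

lemma move_within_cell:
  assumes c: "c \<in> open_cells V E Q" and s: "s \<in> S" "\<pi> s \<in> c" and y: "y \<in> c"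
    and d1: "\<delta>1 \<in> components (T1 - {v1})" "q1 v1 = 0" "fst (fhat s) \<in> \<delta>1"
    and d2: "\<delta>2 \<in> components (T2 - {v2})" "q2 v2 = 0" "snd (fhat s) \<in> \<delta>2"
  obtains s' where "s' \<in> S" "\<pi> s' = y" "fst (fhat s') \<in> \<delta>1" "snd (fhat s') \<in> \<delta>2"
proof -
  obtain a b h where ab: "a \<in> rose_cells g" "b \<in> rose_cells g" and h: "homeomorphism c (a \<times> b) f h"
    using combinatorial c unfolding combinatorial_to_rose_product_def by blast
  have "path_connected (a \<times> b)" using ab by (intro path_connected_Times rose_cells_path_connected)
  then have "path_connected (h ` (a \<times> b))"
    by (intro path_connected_continuous_image homeomorphism_cont2[OF h])
  then have "path_connected c" using homeomorphism_image2[OF h] by simp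
  then obtain r where r: "path r" "path_image r \<subseteq> c" "pathstart r = \<pi> s" "pathfinish r = y"
    using s(2) y unfolding path_connected_def by blast
  have "c \<subseteq> \<Sigma>" using c complex unfolding square_complex_def by blast
  then have r\<Sigma>: "path_image r \<subseteq> \<Sigma>" using r(2) by blast
  obtain r' where r': "path r'" "path_image r' \<subseteq> S" "pathstart r' = s" "\<And>t. t \<in> {0..1} \<Longrightarrow> \<pi> (r' t) = r t"
    "\<And>t. t \<in> {0..1} \<Longrightarrow> r' t \<in> S"
    using path_lift[OF r(1) r\<Sigma> s(1) r(3)[symmetric]] by metis
  note l = lifted_path[OF r'(1,2)]
  have fr: "f (r t) \<in> a \<times> b" if "t \<in> {0..1}" for t
  proof -
    have "r t \<in> c" using r(2) that unfolding path_image_def by blast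
    then show ?thesis using homeomorphism_image1[OF h] by blast
  qed
  have "pathfinish (fst \<circ> fhat \<circ> r') \<in> \<delta>1"
  proof (rule T1.path_stays_in_direction[OF d1(1,2) l(1,2) _ ab(1)])
    show "pathstart (fst \<circ> fhat \<circ> r') \<in> \<delta>1" using d1(3) r'(3) by (simp add: pathstart_compose)
    show "q1 ((fst \<circ> fhat \<circ> r') t) \<in> a" if "t \<in> {0..1}" for t
      using q_fhat(1)[OF r'(5)[OF that]] fr[OF that] r'(4)[OF that] by (simp add: mem_Times_iff)
  qed
  moreover have "pathfinish (snd \<circ> fhat \<circ> r') \<in> \<delta>2"
  proof (rule T2.path_stays_in_direction[OF d2(1,2) l(3,4) _ ab(2)])
    show "pathstart (snd \<circ> fhat \<circ> r') \<in> \<delta>2" using d2(3) r'(3) by (simp add: pathstart_compose)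
    show "q2 ((snd \<circ> fhat \<circ> r') t) \<in> b" if "t \<in> {0..1}" for t
      using q_fhat(2)[OF r'(5)[OF that]] fr[OF that] r'(4)[OF that] by (simp add: mem_Times_iff)
  qed
  moreover have "\<pi> (r' 1) = y" using r'(4)[of 1] r(4) by (simp add: pathfinish_def)
  ultimately show ?thesis using that[of "r' 1"] r'(5)[of 1] by (simp add: pathfinish_def)
qed

lemma openin_quadrant_preimage:
  assumes "openin (top_of_set T1) \<delta>1" "openin (top_of_set T2) \<delta>2"
  shows "openin (top_of_set S) {s\<in>S. fst (fhat s) \<in> \<delta>1 \<and> snd (fhat s) \<in> \<delta>2}"
proof -
  have "openin (top_of_set S) (S \<inter> (fst \<circ> fhat) -` \<delta>1)"
    by (rule continuous_openin_preimage[OF fhat1 _ assms(1)]) (use fhat_in in auto)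
  moreover have "openin (top_of_set S) (S \<inter> (snd \<circ> fhat) -` \<delta>2)"
    by (rule continuous_openin_preimage[OF fhat2 _ assms(2)]) (use fhat_in in auto)
  ultimately have "openin (top_of_set S) ((S \<inter> (fst \<circ> fhat) -` \<delta>1) \<inter> (S \<inter> (snd \<circ> fhat) -` \<delta>2))"
    by (rule openin_Int)
  moreover have "(S \<inter> (fst \<circ> fhat) -` \<delta>1) \<inter> (S \<inter> (snd \<circ> fhat) -` \<delta>2) = {s\<in>S. fst (fhat s) \<in> \<delta>1 \<and> snd (fhat s) \<in> \<delta>2}"
    by auto
  ultimately show ?thesis by simp
qed

text \<open>The curve is lifted from \<open>s\<close>, and after a short positive time the lift is
  still in \<open>N\<close>.\<close>

lemma move_along_curve:
  assumes C: "continuous_on UNIV C" "range C \<subseteq> \<Sigma>" and s: "s \<in> S" "\<pi> s = C 0"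
    and N: "openin (top_of_set S) N" "s \<in> N" and e: "e > (0::real)"
  obtains t s' where "0 < t" "t < e" "s' \<in> N" "\<pi> s' = C t"
proof -
  have "path C" "path_image C \<subseteq> \<Sigma>" "\<pi> s = pathstart C"
    using C s(2) continuous_on_subset[OF C(1)] by (auto simp: path_def path_image_def pathstart_def)
  then obtain r' where r': "path r'" "path_image r' \<subseteq> S" "pathstart r' = s" "\<And>t. t \<in> {0..1} \<Longrightarrow> \<pi> (r' t) = C t"
    "\<And>t. t \<in> {0..1} \<Longrightarrow> r' t \<in> S"
    using path_lift[of C s] s(1) by metis
  have "openin (top_of_set {0..1}) ({0..1} \<inter> r' -` N)"
    by (rule continuous_openin_preimage[OF _ _ N(1)]) (use r'(1,5) in \<open>auto simp: path_def\<close>)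
  moreover have "0 \<in> {0..1} \<inter> r' -` N" using r'(3) N(2) by (simp add: pathstart_def)
  ultimately obtain d where d: "d > 0" "{0..1} \<inter> ball 0 d \<subseteq> {0..1} \<inter> r' -` N" by (rule openin_ballE)
  define t where "t = min (min d e) 1 / 2"
  have t: "0 < t" "t < d" "t < e" "t < 1" using d e by (auto simp: t_def)
  have "t \<in> {0..1} \<inter> ball 0 d" using t by (auto simp: dist_real_def)
  then have "r' t \<in> N" using d(2) by blast
  then show ?thesis using that[of t "r' t"] t r'(4)[of t] by auto
qed

lemma \<Sigma>_not_singleton: assumes "g \<ge> 1" obtains x y where "x \<in> \<Sigma>" "y \<in> \<Sigma>" "x \<noteq> y"
proof -
  let ?\<gamma> = "{x\<in>\<Sigma>. (fst \<circ> f) x = rose_midpoint 1}"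
  have g: "?\<gamma> \<in> diagram_curves g \<Sigma> f" using assms unfolding diagram_curves_def midpoint_preimages_def by auto
  then have "simple_closed_curve ?\<gamma>" using diagram unfolding has_heegaard_diagram_def by blast
  then obtain x where x: "x \<in> ?\<gamma>" unfolding simple_closed_curve_def
    using path_image_nonempty by blast
  obtain C :: "real \<Rightarrow> 'm" where C: "range C \<subseteq> \<Sigma>" "\<And>s t. \<bar>s - t\<bar> < 1 \<Longrightarrow> C s = C t \<Longrightarrow> s = t"
    using diagram_curve[OF g x] by metis
  have "C 0 \<noteq> C (1/2)" using C(2)[of 0 "1/2"] by auto
  moreover have "C 0 \<in> \<Sigma>" "C (1/2) \<in> \<Sigma>" using C(1) by blast+
  ultimately show ?thesis using that by blast
qed

text \<open>Otherwise a neighbourhood of \<open>s\<close> would project to finitely many points, and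
  \<open>\<pi> s\<close> would be isolated in the connected \<open>\<Sigma>\<close>, which has more
  than one point.\<close>

lemma escape_vertices:
  assumes g: "g \<ge> 1" and N: "openin (top_of_set S) N" "s \<in> N"
  obtains s' where "s' \<in> N" "\<pi> s' \<notin> V"
proof (rule ccontr)
  assume "\<not> thesis"
  then have NV: "\<pi> ` N \<subseteq> V" using that by blast
  have "N \<subseteq> S" by (rule openin_imp_subset[OF N(1)])
  then have s: "s \<in> S" using N(2) by blast
  have finV: "finite V" using complex unfolding square_complex_def by blast
  obtain A U \<rho> where A: "s \<in> A" "openin (top_of_set S) A" "\<pi> s \<in> U" "openin (top_of_set \<Sigma>) U" "homeomorphism A U \<pi> \<rho>"
    using covering_space_local_homeomorphism[OF cover_S s] by metis
  have "openin (top_of_set A) (A \<inter> N)"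
    by (rule openin_restrict[OF N(1) openin_imp_subset[OF A(2)]])
  then have "openin (top_of_set U) (\<pi> ` (A \<inter> N))" by (rule homeomorphism_imp_open_map[OF A(5)])
  then have W: "openin (top_of_set \<Sigma>) (\<pi> ` (A \<inter> N))" using A(4) openin_trans by blast
  have fin: "finite (\<pi> ` (A \<inter> N))" using NV finV by (meson Int_lower2 finite_subset image_mono subset_trans)
  have "openin (top_of_set \<Sigma>) (\<pi> ` (A \<inter> N) \<inter> - (\<pi> ` (A \<inter> N) - {\<pi> s}))"
    using fin by (intro openin_Int_open W open_Compl finite_imp_closed) simp
  moreover have "\<pi> ` (A \<inter> N) \<inter> - (\<pi> ` (A \<inter> N) - {\<pi> s}) = {\<pi> s}" using A(1) N(2) by blast
  ultimately have "openin (top_of_set \<Sigma>) {\<pi> s}" by simp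
  moreover have "closedin (top_of_set \<Sigma>) {\<pi> s}" using pi_\<Sigma>[OF s] by (intro closed_subset) auto
  moreover have "connected \<Sigma>"
    using connected_continuous_image[OF covering_space_imp_continuous[OF cover_S] conn_S]
      covering_space_imp_surjective[OF cover_S] by simp
  ultimately have "\<Sigma> = {\<pi> s}" unfolding connected_clopen by blast
  moreover obtain x y where "x \<in> \<Sigma>" "y \<in> \<Sigma>" "x \<noteq> y" using \<Sigma>_not_singleton[OF g] by metis
  ultimately show False by blast
qed

text \<open>Open edges and squares are infinite and \<open>f\<close> is injective on them, so their
  image is not the single point \<open>(0, 0)\<close>.\<close>

lemma cell_types:
  assumes x: "x \<in> \<Sigma>" "x \<notin> V"
  obtains c a b h where "c \<in> open_cells V E Q" "x \<in> c" "a \<in> rose_cells g" "b \<in> rose_cells g"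
    "homeomorphism c (a \<times> b) f h" "a \<noteq> {0} \<or> b \<noteq> {0}"
proof -
  have un: "\<Union>(open_cells V E Q) = \<Sigma>" and injE: "\<And>e. e \<in> E \<Longrightarrow> inj_on e {0<..<1}"
    and injQ: "\<And>s. s \<in> Q \<Longrightarrow> inj_on s ({0<..<1} \<times> {0<..<1})"
    using complex unfolding square_complex_def by blast+
  obtain c where c: "c \<in> open_cells V E Q" "x \<in> c" using un x(1) by blast
  obtain a b h where ab: "a \<in> rose_cells g" "b \<in> rose_cells g" and h: "homeomorphism c (a \<times> b) f h"
    using combinatorial c unfolding combinatorial_to_rose_product_def by blast
  have "infinite c"
  proof -
    have I: "infinite {0<..<1::real}" by simp
    have "c \<in> open_edge ` E \<or> c \<in> open_square ` Q" using c x(2) unfolding open_cells_def by auto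
    then consider e where "e \<in> E" "c = e ` {0<..<1}" | s where "s \<in> Q" "c = s ` ({0<..<1} \<times> {0<..<1})"
      unfolding open_edge_def open_square_def by blast
    then show ?thesis
    proof cases
      case (1 e)
      then show ?thesis using I finite_image_iff[OF injE[OF 1(1)]] by simp
    next
      case (2 s)
      have "infinite ({0<..<1::real} \<times> {0<..<1::real})" using I by (simp add: finite_cartesian_product_iff)
      then show ?thesis using finite_image_iff[OF injQ[OF 2(1)]] 2(2) by simp
    qed
  qed
  moreover have "inj_on f c" by (rule inj_on_inverseI[of _ h]) (rule homeomorphism_apply1[OF h])
  moreover have "f ` c = a \<times> b" by (rule homeomorphism_image1[OF h])
  ultimately have "infinite (a \<times> b)" using finite_imageD by metis
  then have "a \<noteq> {0} \<or> b \<noteq> {0}" by auto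
  then show ?thesis using that c ab h by blast
qed

lemma rose_cell_midpoint:
  assumes "a \<in> rose_cells g" "a \<noteq> {0}"
  obtains k where "k \<in> {1..g}" "a = rose_edge k" "rose_midpoint k \<in> a"
  using assms rose_midpoint_in_edge unfolding rose_cells_def by force

text \<open>A point off the vertices lies over a product with at least one circle factor. If there
  is only one, the point is moved to the midpoint of this factor and thus onto a diagram curve.
  Along the curve one coordinate stays at the midpoint, and local injectivity forces the other away
  from the wedge point, into a cell with two circle factors. The centre is then reached inside that
  cell.\<close>

lemma move_to_centre:
  assumes s: "s \<in> S"
    and d1: "v1 \<in> T1" "\<delta>1 \<in> components (T1 - {v1})" "q1 v1 = 0" "fst (fhat s) \<in> \<delta>1"
    and d2: "v2 \<in> T2" "\<delta>2 \<in> components (T2 - {v2})" "q2 v2 = 0" "snd (fhat s) \<in> \<delta>2"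
  obtains s' k1 k2 where "s' \<in> S" "fst (fhat s') \<in> \<delta>1" "snd (fhat s') \<in> \<delta>2" "k1 \<in> {1..g}" "k2 \<in> {1..g}"
    "f (\<pi> s') = (rose_midpoint k1, rose_midpoint k2)"
proof -
  note thesisI = that
  let ?N = "{s\<in>S. fst (fhat s) \<in> \<delta>1 \<and> snd (fhat s) \<in> \<delta>2}"
  have g: "g \<ge> 1" by (rule T1.direction_imp_pos[OF d1(2,1)])
  have N: "openin (top_of_set S) ?N"
    by (intro openin_quadrant_preimage T1.openin_direction[OF d1(2)] T2.openin_direction[OF d2(2)])
  have zm: "(0::complex) \<noteq> rose_midpoint k" if "k \<in> {1..g}" for k
    using rose_midpoint_in_edge[of k] rose_edge_0[of k] that by auto
  have zero: "a = {0}" if "a \<in> rose_cells g" "0 \<in> a" for a using that rose_edge_0 unfolding rose_cells_def by auto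
  have move: "\<exists>s'\<in>?N. \<pi> s' = y" if "c \<in> open_cells V E Q" "s \<in> ?N" "\<pi> s \<in> c" "y \<in> c" for c s y
    using move_within_cell[OF that(1) _ that(3,4) d1(2,3) _ d2(2,3)] that(2) by (smt (verit) mem_Collect_eq)
  \<comment> \<open>The case of two circle factors, to which the others are reduced.\<close>
  have both: thesis if s: "s \<in> ?N" and fs: "fst (f (\<pi> s)) \<noteq> 0" "snd (f (\<pi> s)) \<noteq> 0" for s
  proof -
    have "\<pi> s \<in> \<Sigma>" using s pi_\<Sigma> by blast
    moreover have "\<Union>(open_cells V E Q) = \<Sigma>" using complex unfolding square_complex_def by blast
    ultimately obtain c where c: "c \<in> open_cells V E Q" "\<pi> s \<in> c" by blast
    then obtain a b h where ab: "a \<in> rose_cells g" "b \<in> rose_cells g" and h: "homeomorphism c (a \<times> b) f h"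
      using combinatorial unfolding combinatorial_to_rose_product_def by blast
    have "f (\<pi> s) \<in> a \<times> b" using homeomorphism_image1[OF h] c(2) by blast
    then have "a \<noteq> {0}" "b \<noteq> {0}" using fs by (auto simp: mem_Times_iff)
    then obtain k1 k2 where k: "k1 \<in> {1..g}" "rose_midpoint k1 \<in> a" "k2 \<in> {1..g}" "rose_midpoint k2 \<in> b"
      using rose_cell_midpoint ab by metis
    then have m: "(rose_midpoint k1, rose_midpoint k2) \<in> a \<times> b" by simp
    let ?y = "h (rose_midpoint k1, rose_midpoint k2)"
    have "?y \<in> c" using homeomorphism_image2[OF h] m by blast
    moreover have "f ?y = (rose_midpoint k1, rose_midpoint k2)" using homeomorphism_apply2[OF h m] .
    ultimately show thesis using move[OF c(1) s c(2)] thesisI k by (smt (verit) mem_Collect_eq)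
  qed
  obtain s1 where s1: "s1 \<in> ?N" "\<pi> s1 \<notin> V"
    using escape_vertices[OF g N, of s] s d1(4) d2(4) by blast
  have "\<pi> s1 \<in> \<Sigma>" using s1 pi_\<Sigma> by blast
  then obtain c a b h where c: "c \<in> open_cells V E Q" "\<pi> s1 \<in> c" and ab: "a \<in> rose_cells g" "b \<in> rose_cells g"
    and h: "homeomorphism c (a \<times> b) f h" and n0: "a \<noteq> {0} \<or> b \<noteq> {0}"
    using s1(2) by (rule cell_types)
  have fc: "f (\<pi> s1) \<in> a \<times> b" using homeomorphism_image1[OF h] c(2) by blast
  consider "a \<noteq> {0}" "b \<noteq> {0}" | "a \<noteq> {0}" "b = {0}" | "a = {0}" "b \<noteq> {0}" using n0 by blast
  then show thesis
  proof cases
    case 1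
    then have "fst (f (\<pi> s1)) \<noteq> 0" "snd (f (\<pi> s1)) \<noteq> 0"
      using fc zero[OF ab(1)] zero[OF ab(2)] unfolding mem_Times_iff by metis+
    then show thesis by (rule both[OF s1(1)])
  next
    case 2
    obtain k where k: "k \<in> {1..g}" "rose_midpoint k \<in> a" using rose_cell_midpoint[OF ab(1) 2(1)] by metis
    have m: "(rose_midpoint k, 0) \<in> a \<times> b" using k 2 by simp
    have y: "h (rose_midpoint k, 0) \<in> c" using homeomorphism_image2[OF h] m by blast
    have fy: "f (h (rose_midpoint k, 0)) = (rose_midpoint k, 0)" using homeomorphism_apply2[OF h m] .
    obtain s2 where s2: "s2 \<in> ?N" "\<pi> s2 = h (rose_midpoint k, 0)" using move[OF c(1) s1(1) c(2) y] by blast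
    have s2S: "s2 \<in> S" using s2(1) by blast
    have fk: "fst (f (\<pi> s2)) = rose_midpoint k" using s2(2) fy by simp
    obtain C :: "real \<Rightarrow> 'm" where C: "continuous_on UNIV C" "range C \<subseteq> \<Sigma>" "C 0 = \<pi> s2"
      "\<forall>t. fst (f (C t)) = rose_midpoint k" "\<forall>t. \<exists>e>0. inj_on (f \<circ> C) (ball t e)"
      by (rule diagram_curve1[OF pi_\<Sigma>[OF s2S] k(1) fk]) (rule that)
    obtain e where e: "e > 0" "inj_on (f \<circ> C) (ball 0 e)" using C(5) by blast
    obtain t s3 where t: "0 < t" "t < e" "s3 \<in> ?N" "\<pi> s3 = C t"
      by (rule move_along_curve[OF C(1,2) s2S C(3)[symmetric] N s2(1) e(1)])
    have "f (C t) \<noteq> f (C 0)" using inj_onD[OF e(2), of t 0] t e(1) by (auto simp: dist_real_def)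
    then have "snd (f (\<pi> s3)) \<noteq> 0" using C(3,4) s2(2) fy t(4) by (metis prod_eq_iff snd_conv)
    moreover have "fst (f (\<pi> s3)) \<noteq> 0" using C(4) t(4) zm[OF k(1)] by simp
    ultimately show thesis using both[OF t(3)] by blast
  next
    case 3
    obtain k where k: "k \<in> {1..g}" "rose_midpoint k \<in> b" using rose_cell_midpoint[OF ab(2) 3(2)] by metis
    have m: "(0, rose_midpoint k) \<in> a \<times> b" using k 3 by simp
    have y: "h (0, rose_midpoint k) \<in> c" using homeomorphism_image2[OF h] m by blast
    have fy: "f (h (0, rose_midpoint k)) = (0, rose_midpoint k)" using homeomorphism_apply2[OF h m] .
    obtain s2 where s2: "s2 \<in> ?N" "\<pi> s2 = h (0, rose_midpoint k)" using move[OF c(1) s1(1) c(2) y] by blast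
    have s2S: "s2 \<in> S" using s2(1) by blast
    have fk: "snd (f (\<pi> s2)) = rose_midpoint k" using s2(2) fy by simp
    obtain C :: "real \<Rightarrow> 'm" where C: "continuous_on UNIV C" "range C \<subseteq> \<Sigma>" "C 0 = \<pi> s2"
      "\<forall>t. snd (f (C t)) = rose_midpoint k" "\<forall>t. \<exists>e>0. inj_on (f \<circ> C) (ball t e)"
      by (rule diagram_curve2[OF pi_\<Sigma>[OF s2S] k(1) fk]) (rule that)
    obtain e where e: "e > 0" "inj_on (f \<circ> C) (ball 0 e)" using C(5) by blast
    obtain t s3 where t: "0 < t" "t < e" "s3 \<in> ?N" "\<pi> s3 = C t"
      by (rule move_along_curve[OF C(1,2) s2S C(3)[symmetric] N s2(1) e(1)])
    have "f (C t) \<noteq> f (C 0)" using inj_onD[OF e(2), of t 0] t e(1) by (auto simp: dist_real_def)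
    then have "fst (f (\<pi> s3)) \<noteq> 0" using C(3,4) s2(2) fy t(4) by (metis prod_eq_iff fst_conv)
    moreover have "snd (f (\<pi> s3)) \<noteq> 0" using C(4) t(4) zm[OF k(1)] by simp
    ultimately show thesis using both[OF t(3)] by blast
  qed
qed

lemma action_displacement:
  assumes "y1 \<in> T1" "z1 \<in> T1" "y2 \<in> T2" "z2 \<in> T2"
  obtains B where "B \<ge> 0" "\<And>\<alpha>. \<alpha> \<in> carrier \<Gamma> \<Longrightarrow> dist (act1 \<alpha> y1) (act1 \<alpha> z1) \<le> B"
    "\<And>\<alpha>. \<alpha> \<in> carrier \<Gamma> \<Longrightarrow> dist (act2 \<alpha> y2) (act2 \<alpha> z2) \<le> B"
proof -
  obtain B1 where B1: "\<And>h. T1.deck h \<Longrightarrow> dist (h y1) (h z1) \<le> B1"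
    using T1.deck_displacement_bounded[OF assms(1,2)] by metis
  obtain B2 where B2: "\<And>h. T2.deck h \<Longrightarrow> dist (h y2) (h z2) \<le> B2"
    using T2.deck_displacement_bounded[OF assms(3,4)] by metis
  let ?B = "max 0 (max B1 B2)"
  have "dist (act1 \<alpha> y1) (act1 \<alpha> z1) \<le> ?B \<and> dist (act2 \<alpha> y2) (act2 \<alpha> z2) \<le> ?B" if \<alpha>: "\<alpha> \<in> carrier \<Gamma>" for \<alpha>
  proof -
    obtain h1 h2 where "T1.deck h1" "T2.deck h2" "\<And>y. y \<in> T1 \<Longrightarrow> act1 \<alpha> y = h1 y" "\<And>y. y \<in> T2 \<Longrightarrow> act2 \<alpha> y = h2 y"
      by (rule action[OF \<alpha>]) blast
    then show ?thesis using B1[of h1] B2[of h2] assms by (simp add: le_max_iff_disj)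
  qed
  then show ?thesis using that[of ?B] by simp
qed

lemma action_in:
  assumes "\<alpha> \<in> carrier \<Gamma>" shows "y \<in> T1 \<Longrightarrow> act1 \<alpha> y \<in> T1" "z \<in> T2 \<Longrightarrow> act2 \<alpha> z \<in> T2"
proof -
  obtain h1 h2 where "T1.deck h1" "T2.deck h2" "\<And>y. y \<in> T1 \<Longrightarrow> act1 \<alpha> y = h1 y" "\<And>y. y \<in> T2 \<Longrightarrow> act2 \<alpha> y = h2 y"
    using action[OF assms] by metis
  then show "y \<in> T1 \<Longrightarrow> act1 \<alpha> y \<in> T1" "z \<in> T2 \<Longrightarrow> act2 \<alpha> z \<in> T2" using T1.deck_in_T T2.deck_in_T by simp_all
qed

lemma image_quadrant_heavy:
  assumes s: "s \<in> S" and u: "u1 \<in> T1" "u2 \<in> T2"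
    and d1: "x1 \<in> T1" "\<delta>1 \<in> components (T1 - {x1})" "fst (fhat s) \<in> \<delta>1"
    and d2: "x2 \<in> T2" "\<delta>2 \<in> components (T2 - {x2})" "snd (fhat s) \<in> \<delta>2"
  shows "heavy \<Gamma> act1 act2 u1 u2 (\<delta>1 \<times> \<delta>2)"
proof -
  obtain v1 \<delta>1' where e1: "v1 \<in> T1" "q1 v1 = 0" "\<delta>1' \<in> components (T1 - {v1})" "\<delta>1 \<subseteq> \<delta>1'"
    "\<And>y. y \<in> \<delta>1' \<Longrightarrow> y \<notin> \<delta>1 \<Longrightarrow> dist x1 y \<le> 1"
    using T1.direction_enlarge[OF d1(2,1)] by metis
  obtain v2 \<delta>2' where e2: "v2 \<in> T2" "q2 v2 = 0" "\<delta>2' \<in> components (T2 - {v2})" "\<delta>2 \<subseteq> \<delta>2'"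
    "\<And>y. y \<in> \<delta>2' \<Longrightarrow> y \<notin> \<delta>2 \<Longrightarrow> dist x2 y \<le> 1"
    using T2.direction_enlarge[OF d2(2,1)] by metis
  have "fst (fhat s) \<in> \<delta>1'" "snd (fhat s) \<in> \<delta>2'" using d1(3) d2(3) e1(4) e2(4) by auto
  then obtain c k1 k2 where c: "c \<in> S" "fst (fhat c) \<in> \<delta>1'" "snd (fhat c) \<in> \<delta>2'" "k1 \<in> {1..g}" "k2 \<in> {1..g}"
    "f (\<pi> c) = (rose_midpoint k1, rose_midpoint k2)"
    using move_to_centre[OF s e1(1,3,2) _ e2(1,3,2)] by metis
  let ?w1 = "fst (fhat c)" and ?w2 = "snd (fhat c)"
  have w: "?w1 \<in> T1" "?w2 \<in> T2" using fhat_in c(1) by simp_all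
  obtain B where B: "B \<ge> 0" "\<And>\<alpha>. \<alpha> \<in> carrier \<Gamma> \<Longrightarrow> dist (act1 \<alpha> ?w1) (act1 \<alpha> u1) \<le> B"
    "\<And>\<alpha>. \<alpha> \<in> carrier \<Gamma> \<Longrightarrow> dist (act2 \<alpha> ?w2) (act2 \<alpha> u2) \<le> B"
    using action_displacement[OF w(1) u(1) w(2) u(2)] by metis
  \<comment> \<open>\<open>B\<close> is the cost of the change of base point, and 1 bounds the
    excess of the enlarged directions. The remaining terms turn displacements of \<open>?w1\<close>
    and \<open>?w2\<close> into distances from the base points of the directions.\<close>
  define K where "K = B + 1 + dist ?w1 v1 + dist ?w1 x1 + dist ?w2 v2 + dist ?w2 x2"
  show ?thesis
  proof (rule heavy_change_base[OF centre_heavy[OF c(1,4,5,6) e1(3) c(2) e2(3) c(3)] B(2,3)])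
    fix \<alpha> assume a: "\<alpha> \<in> carrier \<Gamma>" "(act1 \<alpha> ?w1, act2 \<alpha> ?w2) \<in> \<delta>1' \<times> \<delta>2'"
      "dist ?w1 (act1 \<alpha> ?w1) > K" "dist ?w2 (act2 \<alpha> ?w2) > K"
    have in1: "act1 \<alpha> ?w1 \<in> \<delta>1'" and in2: "act2 \<alpha> ?w2 \<in> \<delta>2'" using a(2) by auto
    have "dist ?w1 (act1 \<alpha> ?w1) > B + 1 + dist ?w1 v1 + dist ?w1 x1"
      using a(3) zero_le_dist[of ?w2 v2] zero_le_dist[of ?w2 x2] unfolding K_def by linarith
    note f1 = dist_far_move[OF this B(2)[OF a(1)]]
    have "dist ?w2 (act2 \<alpha> ?w2) > B + 1 + dist ?w2 v2 + dist ?w2 x2"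
      using a(4) zero_le_dist[of ?w1 v1] zero_le_dist[of ?w1 x1] unfolding K_def by linarith
    note f2 = dist_far_move[OF this B(3)[OF a(1)]]
    \<comment> \<open>So far from \<open>v1\<close> a move by at most \<open>B\<close> stays in
      \<open>\<delta>1'\<close>, and at distance more than 1 from \<open>x1\<close> the direction
      \<open>\<delta>1'\<close> has no points outside \<open>\<delta>1\<close>.\<close>
    have "act1 \<alpha> u1 \<in> \<delta>1'"
      by (rule T1.far_in_direction[OF e1(3) in1 action_in(1)[OF a(1) u(1)] le_less_trans[OF B(2)[OF a(1)] f1(1)]])
    moreover have "act2 \<alpha> u2 \<in> \<delta>2'"
      by (rule T2.far_in_direction[OF e2(3) in2 action_in(2)[OF a(1) u(2)] le_less_trans[OF B(3)[OF a(1)] f2(1)]])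
    ultimately show "(act1 \<alpha> u1, act2 \<alpha> u2) \<in> \<delta>1 \<times> \<delta>2"
      using e1(5) e2(5) f1(2) f2(2) by (metis SigmaI not_le)
  qed
qed

section \<open>Minimality of the core\<close>

lemma core_minimal:
  assumes X: "X \<subseteq> T1 \<times> T2" "fhat ` S \<subseteq> X" "fibres_connected T1 T2 X" and u: "u1 \<in> T1" "u2 \<in> T2"
  shows "guirardel_core \<Gamma> T1 act1 T2 act2 u1 u2 \<subseteq> X"
proof (rule subrelI, rule ccontr)
  fix x1 x2 assume core: "(x1, x2) \<in> guirardel_core \<Gamma> T1 act1 T2 act2 u1 u2" and nX: "(x1, x2) \<notin> X"
  have x: "x1 \<in> T1" "x2 \<in> T2" using core unfolding guirardel_core_def by auto
  have hv: "heavy \<Gamma> act1 act2 u1 u2 (D1 \<times> D2)" if "D1 \<in> components (T1 - {y1})" "y1 \<in> T1" "x1 \<in> D1"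
    "D2 \<in> components (T2 - {y2})" "y2 \<in> T2" "x2 \<in> D2" for D1 D2 y1 y2
    using core that unfolding guirardel_core_def quadrants_def directions_def by blast
  \<comment> \<open>For \<open>g = 0\<close> both trees are points, and \<open>fhat s0\<close> is
    the only point of the product.\<close>
  have g: "g \<ge> 1"
  proof (rule ccontr)
    assume "\<not> g \<ge> 1"
    then have g0: "g = 0" by simp
    have "fhat s0 = (x1, x2)"
      using T1.trivial_tree[OF g0 fhat_in(1)[OF s0] x(1)] T2.trivial_tree[OF g0 fhat_in(2)[OF s0] x(2)]
      by (simp add: prod_eq_iff)
    then show False using nX X(2) s0 by auto
  qed
  \<comment> \<open>The fibres of \<open>X\<close> may be empty; an empty one still lies in a
    direction, provided that there is one.\<close>
  have ne1: "T1 - {x1} \<noteq> {}" using T1.nontrivial_tree[OF g x(1)] by blast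
  have ne2: "T2 - {x2} \<noteq> {}" using T2.nontrivial_tree[OF g x(2)] by blast
  let ?F2 = "{y. (x1, y) \<in> X}" and ?F1 = "{y. (y, x2) \<in> X}"
  have "connected (snd ` (fst -` {x1} \<inter> X))"
    using X(3) x(1) unfolding fibres_connected_def by (intro connected_continuous_image continuous_on_snd continuous_on_id) auto
  moreover have "snd ` (fst -` {x1} \<inter> X) = ?F2" by force
  ultimately have "connected ?F2" by simp
  moreover have "?F2 \<subseteq> T2 - {x2}" using nX X(1) by auto
  ultimately obtain \<delta>2 where d2: "\<delta>2 \<in> components (T2 - {x2})" "?F2 \<subseteq> \<delta>2"
    using exists_component_superset[OF _ ne2] by blast
  have "connected (fst ` (snd -` {x2} \<inter> X))"
    using X(3) x(2) unfolding fibres_connected_def by (intro connected_continuous_image continuous_on_fst continuous_on_id) auto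
  moreover have "fst ` (snd -` {x2} \<inter> X) = ?F1" by force
  ultimately have "connected ?F1" by simp
  moreover have "?F1 \<subseteq> T1 - {x1}" using nX X(1) by auto
  ultimately obtain \<delta>1 where d1: "\<delta>1 \<in> components (T1 - {x1})" "?F1 \<subseteq> \<delta>1"
    using exists_component_superset[OF _ ne1] by blast
  have fX: "(fst (fhat s), snd (fhat s)) \<in> X" if "s \<in> S" for s using X(2) that by auto
  obtain \<eta>1 \<eta>2 where e1: "\<eta>1 \<in> components (T1 - {x1})" and e2: "\<eta>2 \<in> components (T2 - {x2})"
    and empty: "\<And>s. s \<in> S \<Longrightarrow> fst (fhat s) \<noteq> x1 \<Longrightarrow> fst (fhat s) \<notin> \<eta>1 \<Longrightarrow> snd (fhat s) \<noteq> x2 \<Longrightarrow> snd (fhat s) \<notin> \<eta>2 \<Longrightarrow> False"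
  proof -
    let ?W = "{s\<in>S. fst (fhat s) \<in> T1 - {x1} - \<delta>1 \<and> snd (fhat s) \<in> T2 - {x2} - \<delta>2}"
    have o1: "openin (top_of_set T1) (T1 - {x1} - \<delta>1)"
      unfolding in_components_unions_complement[OF d1(1)] by (intro openin_Union) (use T1.openin_direction in auto)
    have o2: "openin (top_of_set T2) (T2 - {x2} - \<delta>2)"
      unfolding in_components_unions_complement[OF d2(1)] by (intro openin_Union) (use T2.openin_direction in auto)
    have oW: "openin (top_of_set S) ?W" by (rule openin_quadrant_preimage[OF o1 o2])
    have "closedin (top_of_set S) ?W"
    proof -
      have c1: "openin (top_of_set S) (S \<inter> (fst \<circ> fhat) -` \<delta>1)"
        by (rule continuous_openin_preimage[OF fhat1 _ T1.openin_direction[OF d1(1)]]) (use fhat_in in auto)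
      have c2: "openin (top_of_set S) (S \<inter> (snd \<circ> fhat) -` \<delta>2)"
        by (rule continuous_openin_preimage[OF fhat2 _ T2.openin_direction[OF d2(1)]]) (use fhat_in in auto)
      have "?W = S - ((S \<inter> (fst \<circ> fhat) -` \<delta>1) \<union> (S \<inter> (snd \<circ> fhat) -` \<delta>2))"
      proof (intro equalityI subsetI)
        fix s assume s: "s \<in> S - ((S \<inter> (fst \<circ> fhat) -` \<delta>1) \<union> (S \<inter> (snd \<circ> fhat) -` \<delta>2))"
        then have sS: "s \<in> S" and nd: "fst (fhat s) \<notin> \<delta>1" "snd (fhat s) \<notin> \<delta>2" by auto
        \<comment> \<open>This is where the fibres enter: an image point over \<open>x1\<close> has
          its second coordinate in \<open>\<delta>2\<close>, and one over \<open>x2\<close> has its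
          first in \<open>\<delta>1\<close>. So avoiding both directions already excludes both base
          points, and \<open>?W\<close> is closed.\<close>
        have "fst (fhat s) \<noteq> x1" "snd (fhat s) \<noteq> x2"
          using fX[OF sS] d1(2) d2(2) nd by blast+
        then show "s \<in> ?W" using s fhat_in by auto
      qed auto
      then show ?thesis using closedin_diff[OF closedin_subtopology_refl[THEN iffD2, of S] openin_Un[OF c1 c2]] by auto
    qed
    then consider "?W = {}" | "?W = S" using conn_S oW unfolding connected_clopen by blast
    then show thesis
    proof cases
      case 1
      show thesis by (rule that[OF d1(1) d2(1)]) (use 1 fhat_in in blast)
    next
      case 2
      \<comment> \<open>The image misses \<open>x1\<close> in the first and \<open>x2\<close> in the
        second coordinate, so each projection lies in a single direction. With these two directions
        no point is left to exclude.\<close>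
      have "connected ((fst \<circ> fhat) ` S)" "connected ((snd \<circ> fhat) ` S)"
        by (intro connected_continuous_image fhat1 fhat2 conn_S)+
      moreover have "(fst \<circ> fhat) ` S \<subseteq> T1 - {x1}" "(snd \<circ> fhat) ` S \<subseteq> T2 - {x2}" using 2 by auto
      ultimately obtain \<eta>1 \<eta>2 where "\<eta>1 \<in> components (T1 - {x1})" "(fst \<circ> fhat) ` S \<subseteq> \<eta>1"
        "\<eta>2 \<in> components (T2 - {x2})" "(snd \<circ> fhat) ` S \<subseteq> \<eta>2"
        using exists_component_superset[OF _ ne1] exists_component_superset[OF _ ne2] by meson
      then show thesis using that[of \<eta>1 \<eta>2] by auto
    qed
  qed
  obtain y1 D1 where D1: "y1 \<in> T1" "D1 \<in> components (T1 - {y1})" "x1 \<in> D1" "\<And>y. y \<in> D1 \<Longrightarrow> y \<in> \<eta>1 \<Longrightarrow> dist x1 y \<le> 1"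
    using T1.direction_shrink[OF e1 x(1)] by metis
  obtain y2 D2 where D2: "y2 \<in> T2" "D2 \<in> components (T2 - {y2})" "x2 \<in> D2" "\<And>y. y \<in> D2 \<Longrightarrow> y \<in> \<eta>2 \<Longrightarrow> dist x2 y \<le> 1"
    using T2.direction_shrink[OF e2 x(2)] by metis
  let ?t1 = "fst (fhat s0)" and ?t2 = "snd (fhat s0)"
  have t: "?t1 \<in> T1" "?t2 \<in> T2" using fhat_in s0 by simp_all
  obtain B where B: "B \<ge> 0" "\<And>\<alpha>. \<alpha> \<in> carrier \<Gamma> \<Longrightarrow> dist (act1 \<alpha> u1) (act1 \<alpha> ?t1) \<le> B"
    "\<And>\<alpha>. \<alpha> \<in> carrier \<Gamma> \<Longrightarrow> dist (act2 \<alpha> u2) (act2 \<alpha> ?t2) \<le> B"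
    using action_displacement[OF u(1) t(1) u(2) t(2)] by metis
  \<comment> \<open>As \<open>(x1, x2)\<close> is in the core, \<open>D1 \<times> D2\<close> is
    heavy. The margin \<open>B + 1\<close> pays for the change to the base point
    \<open>fhat s0\<close> and for the overlap of \<open>D1\<close> with \<open>\<eta>1\<close> and
    of \<open>D2\<close> with \<open>\<eta>2\<close>; the other terms turn displacements into
    distances from \<open>x1\<close> and \<open>x2\<close>.\<close>
  obtain \<alpha> where a: "\<alpha> \<in> carrier \<Gamma>" "(act1 \<alpha> u1, act2 \<alpha> u2) \<in> D1 \<times> D2"
    "dist u1 (act1 \<alpha> u1) > B + 1 + dist u1 x1 + dist u2 x2" "dist u2 (act2 \<alpha> u2) > B + 1 + dist u1 x1 + dist u2 x2"
    using heavy_far_element[OF hv[OF D1(2,1,3) D2(2,1,3)]] by metis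
  have f1: "dist x1 (act1 \<alpha> u1) > B + 1"
    using a(3) dist_triangle[of u1 "act1 \<alpha> u1" x1] zero_le_dist[of u2 x2] by linarith
  have f2: "dist x2 (act2 \<alpha> u2) > B + 1"
    using a(4) dist_triangle[of u2 "act2 \<alpha> u2" x2] zero_le_dist[of u1 x1] by linarith
  have in1: "act1 \<alpha> u1 \<in> D1" and in2: "act2 \<alpha> u2 \<in> D2" using a(2) by auto
  have n1: "act1 \<alpha> ?t1 \<noteq> x1" "act1 \<alpha> ?t1 \<notin> \<eta>1"
    using T1.shrunk_direction_far[OF e1 D1(4) in1 action_in(1)[OF a(1) u(1)] _ action_in(1)[OF a(1) t(1)]]
      f1 B(1) B(2)[OF a(1)] by simp_all
  have n2: "act2 \<alpha> ?t2 \<noteq> x2" "act2 \<alpha> ?t2 \<notin> \<eta>2"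
    using T2.shrunk_direction_far[OF e2 D2(4) in2 action_in(2)[OF a(1) u(2)] _ action_in(2)[OF a(1) t(2)]]
      f2 B(1) B(3)[OF a(1)] by simp_all
  \<comment> \<open>The translate of \<open>fhat s0\<close> is again a point of the image, and it
    lies where \<open>empty\<close> allows none.\<close>
  obtain h1 h2 s where "\<And>y. y \<in> T1 \<Longrightarrow> act1 \<alpha> y = h1 y" "\<And>y. y \<in> T2 \<Longrightarrow> act2 \<alpha> y = h2 y"
    and s: "s \<in> S" "h1 ?t1 = fst (fhat s)" "h2 ?t2 = snd (fhat s)"
    using action[OF a(1)] by metis
  then have "act1 \<alpha> ?t1 = fst (fhat s)" "act2 \<alpha> ?t2 = snd (fhat s)" using t by simp_all
  then show False using empty[OF s(1)] n1 n2 by simp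
qed

end

section \<open>The core as the smallest set with connected fibres around the image\<close>

theorem theorem5p7:
  fixes g :: nat
    and M H1 H2 \<Sigma> :: "'m::t2_space set"
    and f :: "'m \<Rightarrow> complex \<times> complex"
    and V :: "'m set" and E :: "(real \<Rightarrow> 'm) set" and Q :: "(real \<times> real \<Rightarrow> 'm) set"
    and T1 :: "'a::metric_space set" and q1 :: "'a \<Rightarrow> complex"
    and T2 :: "'b::metric_space set" and q2 :: "'b \<Rightarrow> complex"
    and S :: "'s::topological_space set" and \<pi> :: "'s \<Rightarrow> 'm" and s0 :: 's
    and fhat :: "'s \<Rightarrow> 'a \<times> 'b"
    and u1 :: 'a and u2 :: 'b
    and core :: "('a \<times> 'b) set"
  assumes "closed_3manifold M" "orientable_3manifold M" "\<not> S2xS1_summand M"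
    and "heegaard_splitting g M H1 H2 \<Sigma>"
    and "stallings_map g H1 H2 \<Sigma> f" "locally_injective \<Sigma> f"
    and "has_heegaard_diagram g \<Sigma> f" "taut g \<Sigma> f"
    and "square_complex \<Sigma> V E Q"
    and "dual_to_diagram \<Sigma> (\<Union>(midpoint_preimages g \<Sigma> (fst \<circ> f)))
           (\<Union>(midpoint_preimages g \<Sigma> (snd \<circ> f))) V E Q"
    and "combinatorial_to_rose_product g f V E Q"
    and "rose_universal_cover g T1 q1" "rose_universal_cover g T2 q2"
    and "covering_space S \<pi> \<Sigma>" "connected S" "s0 \<in> S"
    and "pi1_map \<Sigma> \<pi> ` carrier (pi1 S s0) =
         kernel (pi1 \<Sigma> (\<pi> s0)) (pi1 (rose g \<times> rose g) (f (\<pi> s0))) (pi1_map (rose g \<times> rose g) f)"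
    and "continuous_on S fhat" "fhat ` S \<subseteq> T1 \<times> T2"
    and "\<forall>s\<in>S. map_prod q1 q2 (fhat s) = f (\<pi> s)"
    and "u1 \<in> T1" "u2 \<in> T2"
    and core_eq: "core = guirardel_core (pi1 \<Sigma> (\<pi> s0))
           T1 (\<lambda>\<alpha>. deck_action T1 q1 (fst (fhat s0)) (pi1_map (rose g) (fst \<circ> f) \<alpha>))
           T2 (\<lambda>\<alpha>. deck_action T2 q2 (snd (fhat s0)) (pi1_map (rose g) (snd \<circ> f) \<alpha>))
           u1 u2"
  shows "core \<subseteq> T1 \<times> T2 \<and> fhat ` S \<subseteq> core \<and> fibres_connected T1 T2 core \<and>
         (\<forall>X. X \<subseteq> T1 \<times> T2 \<and> fhat ` S \<subseteq> X \<and> fibres_connected T1 T2 X \<longrightarrow> core \<subseteq> X)"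
proof -
  interpret combinatorial_lift g T1 q1 T2 q2 \<Sigma> f V E Q S \<pi> s0 fhat
  proof unfold_locales
    show "continuous_on \<Sigma> f"
      using \<open>stallings_map g H1 H2 \<Sigma> f\<close> unfolding stallings_map_def by (elim conjE)
    show "f ` \<Sigma> \<subseteq> rose g \<times> rose g"
      using \<open>stallings_map g H1 H2 \<Sigma> f\<close> unfolding stallings_map_def by (elim conjE)
    show "map_prod q1 q2 (fhat s) = f (\<pi> s)" if "s \<in> S" for s
      using \<open>\<forall>s\<in>S. map_prod q1 q2 (fhat s) = f (\<pi> s)\<close> that by (rule bspec)
  qed fact+
  have core: "core = guirardel_core \<Gamma> T1 act1 T2 act2 u1 u2" by (rule core_eq)
  have "fhat s \<in> core" if s: "s \<in> S" for s
    using image_quadrant_heavy[OF s \<open>u1 \<in> T1\<close> \<open>u2 \<in> T2\<close>] fhat_T s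
    unfolding core guirardel_core_def quadrants_def directions_def by fastforce
  moreover have "fibres_connected T1 T2 core"
    unfolding core by (rule guirardel_core_fibres_connected) unfold_locales
  moreover have "core \<subseteq> X" if "X \<subseteq> T1 \<times> T2" "fhat ` S \<subseteq> X" "fibres_connected T1 T2 X" for X
    unfolding core by (rule core_minimal[OF that \<open>u1 \<in> T1\<close> \<open>u2 \<in> T2\<close>])
  moreover have "core \<subseteq> T1 \<times> T2" unfolding core guirardel_core_def by blast
  ultimately show ?thesis by blast
qed

end
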